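(* Let $\alpha$ be a real number such that $\alpha+2$ is zero or a negative integer. Let $\varphi(z)=\dfrac{az+b}{cz+d}$ be a linear fractional self-map of the unit disk $\mathbb{D}$, and let $\sigma(z)=\dfrac{\bar a z-\bar c}{-\bar b z+\bar d}$ be its Kreĭn adjoint. Let $g(z)=(-\bar b z+\bar d)^{-\alpha-2}$ and $h(z)=(cz+d)^{\alpha+2}$ for $z\in\mathbb{D}$. Then the operator $C_\varphi^{*}-M_gC_\sigma M_h^{*}$ has finite rank on $A^2_\alpha$.
   Context: $\mathbb{D}$ is the open unit disk in $\mathbb{C}$. A linear fractional self-map of $\mathbb{D}$ is a map $\varphi(z)=(az+b)/(cz+d)$ with $a,b,c,d\in\mathbb{C}$, $ad-bc\neq 0$ and $\varphi(\mathbb{D})\subset\mathbb{D}$; its Kreĭn adjoint $\sigma$ is then also a self-map of $\mathbb{D}$, and $cz+d$ and $-\bar bz+\bar d$ do not vanish on the closed unit disk. For an analytic $\psi:\mathbb{D}\to\mathbb{D}$, $C_\psi f=f\circ\psi$ is the composition operator; $M_u f=uf$ is the multiplication operator with symbol $u$. Adjoints are taken in $A^2_\alpha$; all the operators $C_\varphi, C_\sigma, M_g, M_h$ are bounded on $A^2_\alpha$. For $\alpha\in\mathbb{R}$, $A^2_\alpha$ is the space of holomorphic functions $f$ on $\mathbb{D}$ for which there is an integer $k\ge 0$ with $\alpha+2k>-1$ such that $(1-|z|^2)^kf^{(k)}(z)\in L^2(\mathbb{D},dA_\alpha)$, where $dA_\alpha(z)=(1-|z|^2)^\alpha dA(z)$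 and $dA$ is area measure. When $\alpha+2=-N$ with $N\geq 0$ an integer, $A^2_\alpha$ is a reproducing kernel Hilbert space under the inner product whose reproducing kernel is $$K_\alpha(z,w)=(\bar w z-1)^N\log\Big(\frac{1}{1-\bar w z}\Big)+Q(\bar w z),$$ where $\log$ is the principal branch and $Q$ is a fixed analytic polynomial of degree $N$ (such that all Taylor coefficients of $K_\alpha$ in $z\bar w$ are positive). The monomials $z^m$, $m\ge0$, form an orthogonal basis of $A^2_\alpha$, and $\|z^m\|_\alpha^{-2}$ is the coefficient of $(z\bar w)^m$ in $K_\alpha$. *)

theory Defs
  imports
    "HOL-Complex_Analysis.Complex_Analysis"
    "HOL-Library.Function_Algebras"
begin

abbreviation unit_disk :: "complex set" where
  "unit_disk \<equiv> ball 0 1"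

definition dA :: "real \<Rightarrow> complex measure" where
  "dA \<alpha> = density (restrict_space lborel unit_disk) (\<lambda>z. ennreal ((1 - (cmod z)\<^sup>2) powr \<alpha>))"

definition L2 :: "complex measure \<Rightarrow> (complex \<Rightarrow> complex) set" where
  "L2 M = {F. F \<in> borel_measurable M \<and> integrable M (\<lambda>z. (cmod (F z))\<^sup>2)}"

text \<open>A function on the disk is represented by the total function that extends it by 0, so
  that elements of the space are equal as functions if and only if they agree on the disk.\<close>

definition A2 :: "real \<Rightarrow> (complex \<Rightarrow> complex) set" where
  "A2 \<alpha> = {f. f holomorphic_on unit_disk \<and> (\<forall>z. z \<notin> unit_disk \<longrightarrow> f z = 0) \<and>
      (\<exists>k::nat. \<alpha> + 2 * real k > -1 \<and>
         (\<lambda>z. of_real ((1 - (cmod z)\<^sup>2) ^ k) * (deriv ^^ k) f z) \<in> L2 (dA \<alpha>))}"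

text \<open>The kernel is a function of \<open>x = cnj w * z\<close>.\<close>

definition kernel_fun :: "nat \<Rightarrow> complex poly \<Rightarrow> complex \<Rightarrow> complex" where
  "kernel_fun N Q x = (x - 1) ^ N * Ln (1 / (1 - x)) + poly Q x"

definition A2_kernel :: "nat \<Rightarrow> complex poly \<Rightarrow> complex \<Rightarrow> complex \<Rightarrow> complex" where
  "A2_kernel N Q w z = (if z \<in> unit_disk then kernel_fun N Q (cnj w * z) else 0)"

abbreviation taylor_coeff :: "(complex \<Rightarrow> complex) \<Rightarrow> nat \<Rightarrow> complex" where
  "taylor_coeff f m \<equiv> fps_nth (fps_expansion f 0) m"

definition admissible_poly :: "nat \<Rightarrow> complex poly \<Rightarrow> bool" where
  "admissible_poly N Q \<longleftrightarrow> degree Q = N \<and>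
     (\<forall>m. taylor_coeff (kernel_fun N Q) m \<in> \<real> \<and> 0 < Re (taylor_coeff (kernel_fun N Q) m))"

text \<open>The inner product for which the monomials are orthogonal and the squared norm of \<open>z ^ m\<close>
  is the reciprocal of the \<open>m\<close>-th Taylor coefficient of the kernel; it is linear in the first
  argument. That \<^const>\<open>A2_kernel\<close> is its reproducing kernel is shown below.\<close>

definition A2_inner ::
  "nat \<Rightarrow> complex poly \<Rightarrow> (complex \<Rightarrow> complex) \<Rightarrow> (complex \<Rightarrow> complex) \<Rightarrow> complex" where
  "A2_inner N Q f g =
     (\<Sum>m. taylor_coeff f m * cnj (taylor_coeff g m) / taylor_coeff (kernel_fun N Q) m)"

definition comp_op :: "(complex \<Rightarrow> complex) \<Rightarrow> (complex \<Rightarrow> complex) \<Rightarrow> complex \<Rightarrow> complex" where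
  "comp_op \<psi> f = (\<lambda>z. if z \<in> unit_disk then f (\<psi> z) else 0)"

definition mult_op :: "(complex \<Rightarrow> complex) \<Rightarrow> (complex \<Rightarrow> complex) \<Rightarrow> complex \<Rightarrow> complex" where
  "mult_op u f = (\<lambda>z. if z \<in> unit_disk then u z * f z else 0)"

definition adjoint_on :: "'a set \<Rightarrow> ('a \<Rightarrow> 'a \<Rightarrow> complex) \<Rightarrow> ('a \<Rightarrow> 'a) \<Rightarrow> 'a \<Rightarrow> 'a" where
  "adjoint_on H ip T g = (THE v. v \<in> H \<and> (\<forall>f\<in>H. ip (T f) g = ip f v))"

text \<open>The range on \<open>H\<close> lies in a finite-dimensional complex subspace of \<open>H\<close>.\<close>

definition finite_rank_on ::
  "(complex \<Rightarrow> complex) set \<Rightarrow> ((complex \<Rightarrow> complex) \<Rightarrow> complex \<Rightarrow> complex) \<Rightarrow> bool" where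
  "finite_rank_on H T \<longleftrightarrow>
     (\<exists>B. finite B \<and> B \<subseteq> H \<and> T ` H \<subseteq> module.span (\<lambda>(c::complex) f z. c * f z) B)"

definition krein_adjoint ::
  "complex \<Rightarrow> complex \<Rightarrow> complex \<Rightarrow> complex \<Rightarrow> complex \<Rightarrow> complex" where
  "krein_adjoint a b c d = moebius (cnj a) (- cnj c) (- cnj b) (cnj d)"

lemma module_fun_scale: "module (\<lambda>(c::complex) (f::complex \<Rightarrow> complex) z. c * f z)"
  by unfold_locales (auto simp: fun_eq_iff algebra_simps)

lemma kernel_fun_holomorphic: "kernel_fun N Q holomorphic_on unit_disk"
proof -
  have "1 / (1 - x) \<notin> \<real>\<^sub>\<le>\<^sub>0" if "x \<in> unit_disk" for x :: complex
  proof
    assume "1 / (1 - x) \<in> \<real>\<^sub>\<le>\<^sub>0"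
    then have "Re (1 / (1 - x)) \<le> 0" by (simp add: complex_nonpos_Reals_iff)
    moreover have "Re (1 - x) > 0"
      using that complex_Re_le_cmod[of x] by simp
    then have "Re (1 / (1 - x)) > 0"
      by (simp add: Re_divide add_pos_nonneg)
    ultimately show False by simp
  qed
  then have "(\<lambda>x. (x - 1) ^ N * Ln (1 / (1 - x)) + poly Q x) holomorphic_on unit_disk"
    by (intro holomorphic_intros) auto
  then show ?thesis unfolding kernel_fun_def[abs_def] .
qed

lemma A2_kernel_mem:
  assumes w: "w \<in> unit_disk"
  shows "A2_kernel N Q w \<in> A2 \<alpha>"
proof -
  define G where "G = (\<lambda>z. kernel_fun N Q (cnj w * z))"
  define R where "R = (if w = 0 then 2 else 1 / cmod w)"
  have R: "R > 1" using w by (auto simp: R_def divide_simps)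
  have Gh: "G holomorphic_on ball 0 R"
  proof -
    have "(\<lambda>z. cnj w * z) ` ball 0 R \<subseteq> unit_disk"
      by (auto simp: R_def norm_mult field_simps split: if_splits)
    then show ?thesis unfolding G_def
      using holomorphic_on_compose_gen[of "\<lambda>z. cnj w * z" "ball 0 R" "kernel_fun N Q" unit_disk]
        kernel_fun_holomorphic
      by (auto simp: o_def intro!: holomorphic_intros)
  qed
  have sub: "cball 0 1 \<subseteq> ball (0::complex) R" using R by auto
  define k where "k = nat \<lceil>\<bar>\<alpha>\<bar>\<rceil>"
  have k: "\<alpha> + 2 * real k \<ge> 0" unfolding k_def by linarith
  have Dh: "(deriv ^^ k) G holomorphic_on ball 0 R"
    using Gh by (rule holomorphic_higher_deriv) auto
  have "compact ((deriv ^^ k) G ` cball 0 1)"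
    using Dh sub by (intro compact_continuous_image compact_cball)
      (meson holomorphic_on_imp_continuous_on continuous_on_subset)
  then obtain C where C: "\<And>z. z \<in> cball 0 1 \<Longrightarrow> cmod ((deriv ^^ k) G z) \<le> C"
    by (meson compact_imp_bounded bounded_iff imageI)
  have eq: "(deriv ^^ k) (A2_kernel N Q w) z = (deriv ^^ k) G z" if "z \<in> unit_disk" for z
  proof (rule higher_deriv_cong_ev)
    show "\<forall>\<^sub>F x in nhds z. A2_kernel N Q w x = G x"
      using eventually_nhds_in_open[of unit_disk z] that
      by (auto elim!: eventually_mono simp: A2_kernel_def G_def)
  qed simp
  have "A2_kernel N Q w holomorphic_on unit_disk"
  proof (rule holomorphic_transform)
    show "G holomorphic_on unit_disk"
      using holomorphic_on_subset[OF Gh] sub by (meson ball_subset_cball subset_trans)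
  qed (simp add: A2_kernel_def G_def)
  moreover
  define F where "F = (\<lambda>z. of_real ((1 - (cmod z)\<^sup>2) ^ k) * (deriv ^^ k) (A2_kernel N Q w) z)"
  have "F \<in> L2 (dA \<alpha>)"
  proof -
    have Fc: "continuous_on unit_disk F"
    proof -
      have "continuous_on unit_disk ((deriv ^^ k) G)"
        using Dh sub by (meson ball_subset_cball holomorphic_on_imp_continuous_on
            continuous_on_subset subset_trans)
      then have "continuous_on unit_disk ((deriv ^^ k) (A2_kernel N Q w))"
        by (rule continuous_on_eq) (simp add: eq)
      then show ?thesis unfolding F_def by (intro continuous_intros)
    qed
    have Fm: "F \<in> borel_measurable (restrict_space lborel unit_disk)"
      using borel_measurable_continuous_on_restrict[OF Fc]
      by (simp add: measurable_def space_restrict_space sets_restrict_space)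
    have wm: "(\<lambda>z. (1 - (cmod z)\<^sup>2) powr \<alpha>) \<in> borel_measurable (restrict_space lborel unit_disk)"
      by (rule measurable_restrict_space1) measurable
    have "integrable (restrict_space lborel unit_disk)
            (\<lambda>z. (1 - (cmod z)\<^sup>2) powr \<alpha> *\<^sub>R (cmod (F z))\<^sup>2)"
    proof (rule Bochner_Integration.integrable_bound)
      show "integrable (restrict_space lborel unit_disk) (\<lambda>z::complex. C\<^sup>2)"
      proof -
        have "emeasure lborel (ball (0::complex) 1) < \<infinity>"
          by (rule emeasure_bounded_finite) simp
        then have "finite_measure (restrict_space lborel (ball (0::complex) 1))"
          by (intro finite_measureI) (simp add: space_restrict_space emeasure_restrict_space)
        then show ?thesis by (rule finite_measure.integrable_const)
      qed
      show "(\<lambda>z. (1 - (cmod z)\<^sup>2) powr \<alpha> *\<^sub>R (cmod (F z))\<^sup>2)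
              \<in> borel_measurable (restrict_space lborel unit_disk)"
        using Fm wm by measurable
      show "AE z in restrict_space lborel unit_disk.
              norm ((1 - (cmod z)\<^sup>2) powr \<alpha> *\<^sub>R (cmod (F z))\<^sup>2) \<le> norm (C\<^sup>2)"
      proof (rule AE_I2)
        fix z :: complex assume "z \<in> space (restrict_space lborel unit_disk)"
        then have z: "cmod z < 1" by (simp add: space_restrict_space)
        define t where "t = 1 - (cmod z)\<^sup>2"
        have t: "0 < t" "t \<le> 1" using z by (auto simp: t_def power_less_one_iff)
        have "(cmod (F z))\<^sup>2 = t ^ (2 * k) * (cmod ((deriv ^^ k) G z))\<^sup>2"
          using t z
          by (simp add: F_def eq norm_mult norm_power power_mult_distrib power_mult mult.commute
              flip: t_def of_real_power)
        then have "t powr \<alpha> * (cmod (F z))\<^sup>2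
                     = t powr (\<alpha> + 2 * real k) * (cmod ((deriv ^^ k) G z))\<^sup>2"
          using t by (simp add: powr_add powr_realpow[symmetric])
        also have "\<dots> \<le> 1 * C\<^sup>2"
          using t k C[of z] z
          by (intro mult_mono power_mono powr_le1) auto
        finally show "norm ((1 - (cmod z)\<^sup>2) powr \<alpha> *\<^sub>R (cmod (F z))\<^sup>2) \<le> norm (C\<^sup>2)"
          by (simp flip: t_def)
      qed
    qed
    then have "integrable (dA \<alpha>) (\<lambda>z. (cmod (F z))\<^sup>2)"
      unfolding dA_def using Fm wm by (subst integrable_density) auto
    moreover have "F \<in> borel_measurable (dA \<alpha>)"
      using Fm by (simp add: dA_def)
    ultimately show ?thesis by (simp add: L2_def)
  qed
  ultimately show ?thesis
    using k by (auto simp: A2_def F_def A2_kernel_def intro!: exI[of _ k])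
qed

lemma A2_kernel_reproducing:
  assumes Q: "admissible_poly N Q" and f: "f \<in> A2 \<alpha>" and w: "w \<in> unit_disk"
  shows "A2_inner N Q f (A2_kernel N Q w) = f w"
proof -
  let ?K = "kernel_fun N Q"
  have "taylor_coeff (A2_kernel N Q w) m = cnj w ^ m * taylor_coeff ?K m" for m
  proof -
    have "(deriv ^^ m) (A2_kernel N Q w) 0 = (deriv ^^ m) (\<lambda>z. ?K (cnj w * z)) 0"
      by (rule higher_deriv_cong_ev)
         (auto intro!: eventually_mono[OF eventually_nhds_in_open[of unit_disk 0]]
           simp: A2_kernel_def)
    also have "\<dots> = cnj w ^ m * (deriv ^^ m) ?K (cnj w * 0)"
    proof (rule higher_deriv_compose_linear[OF kernel_fun_holomorphic, of unit_disk])
      fix z :: complex assume "z \<in> unit_disk"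
      then have "cmod w * cmod z < 1 * 1" using w by (intro mult_strict_mono') auto
      then show "cnj w * z \<in> unit_disk" by (simp add: norm_mult)
    qed auto
    finally show ?thesis by (simp add: fps_expansion_def)
  qed
  moreover have "cnj (taylor_coeff ?K m) = taylor_coeff ?K m" "taylor_coeff ?K m \<noteq> 0" for m
    using Q by (auto simp: admissible_poly_def Reals_cnj_iff) (metis less_irrefl zero_complex.sel(1))
  ultimately have "A2_inner N Q f (A2_kernel N Q w) = (\<Sum>m. taylor_coeff f m * w ^ m)"
    by (simp add: A2_inner_def)
  also have "\<dots> = f w"
    using holomorphic_power_series[of f 0 1 w] f w
    by (simp add: A2_def fps_expansion_def sums_unique[symmetric])
  finally show ?thesis .
qed

end

theory Submission
  imports Defs
begin

text \<open>For \<open>f\<close> in the space, reproducing gives \<open>(C\<^sub>\<phi>\<^sup>* f)(z) = \<langle>f, K\<^sub>z \<circ> \<phi>\<rangle>\<close> and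
  \<open>(M\<^sub>h\<^sup>* f)(z) = \<langle>f, h K\<^sub>z\<rangle>\<close>, so the difference operator maps \<open>f\<close> to the function
  \<open>z \<mapsto> \<langle>f, K\<^sub>z \<circ> \<phi> - cnj (g z) h K\<^bsub>\<sigma> z\<^esub>\<rangle>\<close>. Since
  \<open>1 - cnj z \<phi>(w) = cnj (- cnj b z + cnj d) (1 - cnj (\<sigma> z) w) / (c w + d)\<close>, the factors multiplying the
  two logarithms agree and the logarithms themselves cancel up to a function of \<open>z\<close> plus a
  function of \<open>w\<close>. What remains is a finite sum of products of a function of \<open>z\<close> and a function
  of \<open>w\<close>, all of them analytic across the unit circle.

  The adjoints exist because the operators are bounded. With \<open>n = N + 1\<close> the norm is equivalent
  to \<open>\<Sum>\<bar>f\<^sub>m\<bar>\<^sup>2 (m + 1)\<^sup>n\<close>, hence, up to finitely many coefficients, to the integral of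
  \<open>\<bar>f\<^sup>(\<^sup>n\<^sup>)\<bar>\<^sup>2 (1 - \<bar>z\<bar>\<^sup>2)\<^sup>N\<close> over the disk. By Bol's identity
  the \<open>n\<close>-th derivative of \<open>(c z + d)\<^sup>N f(\<phi>(z))\<close> is a multiple of \<open>(c z + d)\<^sup>-\<^sup>n\<^sup>-\<^sup>1 f\<^sup>(\<^sup>n\<^sup>)(\<phi>(z))\<close>, so
  that a change of variables and the Schwarz-Pick lemma bound this integral; multiplication by
  \<open>(c z + d)\<^sup>-\<^sup>N\<close> is bounded because its Taylor coefficients decay geometrically.\<close>

section \<open>Change of variables in the complex plane\<close>

text \<open>For a kernel that is the pure power \<open>(1 - cnj w * z)\<close> to the exponent
  \<open>- \<alpha> - 2\<close>, the defining identity of the Krein adjoint would make the adjoint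
  formula exact. Here a logarithm and a polynomial accompany the power. The power still matches, and
  the remainder splits into at most \<open>3 * (N + 1)\<close> products.

  Two obstacles shape the proof. First, \<open>adjoint_on\<close> is a definite description, so
  nothing can be said about it before existence and uniqueness are known, hence the work on
  boundedness of composition by \<open>\<phi>\<close> and multiplication by \<open>h\<close>. For
  these \<open>\<alpha>\<close> the norm measures derivatives, and differentiating
  \<open>f(\<phi>(z))\<close> repeatedly would bring in all lower derivatives of \<open>f\<close>;
  the weight \<open>(c z + d)^N\<close> makes them cancel. The order \<open>N + 1\<close> fits
  because \<open>\<alpha> + 2 * (N + 1) = N\<close>, so that Bol's exponent and the exponent of the
  area weight coincide.

  Second, finite rank asks for spanning functions inside the space. Their singularities, and those
  of the functions paired with \<open>f\<close>, must lie strictly outside the closed disk; this is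
  what \<open>|b| < |d|\<close> and \<open>|c| < |d|\<close> provide.\<close>

definition vec_to_complex :: "real ^ 2 \<Rightarrow> complex" where
  "vec_to_complex v = Complex (v $ 1) (v $ 2)"

definition complex_to_vec :: "complex \<Rightarrow> real ^ 2" where
  "complex_to_vec z = (\<chi> i. if i = 1 then Re z else Im z)"

lemma vec_to_complex_inverse [simp]: "complex_to_vec (vec_to_complex v) = v"
  by (simp add: vec_to_complex_def complex_to_vec_def vec_eq_iff forall_2)

lemma complex_to_vec_inverse [simp]: "vec_to_complex (complex_to_vec z) = z"
  by (simp add: vec_to_complex_def complex_to_vec_def)

lemma vec_to_complex_alt: "vec_to_complex v = of_real (v $ 1) + \<i> * of_real (v $ 2)"
  by (simp add: vec_to_complex_def complex_eq_iff)

lemma bounded_linear_vec_to_complex: "bounded_linear vec_to_complex"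
  unfolding vec_to_complex_alt[abs_def]
  by (intro linear_conv_bounded_linear[THEN iffD1] linearI)
    (simp_all add: complex_eq_iff)

lemma bounded_linear_complex_to_vec: "bounded_linear complex_to_vec"
  by (intro linear_conv_bounded_linear[THEN iffD1] linearI)
    (simp_all add: complex_to_vec_def vec_eq_iff forall_2)

lemma measurable_vec_to_complex [measurable]: "vec_to_complex \<in> borel \<rightarrow>\<^sub>M borel"
  by (intro borel_measurable_continuous_onI linear_continuous_on bounded_linear_vec_to_complex)

text \<open>Lebesgue measure is determined by its values on boxes, and a box in the plane pulls back
  to a box with the same side lengths.\<close>

lemma distr_vec_to_complex: "distr lborel borel vec_to_complex = lborel"
proof (rule lborel_eqI[symmetric])
  fix l u :: complex assume le: "\<And>b. b \<in> Basis \<Longrightarrow> l \<bullet> b \<le> u \<bullet> b"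
  then have le': "Re l \<le> Re u" "Im l \<le> Im u"
    using le[of 1] le[of \<i>] by (auto simp: Basis_complex_def)
  have eq: "vec_to_complex -` box l u = box (complex_to_vec l) (complex_to_vec u)"
    by (auto simp: in_box_complex_iff vec_to_complex_def complex_to_vec_def mem_box_cart forall_2)
  have B: "(Basis :: (real^2) set) = {axis 1 1, axis 2 1}"
    by (auto simp: Basis_vec_def UNIV_2)
  have ne: "(axis 1 1 :: real^2) \<noteq> axis 2 1" by (simp add: axis_eq_axis)
  have "emeasure (distr lborel borel vec_to_complex) (box l u)
          = emeasure lborel (box (complex_to_vec l) (complex_to_vec u))"
    by (simp add: emeasure_distr eq)
  also have "\<dots> = ennreal ((Re u - Re l) * (Im u - Im l))"
    using le' ne by (subst emeasure_lborel_box)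
      (auto simp: B inner_axis complex_to_vec_def inner_diff_left)
  finally show "emeasure (distr lborel borel vec_to_complex) (box l u) = (\<Prod>b\<in>Basis. (u - l) \<bullet> b)"
    by (simp add: Basis_complex_def)
qed simp

text \<open>By the Cauchy-Riemann equations, multiplication by \<open>w\<close> is the real
  differential of a holomorphic map with derivative \<open>w\<close>; this is its Jacobian.\<close>

lemma det_complex_mult:
  "det (matrix (\<lambda>v. complex_to_vec (w * vec_to_complex v))) = (cmod w)\<^sup>2"
  unfolding cmod_power2
  by (simp add: det_2 matrix_def vec_to_complex_def complex_to_vec_def axis_def power2_eq_square)

text \<open>The change of variables theorem of the library lives on \<open>real ^ 'n\<close>; it is carried over to
  the complex plane along \<^const>\<open>vec_to_complex\<close>.\<close>

lemma emeasure_holomorphic_image: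
  assumes S: "open S" and hol: "\<phi> holomorphic_on S" and inj: "inj_on \<phi> S"
    and fin: "emeasure lborel (\<phi> ` S) < \<infinity>"
    and B: "B \<subseteq> S" "B \<in> sets borel" "\<phi> ` B \<in> sets borel"
  shows "(\<integral>\<^sup>+z. ennreal ((cmod (deriv \<phi> z))\<^sup>2) * indicator B z \<partial>lborel) = emeasure lborel (\<phi> ` B)"
proof -
  define f where "f = (\<lambda>v. complex_to_vec (\<phi> (vec_to_complex v)))"
  define f' where "f' = (\<lambda>v u. complex_to_vec (deriv \<phi> (vec_to_complex v) * vec_to_complex u))"
  define B' where "B' = vec_to_complex -` B"
  have B'_borel: "B' \<in> sets borel"
    using measurable_sets[OF measurable_vec_to_complex B(2)] by (simp add: B'_def)
  have inj': "inj_on f B'"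
    by (rule inj_onI) (metis B'_def B(1) complex_to_vec_inverse f_def inj inj_onD subsetD
        vec_to_complex_inverse vimageE)
  have der: "(f has_derivative f' v) (at v within B')" if "v \<in> B'" for v
  proof -
    have "vec_to_complex v \<in> S" using that B(1) by (auto simp: B'_def)
    then have "(\<phi> has_derivative (\<lambda>h. deriv \<phi> (vec_to_complex v) * h)) (at (vec_to_complex v))"
      using holomorphic_derivI[OF hol S] by (simp add: has_field_derivative_def)
    moreover have "(vec_to_complex has_derivative vec_to_complex) (at v within B')"
      by (rule bounded_linear_imp_has_derivative[OF bounded_linear_vec_to_complex])
    ultimately have "((\<lambda>v. \<phi> (vec_to_complex v)) has_derivative
        (\<lambda>u. deriv \<phi> (vec_to_complex v) * vec_to_complex u)) (at v within B')"
      by (rule has_derivative_compose[rotated])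
    then show ?thesis unfolding f_def f'_def
      by (rule bounded_linear.has_derivative[OF bounded_linear_complex_to_vec])
  qed
  have im: "f ` B' = vec_to_complex -` (\<phi> ` B)"
  proof (intro equalityI subsetI)
    fix v assume "v \<in> vec_to_complex -` (\<phi> ` B)"
    then obtain z where "z \<in> B" "vec_to_complex v = \<phi> z" by auto
    then show "v \<in> f ` B'"
      by (intro image_eqI[of _ _ "complex_to_vec z"]) (auto simp: f_def B'_def dest: arg_cong[of _ _ complex_to_vec])
  qed (auto simp: f_def B'_def)
  have im_borel: "f ` B' \<in> sets borel"
    using measurable_sets[OF measurable_vec_to_complex B(3)] by (simp add: im)
  have em: "emeasure lborel (f ` B') = emeasure lborel (\<phi> ` B)"
    by (subst distr_vec_to_complex[symmetric]) (simp add: emeasure_distr B(3) im)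
  have "emeasure lborel (\<phi> ` B) \<le> emeasure lborel (\<phi> ` S)"
    using B(1) open_mapping_thm3[OF hol S inj] by (intro emeasure_mono) auto
  with fin have fin': "emeasure lborel (\<phi> ` B) < \<infinity>" by (rule le_less_trans[rotated])
  define m where "m = measure lborel (f ` B')"
  have m: "emeasure lborel (f ` B') = ennreal m"
    unfolding m_def by (rule emeasure_eq_ennreal_measure) (use fin' em in auto)
  have "f ` B' \<in> lmeasurable"
    using im_borel fin' em by (intro fmeasurableI) auto
  moreover have "measure lebesgue (f ` B') = m"
    using im_borel by (simp add: m_def)
  ultimately have "((\<lambda>x. \<bar>det (matrix (f' x))\<bar>) has_integral m) B'"
    using has_measure_differentiable_image[of B' f f' m] B'_borel der inj' by auto
  then have "((\<lambda>x. (cmod (deriv \<phi> (vec_to_complex x)))\<^sup>2) has_integral m) B'"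
    by (simp add: f'_def det_complex_mult)
  then have "(\<integral>\<^sup>+v. ennreal ((cmod (deriv \<phi> (vec_to_complex v)))\<^sup>2) * indicator B' v \<partial>lborel) = ennreal m"
    by (intro nn_integral_has_integral_lebesgue') auto
  \<comment> \<open>The derivative is continuous on \<open>S\<close> only, so measurability is
    obtained for its extension by 0 off \<open>S\<close>, which changes nothing on
    \<open>B\<close>.\<close>
  moreover have "(\<lambda>z. ennreal ((cmod (deriv \<phi> z))\<^sup>2) * indicator B z) \<in> borel_measurable borel"
  proof -
    have "continuous_on S (\<lambda>z. (cmod (deriv \<phi> z))\<^sup>2)"
      using hol S by (intro continuous_intros holomorphic_on_imp_continuous_on holomorphic_deriv)
    then have "(\<lambda>z. indicator S z *\<^sub>R (cmod (deriv \<phi> z))\<^sup>2) \<in> borel_measurable borel"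
      using S by (intro borel_measurable_continuous_on_indicator) auto
    then have "(\<lambda>z. ennreal (indicator S z *\<^sub>R (cmod (deriv \<phi> z))\<^sup>2) * indicator B z) \<in> borel_measurable borel"
      using B(2) by measurable
    also have "(\<lambda>z. ennreal (indicator S z *\<^sub>R (cmod (deriv \<phi> z))\<^sup>2) * indicator B z)
                = (\<lambda>z. ennreal ((cmod (deriv \<phi> z))\<^sup>2) * indicator B z)"
      using B(1) by (auto simp: fun_eq_iff indicator_def)
    finally show ?thesis .
  qed
  moreover have "indicator B (vec_to_complex v) = (indicator B' v :: ennreal)" for v
    by (simp add: B'_def indicator_def)
  ultimately have "(\<integral>\<^sup>+z. ennreal ((cmod (deriv \<phi> z))\<^sup>2) * indicator B z \<partial>distr lborel borel vec_to_complex)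
      = ennreal m"
    by (simp add: nn_integral_distr)
  then show ?thesis by (simp add: distr_vec_to_complex m flip: em)
qed

text \<open>The left side integrates \<open>F\<close> against the push-forward under
  \<open>\<phi>\<close> of the measure with density \<open>|\<phi>'|^2\<close>, the right side
  against area on the image. Equality of these two measures needs only sets, that is, the preceding
  lemma.\<close>

lemma nn_integral_holomorphic_image:
  assumes S: "open S" and hol: "\<phi> holomorphic_on S" and inj: "inj_on \<phi> S"
    and fin: "emeasure lborel (\<phi> ` S) < \<infinity>"
    and F: "F \<in> borel_measurable borel"
  shows "(\<integral>\<^sup>+z. F (\<phi> z) * ennreal ((cmod (deriv \<phi> z))\<^sup>2) * indicator S z \<partial>lborel)
           = (\<integral>\<^sup>+z. F z * indicator (\<phi> ` S) z \<partial>lborel)"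
proof -
  have imS: "open (\<phi> ` S)" using open_mapping_thm3[OF hol S inj] .
  have [measurable]: "S \<in> sets borel" "\<phi> ` S \<in> sets borel" using S imS by auto
  let ?R = "restrict_space lborel S"
  have mphi: "\<phi> \<in> ?R \<rightarrow>\<^sub>M borel"
    using borel_measurable_continuous_on_restrict[OF holomorphic_on_imp_continuous_on[OF hol]]
    by (simp add: measurable_def space_restrict_space sets_restrict_space)
  have cd: "continuous_on S (\<lambda>z. (cmod (deriv \<phi> z))\<^sup>2)"
    using hol S by (intro continuous_intros holomorphic_on_imp_continuous_on holomorphic_deriv)
  have md: "(\<lambda>z. ennreal ((cmod (deriv \<phi> z))\<^sup>2)) \<in> borel_measurable ?R"
    using borel_measurable_continuous_on_restrict[OF cd]
    by (intro measurable_compose[OF _ measurable_ennreal]) (simp add: measurable_def space_restrict_space sets_restrict_space)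
  define \<mu> where "\<mu> = distr (density ?R (\<lambda>z. ennreal ((cmod (deriv \<phi> z))\<^sup>2))) borel \<phi>"
  define \<nu> where "\<nu> = density lborel (indicator (\<phi> ` S) :: complex \<Rightarrow> ennreal)"
  have "\<mu> = \<nu>"
  proof (rule measure_eqI)
    show "sets \<mu> = sets \<nu>" by (simp add: \<mu>_def \<nu>_def)
    fix A assume "A \<in> sets \<mu>"
    then have A[measurable]: "A \<in> sets borel" by (simp add: \<mu>_def)
    define B where "B = \<phi> -` A \<inter> S"
    have B': "B \<in> sets ?R"
      using measurable_sets[OF mphi A] by (simp add: B_def space_restrict_space)
    then have B: "B \<subseteq> S" "B \<in> sets borel"
      by (auto simp: sets_restrict_space_iff B_def)
    have im: "\<phi> ` B = A \<inter> \<phi> ` S" by (auto simp: B_def)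
    have "emeasure \<mu> A = (\<integral>\<^sup>+z. ennreal ((cmod (deriv \<phi> z))\<^sup>2) * indicator B z \<partial>?R)"
      using md mphi B' by (simp add: \<mu>_def emeasure_distr emeasure_density B_def space_restrict_space)
    also have "\<dots> = (\<integral>\<^sup>+z. ennreal ((cmod (deriv \<phi> z))\<^sup>2) * indicator B z \<partial>lborel)"
      using B(1) by (subst nn_integral_restrict_space)
        (auto intro!: nn_integral_cong simp: indicator_def)
    also have "\<dots> = emeasure lborel (\<phi> ` B)"
      using S hol inj fin B by (intro emeasure_holomorphic_image) (auto simp: im)
    also have "\<dots> = emeasure \<nu> A"
      by (simp add: \<nu>_def im emeasure_density flip: indicator_inter_arith)
        (simp add: Int_commute)
    finally show "emeasure \<mu> A = emeasure \<nu> A" .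
  qed
  then have "(\<integral>\<^sup>+z. F z \<partial>\<mu>) = (\<integral>\<^sup>+z. F z \<partial>\<nu>)" by simp
  then show ?thesis
    using F md mphi
    by (simp add: \<mu>_def \<nu>_def nn_integral_distr nn_integral_density nn_integral_restrict_space mult_ac)
qed

section \<open>Area integrals of power series\<close>

lemma measurable_cnj [measurable]: "cnj \<in> borel \<rightarrow>\<^sub>M borel"
  by (intro borel_measurable_continuous_onI continuous_intros)

lemma measurable_indicator_unit_disk [measurable]:
  "(indicator unit_disk :: complex \<Rightarrow> ennreal) \<in> borel_measurable borel"
  by (intro borel_measurable_indicator) simp

text \<open>The preimage of a box is its image under the inverse rotation \<open>cnj w\<close>,
  whose derivative has constant modulus 1, so the change of variables preserves its area.\<close>

lemma distr_complex_rotation: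
  assumes "cmod w = 1"
  shows "distr lborel borel (\<lambda>z. w * z) = lborel"
proof (rule lborel_eqI[symmetric])
  fix l u :: complex assume le: "\<And>b. b \<in> Basis \<Longrightarrow> l \<bullet> b \<le> u \<bullet> b"
  have w: "w \<noteq> 0" "w * cnj w = 1" using assms by (auto simp: complex_norm_square[symmetric])
  have vim: "(\<lambda>z. w * z) -` box l u = (\<lambda>z. cnj w * z) ` box l u"
  proof (intro equalityI subsetI)
    fix z assume "z \<in> (\<lambda>z. w * z) -` box l u"
    then show "z \<in> (\<lambda>z. cnj w * z) ` box l u"
      using w by (intro image_eqI[of _ _ "w * z"]) (auto simp: mult_ac)
  qed (use w in \<open>auto simp flip: mult.assoc\<close>)
  have hol: "(\<lambda>z. cnj w * z) holomorphic_on box l u" by (intro holomorphic_intros)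
  have inj: "inj_on (\<lambda>z. cnj w * z) (box l u)" using w by (auto simp: inj_on_def)
  have op: "open ((\<lambda>z. cnj w * z) ` box l u)"
    using open_mapping_thm3[OF hol _ inj] by auto
  have bd: "bounded ((\<lambda>z. cnj w * z) ` box l u)"
    by (intro bounded_linear_image bounded_linear_mult_right bounded_box)
  have d: "deriv (\<lambda>z. cnj w * z) z = cnj w" for z
    by (rule DERIV_imp_deriv) (auto intro!: derivative_eq_intros)
  have "emeasure (distr lborel borel (\<lambda>z. w * z)) (box l u)
          = emeasure lborel ((\<lambda>z. cnj w * z) ` box l u)"
    by (simp add: emeasure_distr vim)
  also have "\<dots> = (\<integral>\<^sup>+z. ennreal ((cmod (deriv (\<lambda>z. cnj w * z) z))\<^sup>2) * indicator (box l u) z \<partial>lborel)"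
    using hol inj op emeasure_bounded_finite[OF bd]
    by (intro emeasure_holomorphic_image[symmetric, where S = "box l u"]) auto
  also have "\<dots> = emeasure lborel (box l u)"
    using assms by (simp add: d)
  finally show "emeasure (distr lborel borel (\<lambda>z. w * z)) (box l u) = (\<Prod>b\<in>Basis. (u - l) \<bullet> b)"
    using le by simp
qed simp

lemma integral_complex_rotation:
  fixes f :: "complex \<Rightarrow> complex"
  assumes "cmod w = 1" and [measurable]: "f \<in> borel_measurable borel"
  shows "(LINT z|lborel. f (w * z)) = (LINT z|lborel. f z)"
  by (subst (2) distr_complex_rotation[OF assms(1), symmetric]) (simp add: integral_distr)

text \<open>The substitution \<open>t = |z|^2\<close> replaces polar coordinates: the push-forward
  of area on the disk is \<open>pi\<close> times Lebesgue measure on the unit interval, because both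
  give the same mass to every ray \<open>{x<..}\<close>. Only areas of disks are needed for
  that.\<close>

lemma nn_integral_radial_disk:
  fixes G :: "real \<Rightarrow> ennreal"
  assumes G: "G \<in> borel_measurable borel"
  shows "(\<integral>\<^sup>+z. G ((cmod z)\<^sup>2) * indicator unit_disk z \<partial>lborel)
           = ennreal pi * (\<integral>\<^sup>+t. G t * indicator {0..1} t \<partial>lborel)"
proof -
  define M where "M = distr (density lborel (indicator unit_disk)) borel (\<lambda>z::complex. (cmod z)\<^sup>2)"
  define N where "N = density lborel (\<lambda>t::real. ennreal pi * indicator {0..1} t)"
  have cball: "emeasure lborel (cball (0::complex) r) = ennreal (pi * r\<^sup>2)" if "r \<ge> 0" for r
    using emeasure_cball[of r "0::complex"] that by (simp add: unit_ball_vol_2)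
  have ball: "emeasure lborel (ball (0::complex) 1) = ennreal pi"
    using emeasure_ball[of 1 "0::complex"] by (simp add: unit_ball_vol_2)
  have "M = N"
  proof (rule measure_eqI_lessThan)
    show "sets M = sets borel" "sets N = sets borel" by (simp_all add: M_def N_def)
    fix x :: real
    have M: "emeasure M {x<..} = emeasure lborel (unit_disk \<inter> {z. x < (cmod z)\<^sup>2})"
    proof -
      let ?A = "{z::complex. x < (cmod z)\<^sup>2}"
      have A: "?A \<in> sets borel" by measurable
      have "emeasure (density lborel (indicator unit_disk)) ?A = (\<integral>\<^sup>+z. indicator unit_disk z * indicator ?A z \<partial>lborel)"
        using A by (intro emeasure_density borel_measurable_indicator) auto
      also have "\<dots> = emeasure lborel (unit_disk \<inter> ?A)"
        using A by (simp flip: indicator_inter_arith)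
      finally show ?thesis
        by (simp add: M_def emeasure_distr vimage_def)
    qed
    have "emeasure M {x<..} \<le> emeasure lborel unit_disk"
      unfolding M by (intro emeasure_mono) auto
    also have "\<dots> < \<infinity>" by (simp add: ball)
    finally show "emeasure M {x<..} < \<infinity>" .
    have N: "emeasure N {x<..} = ennreal pi * emeasure lborel ({0..1} \<inter> {x<..})"
      by (simp add: N_def emeasure_density nn_integral_cmult mult.assoc flip: indicator_inter_arith)
    show "emeasure M {x<..} = emeasure N {x<..}"
    proof -
      consider "x < 0" | "0 \<le> x" "x < 1" | "1 \<le> x" by linarith
      then show ?thesis
      proof cases
        case 1
        then have "unit_disk \<inter> {z. x < (cmod z)\<^sup>2} = unit_disk" "{0..1} \<inter> {x<..} = {0..1}"
          by (auto intro: less_le_trans)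
        then show ?thesis by (simp add: M N ball)
      next
        case 2
        have "x < (cmod z)\<^sup>2 \<longleftrightarrow> \<not> cmod z \<le> sqrt x" for z
          using real_sqrt_le_iff[of "(cmod z)\<^sup>2" x] by auto
        then have "unit_disk \<inter> {z. x < (cmod z)\<^sup>2} = unit_disk - cball 0 (sqrt x)"
          by (simp add: set_eq_iff)
        moreover have "emeasure lborel (unit_disk - cball 0 (sqrt x)) = ennreal pi - ennreal (pi * x)"
        proof -
          have "sqrt x < 1" using 2 by simp
          then have "cball 0 (sqrt x) \<subseteq> (unit_disk :: complex set)"
            unfolding subset_iff mem_cball mem_ball dist_0_norm using le_less_trans by blast
          then show ?thesis
            using 2 by (subst emeasure_Diff) (simp_all add: ball cball)
        qed
        moreover have "{0..1} \<inter> {x<..} = {x<..1}" using 2 by auto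
        ultimately show ?thesis
          using 2 by (simp add: M N ennreal_minus ennreal_mult[symmetric] algebra_simps)
      next
        case 3
        have "unit_disk \<inter> {z. x < (cmod z)\<^sup>2} = {}"
        proof -
          have "(cmod z)\<^sup>2 < 1" if "cmod z < 1" for z :: complex
            using that by (simp add: power_less_one_iff)
          with 3 show ?thesis by force
        qed
        moreover have "{0..1} \<inter> {x<..} = {}" using 3 by auto
        ultimately show ?thesis by (simp add: M N)
      qed
    qed
  qed
  then have "(\<integral>\<^sup>+t. G t \<partial>M) = (\<integral>\<^sup>+t. G t \<partial>N)" by simp
  then show ?thesis
    using G by (simp add: M_def N_def nn_integral_distr nn_integral_density nn_integral_cmult mult_ac)
qed

text \<open>Induction on \<open>s\<close> for all \<open>m\<close> at once, since writing the extra
  factor as \<open>1 - t\<close> leads to the exponents \<open>m\<close> and \<open>Suc m\<close>.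
  The value is the Beta function at \<open>m + 1\<close> and \<open>s + 1\<close>.\<close>

lemma has_integral_beta_nat:
  "((\<lambda>t::real. t ^ m * (1 - t) ^ s) has_integral (fact m * fact s / fact (Suc (m + s)))) {0..1}"
proof (induction s arbitrary: m)
  case 0
  have "((\<lambda>t::real. t ^ m) has_integral (1 ^ Suc m / real (Suc m) - 0 ^ Suc m / real (Suc m))) {0..1}"
  proof (rule fundamental_theorem_of_calculus)
    show "((\<lambda>t. t ^ Suc m / real (Suc m)) has_vector_derivative t ^ m) (at t within {0..1})" for t :: real
      unfolding has_real_derivative_iff_has_vector_derivative[symmetric]
      by (auto intro!: derivative_eq_intros simp del: of_nat_Suc power_Suc)
  qed simp
  then show ?case by simp
next
  case (Suc s)
  have "((\<lambda>t::real. t ^ m * (1 - t) ^ s - t ^ Suc m * (1 - t) ^ s) has_integral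
      (fact m * fact s / fact (Suc (m + s)) - fact (Suc m) * fact s / fact (Suc (Suc m + s)))) {0..1}"
    by (intro has_integral_diff Suc.IH)
  moreover have "(fact m * fact s / fact (Suc (m + s)) - fact (Suc m) * fact s / fact (Suc (Suc m + s)) :: real)
      = fact m * fact (Suc s) / fact (Suc (m + Suc s))"
    by (simp add: divide_simps) (simp add: algebra_simps)
  moreover have "(\<lambda>t::real. t ^ m * (1 - t) ^ s - t ^ Suc m * (1 - t) ^ s) = (\<lambda>t. t ^ m * (1 - t) ^ Suc s)"
    by (simp add: fun_eq_iff algebra_simps)
  ultimately show ?case by simp
qed

text \<open>The integral of \<open>|z|^(2 m) (1 - |z|^2)^s\<close> over the disk, which is
  \<open>pi\<close> times a Beta value.\<close>

definition disk_moment :: "nat \<Rightarrow> nat \<Rightarrow> real" where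
  "disk_moment s m = pi * (fact m * fact s / fact (Suc (m + s)))"

lemma nn_integral_disk_moment:
  "(\<integral>\<^sup>+z. ennreal (((cmod z)\<^sup>2) ^ m * (1 - (cmod z)\<^sup>2) ^ s) * indicator unit_disk z \<partial>lborel)
     = ennreal (disk_moment s m)"
proof -
  have "(\<integral>\<^sup>+z. ennreal (((cmod z)\<^sup>2) ^ m * (1 - (cmod z)\<^sup>2) ^ s) * indicator unit_disk z \<partial>lborel)
      = ennreal pi * (\<integral>\<^sup>+t. ennreal (t ^ m * (1 - t) ^ s) * indicator {0..1} t \<partial>lborel)"
    by (rule nn_integral_radial_disk[where G = "\<lambda>t. ennreal (t ^ m * (1 - t) ^ s)"]) measurable
  also have "(\<integral>\<^sup>+t. ennreal (t ^ m * (1 - t) ^ s) * indicator {0..1} t \<partial>lborel)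
      = ennreal (fact m * fact s / fact (Suc (m + s)))"
    by (rule nn_integral_has_integral_lebesgue'[OF _ has_integral_beta_nat]) auto
  finally show ?thesis by (simp add: disk_moment_def ennreal_mult[symmetric])
qed

text \<open>Rotation by the angle \<open>pi / (m - l)\<close> fixes the radial weight and multiplies
  the monomial by -1, so the integral equals its own negative.\<close>

lemma integral_monomials_orthogonal:
  assumes "m \<noteq> l" and "\<And>z w. cmod z = cmod w \<Longrightarrow> W z = W w"
    and [measurable]: "W \<in> borel_measurable borel"
  shows "(LINT z|lborel. W z * (z ^ m * cnj z ^ l)) = 0"
proof -
  define w where "w = cis (pi / (real m - real l))"
  have nz: "real m - real l \<noteq> 0" using assms(1) by simp
  have "w ^ m * cnj w ^ l = cis (real m * (pi / (real m - real l)) - real l * (pi / (real m - real l)))"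
    by (simp add: w_def cis_cnj Complex.DeMoivre cis_mult)
  also have "real m * (pi / (real m - real l)) - real l * (pi / (real m - real l)) = pi"
    by (subst left_diff_distrib[symmetric]) (simp add: nz assms(1))
  finally have w: "w ^ m * cnj w ^ l = - 1" by simp
  have nw: "cmod w = 1" by (simp add: w_def)
  have "(LINT z|lborel. W z * (z ^ m * cnj z ^ l))
      = (LINT z|lborel. W (w * z) * ((w * z) ^ m * cnj (w * z) ^ l))"
    by (rule integral_complex_rotation[symmetric, OF nw]) measurable
  also have "\<dots> = (LINT z|lborel. - (W z * (z ^ m * cnj z ^ l)))"
  proof (rule arg_cong[where f = "lebesgue_integral lborel"], rule ext)
    fix z
    have "W (w * z) = W z" by (rule assms(2)) (simp add: norm_mult nw)
    then have "W (w * z) * ((w * z) ^ m * cnj (w * z) ^ l) = (w ^ m * cnj w ^ l) * (W z * (z ^ m * cnj z ^ l))"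
      by (simp add: power_mult_distrib mult_ac)
    then show "W (w * z) * ((w * z) ^ m * cnj (w * z) ^ l) = - (W z * (z ^ m * cnj z ^ l))"
      by (simp add: w)
  qed
  also have "\<dots> = - (LINT z|lborel. W z * (z ^ m * cnj z ^ l))" by simp
  finally show ?thesis by simp
qed

text \<open>Parseval's identity for a radial weight, with both sides allowed to be infinite. On a
  ball of radius \<open>r < 1\<close> the partial sums are uniformly bounded, so dominated
  convergence applies there; monotone convergence then exhausts the disk.\<close>

lemma nn_integral_disk_power_series:
  assumes F: "F holomorphic_on unit_disk"
  shows "(\<integral>\<^sup>+z. ennreal ((cmod (F z))\<^sup>2 * (1 - (cmod z)\<^sup>2) ^ s) * indicator unit_disk z \<partial>lborel)
           = (\<Sum>m. ennreal ((cmod (taylor_coeff F m))\<^sup>2 * disk_moment s m))"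
proof -
  define a where "a = taylor_coeff F"
  have sums: "(\<lambda>m. a m * z ^ m) sums F z" if "z \<in> unit_disk" for z
    using holomorphic_power_series[OF F that] by (simp add: a_def fps_expansion_def)
  define G where "G = (\<lambda>z. ennreal ((cmod (F z))\<^sup>2 * (1 - (cmod z)\<^sup>2) ^ s) * indicator unit_disk z)"
  define h where "h = (\<lambda>m z. (cmod (a m))\<^sup>2 * (((cmod z)\<^sup>2) ^ m * (1 - (cmod z)\<^sup>2) ^ s))"
  \<comment> \<open>\<open>H\<close> is the average of \<open>G\<close> over circles: the mixed
    terms are gone, while the integral over each centred ball is unchanged.\<close>
  define H where "H = (\<lambda>z. \<Sum>m. ennreal (h m z) * indicator unit_disk z)"
  have Fc: "continuous_on unit_disk F" using F by (rule holomorphic_on_imp_continuous_on)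
  have [measurable]: "ball 0 r \<in> sets (borel :: complex measure)" for r by simp
  have h_meas [measurable]: "h m \<in> borel_measurable borel" for m
    unfolding h_def by measurable
  have H_meas [measurable]: "H \<in> borel_measurable borel"
    unfolding H_def by measurable
  have G_meas [measurable]: "G \<in> borel_measurable borel"
  proof -
    have "(\<lambda>z. indicator unit_disk z *\<^sub>R ((cmod (F z))\<^sup>2 * (1 - (cmod z)\<^sup>2) ^ s)) \<in> borel_measurable borel"
      using Fc by (intro borel_measurable_continuous_on_indicator continuous_intros) auto
    then have "(\<lambda>z. ennreal (indicator unit_disk z *\<^sub>R ((cmod (F z))\<^sup>2 * (1 - (cmod z)\<^sup>2) ^ s))) \<in> borel_measurable borel"
      by measurable
    also have "(\<lambda>z. ennreal (indicator unit_disk z *\<^sub>R ((cmod (F z))\<^sup>2 * (1 - (cmod z)\<^sup>2) ^ s))) = G"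
      by (auto simp: G_def fun_eq_iff indicator_def)
    finally show ?thesis .
  qed
  have ball_eq: "(\<integral>\<^sup>+z. G z * indicator (ball 0 r) z \<partial>lborel) = (\<integral>\<^sup>+z. H z * indicator (ball 0 r) z \<partial>lborel)"
    if r: "0 < r" "r < 1" for r
  proof -
    define V where "V = (\<lambda>z::complex. indicator (ball 0 r) z * (1 - (cmod z)\<^sup>2) ^ s :: real)"
    define P where "P = (\<lambda>n z. \<Sum>m<n. a m * z ^ m)"
    define c where "c = (\<lambda>m. LINT z|lborel. V z * ((cmod z)\<^sup>2) ^ m)"
    have V_meas [measurable]: "V \<in> borel_measurable borel" unfolding V_def by measurable
    have V_nonneg: "0 \<le> V z" and V_le: "V z \<le> indicator (ball 0 r) z" for z
    proof -
      have "0 \<le> 1 - (cmod z)\<^sup>2 \<and> 1 - (cmod z)\<^sup>2 \<le> 1" if "cmod z < r"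
        using that r by (auto simp: power_le_one_iff)
      then show "0 \<le> V z" "V z \<le> indicator (ball 0 r) z"
        by (auto simp: V_def indicator_def intro: power_le_one)
    qed
    have ind_int: "integrable lborel (\<lambda>z::complex. K * indicator (ball 0 r) z :: real)" for K
      by (intro integrable_mult_right integrable_real_indicator emeasure_bounded_finite) auto
    have V_int: "integrable lborel (\<lambda>z. of_real (V z) * f z)"
      if "f \<in> borel_measurable borel" "\<And>z. z \<in> ball 0 r \<Longrightarrow> cmod (f z) \<le> K" for f :: "complex \<Rightarrow> complex" and K
    proof (rule Bochner_Integration.integrable_bound[OF ind_int[of K]])
      show "(\<lambda>z. of_real (V z) * f z) \<in> borel_measurable lborel" using that(1) by simp
      have "cmod (of_real (V z) * f z) \<le> norm (K * indicator (ball 0 r) z)" for z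
      proof (cases "z \<in> ball 0 r")
        case True
        have "cmod (of_real (V z) * f z) = V z * cmod (f z)"
          using V_nonneg[of z] by (simp add: norm_mult)
        also have "\<dots> \<le> 1 * K"
          using V_nonneg[of z] V_le[of z] that(2)[OF True] True by (intro mult_mono) auto
        finally show ?thesis using True by simp
      qed (simp add: V_def)
      then show "AE z in lborel. cmod (of_real (V z) * f z) \<le> norm (K * indicator (ball 0 r) z)"
        by simp
    qed
    have zz: "z ^ m * cnj z ^ m = complex_of_real (((cmod z)\<^sup>2) ^ m)" for z m
      by (subst of_real_power, subst complex_norm_square) (simp add: power_mult_distrib)
    have mon_int: "integrable lborel (\<lambda>z. of_real (V z) * (z ^ m * cnj z ^ l))" for m l
    proof (rule V_int[where K = 1])
      show "cmod (z ^ m * cnj z ^ l) \<le> 1" if "z \<in> ball 0 r" for z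
        using that r by (auto simp: norm_mult norm_power intro!: mult_le_one power_le_one)
    qed measurable
    have fin: "(LINT z|lborel. of_real (V z) * (P n z * cnj (P n z)))
        = of_real (\<Sum>m<n. (cmod (a m))\<^sup>2 * c m)" for n
    proof -
      have diag: "(LINT z|lborel. of_real (V z) * (z ^ m * cnj z ^ l))
          = (if l = m then of_real (c m) else 0 :: complex)" for m l
      proof (cases "l = m")
        case True
        have "(\<lambda>z. of_real (V z) * (z ^ m * cnj z ^ m)) = (\<lambda>z. complex_of_real (V z * ((cmod z)\<^sup>2) ^ m))"
          unfolding zz of_real_mult ..
        then have "(LINT z|lborel. of_real (V z) * (z ^ m * cnj z ^ m))
           = (LINT z|lborel. complex_of_real (V z * ((cmod z)\<^sup>2) ^ m))" by simp
        also have "\<dots> = of_real (c m)" unfolding c_def by (rule integral_complex_of_real)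
        finally show ?thesis using True by simp
      next
        case False
        have "(LINT z|lborel. of_real (V z) * (z ^ m * cnj z ^ l)) = 0"
        proof (rule integral_monomials_orthogonal)
          show "complex_of_real (V z) = of_real (V w)" if "cmod z = cmod w" for z w
            using that by (simp add: V_def indicator_def)
        qed (use False in auto)
        with False show ?thesis by simp
      qed
      have "(\<lambda>z. of_real (V z) * (P n z * cnj (P n z)))
          = (\<lambda>z. \<Sum>m<n. \<Sum>l<n. (a m * cnj (a l)) * (of_real (V z) * (z ^ m * cnj z ^ l)))"
      proof
        fix z
        have "P n z * cnj (P n z) = (\<Sum>m<n. \<Sum>l<n. (a m * z ^ m) * (cnj (a l) * cnj z ^ l))"
          by (simp add: P_def sum_product)
        then show "of_real (V z) * (P n z * cnj (P n z))
          = (\<Sum>m<n. \<Sum>l<n. (a m * cnj (a l)) * (of_real (V z) * (z ^ m * cnj z ^ l)))"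
          by (simp add: sum_distrib_left mult_ac)
      qed
      then have "(LINT z|lborel. of_real (V z) * (P n z * cnj (P n z)))
          = (\<Sum>m<n. \<Sum>l<n. (a m * cnj (a l)) * (LINT z|lborel. of_real (V z) * (z ^ m * cnj z ^ l)))"
        by (simp add: mon_int Bochner_Integration.integral_sum)
      also have "\<dots> = (\<Sum>m<n. (a m * cnj (a m)) * of_real (c m))"
        by (simp add: diag if_distrib cong: if_cong)
      also have "\<dots> = of_real (\<Sum>m<n. (cmod (a m))\<^sup>2 * c m)"
        unfolding of_real_sum of_real_mult complex_norm_square ..
      finally show ?thesis .
    qed
    \<comment> \<open>A radius strictly between \<open>r\<close> and 1: convergence at
      \<open>r'\<close> forces absolute convergence at \<open>r\<close>.\<close>
    define r' where "r' = (1 + r) / 2"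
    have r': "r < r'" "r' < 1" using r by (auto simp: r'_def)
    have "summable (\<lambda>m. a m * of_real r' ^ m)"
      using sums[of "of_real r'"] r r' by (auto simp: sums_iff)
    then have summ: "summable (\<lambda>m. cmod (a m * of_real r ^ m))"
      by (rule powser_insidea) (use r r' in auto)
    define K where "K = (\<Sum>m. cmod (a m * of_real r ^ m))"
    have P_le: "cmod (P n z) \<le> K" if "z \<in> ball 0 r" for n z
    proof -
      have "cmod (P n z) \<le> (\<Sum>m<n. cmod (a m * of_real r ^ m))"
        unfolding P_def using that r
        by (intro sum_norm_le) (auto simp: norm_mult norm_power intro!: mult_left_mono power_mono)
      also have "\<dots> \<le> K" unfolding K_def using summ by (intro sum_le_suminf) auto
      finally show ?thesis .
    qed
    have K0: "0 \<le> K" unfolding K_def using summ by (intro suminf_nonneg) auto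
    let ?f = "\<lambda>z. of_real (V z) * (F z * cnj (F z))"
    have f_meas: "?f \<in> borel_measurable lborel"
    proof -
      have "continuous_on (ball 0 r) F" using Fc by (rule continuous_on_subset) (use r in auto)
      then have "(\<lambda>z. indicator (ball 0 r) z *\<^sub>R (of_real ((1 - (cmod z)\<^sup>2) ^ s) * (F z * cnj (F z)))) \<in> borel_measurable borel"
        by (intro borel_measurable_continuous_on_indicator continuous_intros) auto
      also have "(\<lambda>z. indicator (ball 0 r) z *\<^sub>R (of_real ((1 - (cmod z)\<^sup>2) ^ s) * (F z * cnj (F z)))) = ?f"
        by (auto simp: V_def fun_eq_iff indicator_def)
      finally show ?thesis by simp
    qed
    have P_meas: "(\<lambda>z. of_real (V z) * (P n z * cnj (P n z))) \<in> borel_measurable lborel" for n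
      unfolding P_def by measurable
    have lim: "AE z in lborel. (\<lambda>n. of_real (V z) * (P n z * cnj (P n z))) \<longlonglongrightarrow> ?f z"
    proof (rule AE_I2)
      fix z :: complex
      show "(\<lambda>n. of_real (V z) * (P n z * cnj (P n z))) \<longlonglongrightarrow> ?f z"
      proof (cases "z \<in> ball 0 r")
        case True
        then have "(\<lambda>n. P n z) \<longlonglongrightarrow> F z"
          using sums[of z] r by (auto simp: sums_def P_def)
        then show ?thesis by (intro tendsto_intros)
      qed (simp add: V_def)
    qed
    have dom: "AE z in lborel. norm (of_real (V z) * (P n z * cnj (P n z))) \<le> K\<^sup>2 * indicator (ball 0 r) z" for n
    proof (rule AE_I2)
      fix z :: complex
      show "norm (of_real (V z) * (P n z * cnj (P n z))) \<le> K\<^sup>2 * indicator (ball 0 r) z"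
      proof (cases "z \<in> ball 0 r")
        case True
        have "norm (of_real (V z) * (P n z * cnj (P n z))) = V z * (cmod (P n z) * cmod (P n z))"
          using V_nonneg[of z] by (simp add: norm_mult)
        also have "\<dots> \<le> 1 * (K * K)"
          using V_nonneg[of z] V_le[of z] P_le[OF True, of n] K0 True
          by (intro mult_mono) auto
        finally show ?thesis using True by (simp add: power2_eq_square)
      qed (simp add: V_def)
    qed
    note dct = integral_dominated_convergence[OF f_meas P_meas ind_int lim dom]
      integrable_dominated_convergence[OF f_meas P_meas ind_int lim dom]
    have fV: "?f = (\<lambda>z. of_real (V z * (cmod (F z))\<^sup>2))"
      unfolding of_real_mult complex_norm_square ..
    define I where "I = (LINT z|lborel. V z * (cmod (F z))\<^sup>2)"
    have "(LINT z|lborel. ?f z) = of_real I"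
      unfolding fV I_def by (rule integral_complex_of_real)
    with dct(1) have "(\<lambda>n. of_real (\<Sum>m<n. (cmod (a m))\<^sup>2 * c m)) \<longlonglongrightarrow> complex_of_real I"
      by (simp only: fin)
    then have Isums: "(\<lambda>m. (cmod (a m))\<^sup>2 * c m) sums I"
      unfolding sums_def by (simp only: tendsto_of_real_iff)
    have V2_int: "integrable lborel (\<lambda>z. V z * (cmod (F z))\<^sup>2)"
      using dct(2) unfolding fV by (simp only: complex_of_real_integrable_eq)
    have c_nonneg: "0 \<le> c m" for m
      unfolding c_def by (rule Bochner_Integration.integral_nonneg) (simp add: V_nonneg)
    have "(\<integral>\<^sup>+z. G z * indicator (ball 0 r) z \<partial>lborel) = (\<integral>\<^sup>+z. ennreal (V z * (cmod (F z))\<^sup>2) \<partial>lborel)"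
      using r by (intro nn_integral_cong) (auto simp: G_def V_def indicator_def mult_ac)
    also have "\<dots> = ennreal I"
      unfolding I_def using V2_int V_nonneg by (intro nn_integral_eq_integral) auto
    also have "\<dots> = (\<Sum>m. ennreal ((cmod (a m))\<^sup>2 * c m))"
      using Isums c_nonneg by (subst suminf_ennreal2) (auto simp: sums_iff)
    also have "\<dots> = (\<Sum>m. (\<integral>\<^sup>+z. ennreal (h m z) * indicator (ball 0 r) z \<partial>lborel))"
    proof (rule arg_cong[where f = suminf], rule ext)
      fix m
      have "integrable lborel (\<lambda>z. of_real (V z * ((cmod z)\<^sup>2) ^ m) :: complex)"
        using mon_int[of m m] unfolding zz of_real_mult .
      then have i: "integrable lborel (\<lambda>z. V z * ((cmod z)\<^sup>2) ^ m)"
        by (simp only: complex_of_real_integrable_eq)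
      have "ennreal ((cmod (a m))\<^sup>2 * c m) = ennreal (LINT z|lborel. (cmod (a m))\<^sup>2 * (V z * ((cmod z)\<^sup>2) ^ m))"
        by (simp add: c_def)
      also have "\<dots> = (\<integral>\<^sup>+z. ennreal ((cmod (a m))\<^sup>2 * (V z * ((cmod z)\<^sup>2) ^ m)) \<partial>lborel)"
        using i V_nonneg by (intro nn_integral_eq_integral[symmetric] integrable_mult_right) auto
      also have "\<dots> = (\<integral>\<^sup>+z. ennreal (h m z) * indicator (ball 0 r) z \<partial>lborel)"
        by (intro nn_integral_cong) (auto simp: h_def V_def indicator_def mult_ac)
      finally show "ennreal ((cmod (a m))\<^sup>2 * c m) = (\<integral>\<^sup>+z. ennreal (h m z) * indicator (ball 0 r) z \<partial>lborel)" .
    qed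
    also have "\<dots> = (\<integral>\<^sup>+z. (\<Sum>m. ennreal (h m z) * indicator (ball 0 r) z) \<partial>lborel)"
      by (rule nn_integral_suminf[symmetric]) measurable
    also have "\<dots> = (\<integral>\<^sup>+z. H z * indicator (ball 0 r) z \<partial>lborel)"
      using r by (intro nn_integral_cong) (auto simp: H_def indicator_def)
    finally show ?thesis .
  qed
  define B where "B = (\<lambda>n. ball (0::complex) (1 - 1 / (real n + 2)))"
  have B_inc: "incseq B"
  proof (rule incseq_SucI)
    show "B n \<subseteq> B (Suc n)" for n
      unfolding B_def by (rule subset_ball) (simp add: field_simps)
  qed
  have B_Un: "(\<Union>n. B n) = unit_disk"
  proof (intro equalityI subsetI)
    fix z :: complex assume z: "z \<in> unit_disk"
    obtain n where n: "1 / (1 - cmod z) < real n" using reals_Archimedean2 by blast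
    have "1 / (real n + 2) < 1 - cmod z"
    proof -
      have "1 < (1 - cmod z) * real n" using n z by (simp add: divide_less_eq mult.commute)
      also have "\<dots> \<le> (1 - cmod z) * (real n + 2)" using z by (intro mult_left_mono) auto
      finally show ?thesis by (simp add: divide_less_eq)
    qed
    then show "z \<in> (\<Union>n. B n)" by (auto simp: B_def intro!: exI[of _ n])
  next
    fix z assume "z \<in> (\<Union>n. B n)"
    then obtain n where "cmod z < 1 - 1 / (real n + 2)" by (auto simp: B_def)
    also have "\<dots> \<le> 1" by simp
    finally show "z \<in> unit_disk" by simp
  qed
  \<comment> \<open>Monotone convergence, read as continuity from below of the measure with density
    \<open>E\<close>.\<close>
  have lim: "(\<integral>\<^sup>+z. E z * indicator unit_disk z \<partial>lborel) = (SUP n. \<integral>\<^sup>+z. E z * indicator (B n) z \<partial>lborel)"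
    if [measurable]: "E \<in> borel_measurable borel" for E :: "complex \<Rightarrow> ennreal"
  proof -
    have [measurable]: "B n \<in> sets borel" for n by (simp add: B_def)
    have "(SUP n. emeasure (density lborel E) (B n)) = emeasure (density lborel E) (\<Union>n. B n)"
      by (rule SUP_emeasure_incseq) (use B_inc in auto)
    then show ?thesis by (simp add: B_Un emeasure_density)
  qed
  have "(\<integral>\<^sup>+z. G z \<partial>lborel) = (\<integral>\<^sup>+z. G z * indicator unit_disk z \<partial>lborel)"
    by (intro nn_integral_cong) (auto simp: G_def indicator_def)
  also have "\<dots> = (\<integral>\<^sup>+z. H z * indicator unit_disk z \<partial>lborel)"
    unfolding lim[OF G_meas] lim[OF H_meas]
    by (intro SUP_cong refl) (auto simp: B_def intro!: ball_eq)
  also have "\<dots> = (\<integral>\<^sup>+z. H z \<partial>lborel)"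
    by (intro nn_integral_cong) (auto simp: H_def indicator_def)
  also have "\<dots> = (\<Sum>m. \<integral>\<^sup>+z. ennreal (h m z) * indicator unit_disk z \<partial>lborel)"
    unfolding H_def by (rule nn_integral_suminf) measurable
  also have "\<dots> = (\<Sum>m. ennreal ((cmod (a m))\<^sup>2 * disk_moment s m))"
  proof (rule arg_cong[where f = suminf], rule ext)
    fix m
    have "(\<integral>\<^sup>+z. ennreal (h m z) * indicator unit_disk z \<partial>lborel)
        = (\<integral>\<^sup>+z. ennreal ((cmod (a m))\<^sup>2) * (ennreal (((cmod z)\<^sup>2) ^ m * (1 - (cmod z)\<^sup>2) ^ s) * indicator unit_disk z) \<partial>lborel)"
      by (intro nn_integral_cong) (auto simp: h_def ennreal_mult' indicator_def)
    also have "\<dots> = ennreal ((cmod (a m))\<^sup>2 * disk_moment s m)"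
    proof -
      have "(\<lambda>z. ennreal (((cmod z)\<^sup>2) ^ m * (1 - (cmod z)\<^sup>2) ^ s) * indicator unit_disk z)
          \<in> borel_measurable lborel" by measurable
      from nn_integral_cmult[OF this, of "ennreal ((cmod (a m))\<^sup>2)"] show ?thesis
        by (simp only: nn_integral_disk_moment ennreal_mult'[OF zero_le_power2])
    qed
    finally show "(\<integral>\<^sup>+z. ennreal (h m z) * indicator unit_disk z \<partial>lborel) = ennreal ((cmod (a m))\<^sup>2 * disk_moment s m)" .
  qed
  finally show ?thesis by (simp add: G_def a_def)
qed

section \<open>The space in terms of Taylor coefficients\<close>

lemma taylor_coeff_alt: "taylor_coeff f m = (deriv ^^ m) f 0 / fact m"
  by (simp add: fps_expansion_def)

lemma taylor_coeff_cong:
  assumes "\<And>z. z \<in> unit_disk \<Longrightarrow> f z = g z"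
  shows "taylor_coeff f = taylor_coeff g"
proof -
  have "\<forall>\<^sub>F z in nhds 0. f z = g z"
    by (rule eventually_mono[OF eventually_nhds_in_open[of unit_disk 0]]) (use assms in auto)
  then show ?thesis by (metis fps_expansion_cong)
qed

lemma taylor_coeff_sums:
  assumes "f holomorphic_on unit_disk" "z \<in> unit_disk"
  shows "(\<lambda>m. taylor_coeff f m * z ^ m) sums f z"
  using holomorphic_power_series[OF assms] by (simp add: taylor_coeff_alt)

lemma taylor_coeff_has_fps_expansion:
  assumes "f has_fps_expansion F"
  shows "taylor_coeff f = fps_nth F"
  using assms by (auto simp: fun_eq_iff taylor_coeff_alt fps_nth_fps_expansion)

lemma holomorphic_has_fps_expansion:
  assumes "f holomorphic_on unit_disk"
  shows "f has_fps_expansion fps_expansion f 0"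
  using assms by (intro has_fps_expansion_fps_expansion[of unit_disk]) auto

lemma taylor_coeff_mult:
  assumes "f holomorphic_on unit_disk" "g holomorphic_on unit_disk"
  shows "taylor_coeff (\<lambda>z. f z * g z) m = (\<Sum>j\<le>m. taylor_coeff f j * taylor_coeff g (m - j))"
  using taylor_coeff_has_fps_expansion[OF has_fps_expansion_mult[OF
        holomorphic_has_fps_expansion[OF assms(1)] holomorphic_has_fps_expansion[OF assms(2)]]]
  by (simp add: fps_mult_nth atMost_atLeast0)

lemma taylor_coeff_add:
  assumes "f holomorphic_on unit_disk" "g holomorphic_on unit_disk"
  shows "taylor_coeff (\<lambda>z. f z + g z) m = taylor_coeff f m + taylor_coeff g m"
  using taylor_coeff_has_fps_expansion[OF has_fps_expansion_add[OF
        holomorphic_has_fps_expansion[OF assms(1)] holomorphic_has_fps_expansion[OF assms(2)]]]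
  by simp

lemma taylor_coeff_cmult:
  assumes "f holomorphic_on unit_disk"
  shows "taylor_coeff (\<lambda>z. c * f z) m = c * taylor_coeff f m"
  using taylor_coeff_has_fps_expansion[OF has_fps_expansion_cmult_left[OF
        holomorphic_has_fps_expansion[OF assms]], of c]
  by simp

lemma taylor_coeff_monomial: "taylor_coeff (\<lambda>z. z ^ n) m = (if m = n then 1 else 0)"
  using taylor_coeff_has_fps_expansion[OF has_fps_expansion_fps_X_power, of n] by simp

lemma taylor_coeff_higher_deriv:
  "taylor_coeff ((deriv ^^ k) f) m = fact (m + k) / fact m * taylor_coeff f (m + k)"
  by (simp add: taylor_coeff_alt funpow_add)

lemma taylor_coeff_power_series:
  assumes "\<And>z. z \<in> unit_disk \<Longrightarrow> (\<lambda>m. a m * z ^ m) sums f z"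
  shows "f holomorphic_on unit_disk" "taylor_coeff f = a"
proof -
  show "f holomorphic_on unit_disk"
    using power_series_holomorphic[of 0 1 a f] assms by simp
  have "f has_fps_expansion Abs_fps a"
  proof (rule has_fps_expansionI)
    show "\<forall>\<^sub>F z in nhds 0. (\<lambda>m. fps_nth (Abs_fps a) m * z ^ m) sums f z"
      by (rule eventually_mono[OF eventually_nhds_in_open[of unit_disk 0]]) (use assms in auto)
  qed
  from taylor_coeff_has_fps_expansion[OF this] show "taylor_coeff f = a" by (simp add: fun_eq_iff)
qed

text \<open>For \<open>n = Suc N\<close> the weight is comparable to the reciprocal of the
  \<open>m\<close>-th kernel coefficient, that is, to the squared norm of \<open>z ^ m\<close>. The
  shift to \<open>Suc m\<close> keeps it positive at \<open>m = 0\<close>.\<close>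

definition dir_term :: "nat \<Rightarrow> (complex \<Rightarrow> complex) \<Rightarrow> nat \<Rightarrow> real" where
  "dir_term n f m = (cmod (taylor_coeff f m))\<^sup>2 * real (Suc m) ^ n"

text \<open>The square of a norm; junk unless the terms are summable.\<close>

definition dir_norm :: "nat \<Rightarrow> (complex \<Rightarrow> complex) \<Rightarrow> real" where
  "dir_norm n f = (\<Sum>m. dir_term n f m)"

lemma dir_term_nonneg [simp]: "0 \<le> dir_term n f m"
  by (simp add: dir_term_def)

lemma dir_norm_nonneg: "summable (dir_term n f) \<Longrightarrow> 0 \<le> dir_norm n f"
  unfolding dir_norm_def by (rule suminf_nonneg) auto

lemma dir_term_cong:
  "(\<And>z. z \<in> unit_disk \<Longrightarrow> f z = g z) \<Longrightarrow> dir_term n f = dir_term n g"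
  using taylor_coeff_cong[of f g] by (simp add: dir_term_def fun_eq_iff)

text \<open>The quotient of the factorials is the product of \<open>m + 1\<close>, ...,
  \<open>m + j\<close>, and each factor lies between \<open>m + 1\<close> and
  \<open>(m + 1) * j\<close>.\<close>

lemma fact_add_bounds:
  "real (Suc m) ^ j * fact m \<le> fact (m + j)"
  "fact (m + j) \<le> (real (Suc m) * real j) ^ j * fact m"
proof -
  show "real (Suc m) ^ j * fact m \<le> fact (m + j)"
  proof (induction j)
    case (Suc j)
    have "real (Suc m) ^ Suc j * fact m \<le> real (Suc m) * fact (m + j)"
      using Suc by (simp only: power_Suc mult.assoc mult_left_mono of_nat_0_le_iff)
    also have "\<dots> \<le> real (Suc (m + j)) * fact (m + j)"
      by (intro mult_right_mono) auto
    finally show ?case by simp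
  qed simp
  \<comment> \<open>The induction runs over the number \<open>i\<close> of factors while the base
    keeps the fixed \<open>j\<close>.\<close>
  have "fact (m + i) \<le> (real (Suc m) * real j) ^ i * fact m" if "i \<le> j" for i
    using that
  proof (induction i)
    case (Suc i)
    have "real (Suc (m + i)) \<le> real (Suc m) * real j"
    proof -
      have "Suc (m + i) \<le> Suc m * j"
      proof -
        have "m \<le> m * j" using Suc.prems by (cases j) auto
        then show ?thesis using Suc.prems unfolding mult_Suc by linarith
      qed
      then show ?thesis by (metis of_nat_le_iff of_nat_mult)
    qed
    then have "real (Suc (m + i)) * fact (m + i) \<le> (real (Suc m) * real j) * ((real (Suc m) * real j) ^ i * fact m)"
      using Suc by (intro mult_mono) auto
    then show ?case by (simp add: mult_ac)
  qed simp
  then show "fact (m + j) \<le> (real (Suc m) * real j) ^ j * fact m" by simp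
qed

text \<open>The squared quotient of factorials grows like the power \<open>2 * k\<close> of
  \<open>m\<close>, and the moment decays like the power \<open>s + 1\<close>; the assumption says
  that the exponent \<open>n\<close> remains. The bounds are stated with \<open>Suc (m + k)\<close>
  because differentiating \<open>k\<close> times shifts the coefficients by
  \<open>k\<close>.\<close>

lemma moment_bounds:
  assumes "2 * k = Suc s + n"
  obtains A B where "A > 0" "B > 0"
    "\<And>m. A * real (Suc (m + k)) ^ n \<le> (fact (m + k) / fact m)\<^sup>2 * disk_moment s m"
    "\<And>m. (fact (m + k) / fact m)\<^sup>2 * disk_moment s m \<le> B * real (Suc (m + k)) ^ n"
proof -
  define r where "r = (\<lambda>j m. fact (m + j) / fact m :: real)"
  have r: "real (Suc m) ^ j \<le> r j m" "r j m \<le> (real (Suc m) * real j) ^ j" "0 < r j m" for j m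
    using fact_add_bounds[of m j] by (auto simp: r_def le_divide_eq divide_le_eq)
  have eq: "(fact (m + k) / fact m)\<^sup>2 * disk_moment s m = (r k m)\<^sup>2 / r (Suc s) m * (pi * fact s)" for m
    by (simp add: r_def disk_moment_def)
  have k: "0 < k" using assms by (cases k) auto
  \<comment> \<open>In \<open>A\<close>, the power of \<open>Suc s\<close> comes from the upper
    bound for \<open>r (Suc s) m\<close>, the power of \<open>Suc k\<close> from
    \<open>Suc (m + k) \<le> Suc k * Suc m\<close>. In \<open>B\<close>, the power of
    \<open>k\<close> comes from the upper bound for \<open>r k m\<close>.\<close>
  define A where "A = pi * fact s / real (Suc s) ^ Suc s / real (Suc k) ^ n"
  define B where "B = pi * fact s * real k ^ (2 * k)"
  show thesis
  proof (rule that)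
    show "A > 0" by (simp add: A_def)
    show "B > 0" using k by (simp add: B_def)
    fix m
    have p: "(real (Suc m) ^ k)\<^sup>2 = real (Suc m) ^ Suc s * real (Suc m) ^ n"
      by (simp only: power_mult[symmetric] mult.commute[of k] assms power_add)
    have "A * real (Suc (m + k)) ^ n \<le> A * (real (Suc k) ^ n * real (Suc m) ^ n)"
    proof (intro mult_left_mono)
      have "Suc (m + k) \<le> Suc k * Suc m" by simp
      then have "real (Suc (m + k)) \<le> real (Suc k) * real (Suc m)" by (metis of_nat_le_iff of_nat_mult)
      then show "real (Suc (m + k)) ^ n \<le> real (Suc k) ^ n * real (Suc m) ^ n"
        by (metis of_nat_0_le_iff power_mono power_mult_distrib)
    qed (simp add: A_def)
    also have "\<dots> = (real (Suc m) ^ k)\<^sup>2 / (real (Suc m) * real (Suc s)) ^ Suc s * (pi * fact s)"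
      unfolding p power_mult_distrib A_def by (simp add: field_simps del: of_nat_Suc power_Suc)
    also have "\<dots> \<le> (r k m)\<^sup>2 / r (Suc s) m * (pi * fact s)"
      using r[where j = k and m = m] r[where j = "Suc s" and m = m]
      by (intro mult_right_mono frac_le power_mono) auto
    finally show "A * real (Suc (m + k)) ^ n \<le> (fact (m + k) / fact m)\<^sup>2 * disk_moment s m"
      by (simp only: eq)
    have "(r k m)\<^sup>2 / r (Suc s) m * (pi * fact s)
       \<le> ((real (Suc m) * real k) ^ k)\<^sup>2 / real (Suc m) ^ Suc s * (pi * fact s)"
      using r[where j = k and m = m] r[where j = "Suc s" and m = m]
      by (intro mult_right_mono frac_le power_mono) auto
    also have "((real (Suc m) * real k) ^ k)\<^sup>2 = (real (Suc m) ^ Suc s * real (Suc m) ^ n) * real k ^ (2 * k)"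
      by (simp only: power_mult_distrib p) (simp add: power_mult[symmetric] mult.commute)
    also have "(real (Suc m) ^ Suc s * real (Suc m) ^ n) * real k ^ (2 * k) / real (Suc m) ^ Suc s * (pi * fact s)
        = B * real (Suc m) ^ n"
      by (simp add: B_def)
    also have "\<dots> \<le> B * real (Suc (m + k)) ^ n"
      using \<open>B > 0\<close> by (intro mult_left_mono power_mono) auto
    finally show "(fact (m + k) / fact m)\<^sup>2 * disk_moment s m \<le> B * real (Suc (m + k)) ^ n"
      by (simp only: eq)
  qed
qed

definition area_integral :: "nat \<Rightarrow> nat \<Rightarrow> (complex \<Rightarrow> complex) \<Rightarrow> ennreal" where
  "area_integral k s f =
     (\<integral>\<^sup>+z. ennreal ((cmod ((deriv ^^ k) f z))\<^sup>2 * (1 - (cmod z)\<^sup>2) ^ s) * indicator unit_disk z \<partial>lborel)"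

text \<open>Parseval for the \<open>k\<close>-th derivative, compared term by term. Only the tail
  from index \<open>k\<close> on appears, since the derivative annihilates the lower coefficients;
  the constants do not depend on \<open>f\<close>.\<close>

lemma area_integral_bounds:
  assumes "2 * k = Suc s + n"
  obtains A B where "A > 0" "B > 0"
    "\<And>f. f holomorphic_on unit_disk \<Longrightarrow>
       ennreal A * (\<Sum>m. ennreal (dir_term n f (m + k))) \<le> area_integral k s f"
    "\<And>f. f holomorphic_on unit_disk \<Longrightarrow>
       area_integral k s f \<le> ennreal B * (\<Sum>m. ennreal (dir_term n f (m + k)))"
proof -
  obtain A B where AB: "A > 0" "B > 0"
    "\<And>m. A * real (Suc (m + k)) ^ n \<le> (fact (m + k) / fact m)\<^sup>2 * disk_moment s m"
    "\<And>m. (fact (m + k) / fact m)\<^sup>2 * disk_moment s m \<le> B * real (Suc (m + k)) ^ n"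
    using moment_bounds[OF assms] by blast
  have eq: "area_integral k s f
      = (\<Sum>m. ennreal ((cmod (taylor_coeff f (m + k)))\<^sup>2 * ((fact (m + k) / fact m)\<^sup>2 * disk_moment s m)))"
    if f: "f holomorphic_on unit_disk" for f
  proof -
    have "(cmod (taylor_coeff ((deriv ^^ k) f) m))\<^sup>2 * disk_moment s m
        = (cmod (taylor_coeff f (m + k)))\<^sup>2 * ((fact (m + k) / fact m)\<^sup>2 * disk_moment s m)" for m
      unfolding taylor_coeff_higher_deriv
      by (simp add: norm_mult norm_divide power_mult_distrib power_divide)
    then show ?thesis
      unfolding area_integral_def
        nn_integral_disk_power_series[OF holomorphic_higher_deriv[OF f open_ball]]
      by (simp only:)
  qed
  show thesis
  proof (rule that[OF AB(1,2)])
    fix f assume f: "f holomorphic_on unit_disk"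
    show "ennreal A * (\<Sum>m. ennreal (dir_term n f (m + k))) \<le> area_integral k s f"
      unfolding eq[OF f] ennreal_suminf_cmult[symmetric]
    proof (intro suminf_le summableI)
      fix m
      have "A * dir_term n f (m + k) \<le> (cmod (taylor_coeff f (m + k)))\<^sup>2 * ((fact (m + k) / fact m)\<^sup>2 * disk_moment s m)"
        using mult_left_mono[OF AB(3)[of m], of "(cmod (taylor_coeff f (m + k)))\<^sup>2"]
        by (simp add: dir_term_def mult_ac)
      then show "ennreal A * ennreal (dir_term n f (m + k))
        \<le> ennreal ((cmod (taylor_coeff f (m + k)))\<^sup>2 * ((fact (m + k) / fact m)\<^sup>2 * disk_moment s m))"
        using AB(1) by (subst ennreal_mult[symmetric]) (auto intro!: ennreal_leI)
    qed
    show "area_integral k s f \<le> ennreal B * (\<Sum>m. ennreal (dir_term n f (m + k)))"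
      unfolding eq[OF f] ennreal_suminf_cmult[symmetric]
    proof (intro suminf_le summableI)
      fix m
      have "(cmod (taylor_coeff f (m + k)))\<^sup>2 * ((fact (m + k) / fact m)\<^sup>2 * disk_moment s m) \<le> B * dir_term n f (m + k)"
        using mult_left_mono[OF AB(4)[of m], of "(cmod (taylor_coeff f (m + k)))\<^sup>2"]
        by (simp add: dir_term_def mult_ac)
      then show "ennreal ((cmod (taylor_coeff f (m + k)))\<^sup>2 * ((fact (m + k) / fact m)\<^sup>2 * disk_moment s m))
        \<le> ennreal B * ennreal (dir_term n f (m + k))"
        using AB(2) by (subst ennreal_mult[symmetric]) (auto intro!: ennreal_leI)
    qed
  qed
qed

text \<open>The finitely many coefficients missed by the area integral do not affect summability.
  Hence finiteness is the same for all pairs \<open>k\<close>, \<open>s\<close> with the same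
  \<open>n\<close>, which settles the free choice of \<open>k\<close> in \<open>A2\<close>.\<close>

lemma summable_dir_term_iff_area_integral:
  assumes "2 * k = Suc s + n" and f: "f holomorphic_on unit_disk"
  shows "summable (dir_term n f) \<longleftrightarrow> area_integral k s f < \<infinity>"
proof -
  obtain A B where AB: "A > 0" "B > 0"
    "ennreal A * (\<Sum>m. ennreal (dir_term n f (m + k))) \<le> area_integral k s f"
    "area_integral k s f \<le> ennreal B * (\<Sum>m. ennreal (dir_term n f (m + k)))"
    using area_integral_bounds[OF assms(1)] f by metis
  have "summable (dir_term n f) \<longleftrightarrow> summable (\<lambda>m. dir_term n f (m + k))"
    by (rule summable_iff_shift[symmetric])
  also have "\<dots> \<longleftrightarrow> (\<Sum>m. ennreal (dir_term n f (m + k))) < \<infinity>"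
  proof
    assume "summable (\<lambda>m. dir_term n f (m + k))"
    then show "(\<Sum>m. ennreal (dir_term n f (m + k))) < \<infinity>"
      by (subst suminf_ennreal2) auto
  next
    assume "(\<Sum>m. ennreal (dir_term n f (m + k))) < \<infinity>"
    then show "summable (\<lambda>m. dir_term n f (m + k))"
      by (intro summable_suminf_not_top) (auto simp: less_top)
  qed
  also have "\<dots> \<longleftrightarrow> area_integral k s f < \<infinity>"
  proof
    assume "(\<Sum>m. ennreal (dir_term n f (m + k))) < \<infinity>"
    then have "ennreal B * (\<Sum>m. ennreal (dir_term n f (m + k))) < \<infinity>"
      by (simp add: ennreal_mult_less_top)
    with AB(4) show "area_integral k s f < \<infinity>" by (rule le_less_trans)
  next
    assume "area_integral k s f < \<infinity>"
    with AB(3) have "ennreal A * (\<Sum>m. ennreal (dir_term n f (m + k))) < \<infinity>" by (rule le_less_trans)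
    then show "(\<Sum>m. ennreal (dir_term n f (m + k))) < \<infinity>"
      using AB(1) by (auto simp: ennreal_mult_less_top)
  qed
  finally show ?thesis .
qed

text \<open>Squaring contributes \<open>2 * k\<close> powers of \<open>1 - |z|^2\<close>, which
  merge with the weight of exponent \<open>\<alpha>\<close> into the natural exponent
  \<open>s\<close>.\<close>

lemma L2_dA_iff_area_integral:
  assumes f: "f holomorphic_on unit_disk" and s: "\<alpha> + 2 * real k = real s"
  shows "(\<lambda>z. of_real ((1 - (cmod z)\<^sup>2) ^ k) * (deriv ^^ k) f z) \<in> L2 (dA \<alpha>) \<longleftrightarrow> area_integral k s f < \<infinity>"
proof -
  define F where "F = (\<lambda>z. of_real ((1 - (cmod z)\<^sup>2) ^ k) * (deriv ^^ k) f z)"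
  let ?R = "restrict_space lborel unit_disk"
  have cont: "continuous_on unit_disk F"
    unfolding F_def using f
    by (intro continuous_intros holomorphic_on_imp_continuous_on holomorphic_higher_deriv) auto
  have F_meas [measurable]: "F \<in> borel_measurable ?R"
    using borel_measurable_continuous_on_restrict[OF cont]
    by (simp add: measurable_def space_restrict_space sets_restrict_space)
  have w_meas [measurable]: "(\<lambda>z. (1 - (cmod z)\<^sup>2) powr \<alpha>) \<in> borel_measurable ?R"
    by (rule measurable_restrict_space1) measurable
  have F_meas': "F \<in> borel_measurable (dA \<alpha>)" by (simp add: dA_def)
  then have "F \<in> L2 (dA \<alpha>) \<longleftrightarrow> (\<integral>\<^sup>+z. ennreal ((cmod (F z))\<^sup>2) \<partial>dA \<alpha>) < \<infinity>"
    by (simp add: L2_def integrable_iff_bounded)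
  also have "(\<integral>\<^sup>+z. ennreal ((cmod (F z))\<^sup>2) \<partial>dA \<alpha>)
      = (\<integral>\<^sup>+z. ennreal ((1 - (cmod z)\<^sup>2) powr \<alpha>) * ennreal ((cmod (F z))\<^sup>2) \<partial>?R)"
    unfolding dA_def by (rule nn_integral_density) measurable
  also have "\<dots> = (\<integral>\<^sup>+z. ennreal ((1 - (cmod z)\<^sup>2) powr \<alpha>) * ennreal ((cmod (F z))\<^sup>2) * indicator unit_disk z \<partial>lborel)"
    by (rule nn_integral_restrict_space) simp
  also have "\<dots> = area_integral k s f"
    unfolding area_integral_def
  proof (rule nn_integral_cong)
    fix z :: complex
    show "ennreal ((1 - (cmod z)\<^sup>2) powr \<alpha>) * ennreal ((cmod (F z))\<^sup>2) * indicator unit_disk z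
        = ennreal ((cmod ((deriv ^^ k) f z))\<^sup>2 * (1 - (cmod z)\<^sup>2) ^ s) * indicator unit_disk z"
    proof (cases "z \<in> unit_disk")
      case True
      define t where "t = 1 - (cmod z)\<^sup>2"
      have t: "0 < t" using True by (simp add: t_def power_less_one_iff)
      have "(cmod (F z))\<^sup>2 = t ^ (2 * k) * (cmod ((deriv ^^ k) f z))\<^sup>2"
        using t by (simp add: F_def norm_mult power_mult_distrib flip: t_def power_mult of_real_power)
          (simp add: mult.commute)
      moreover have "t powr \<alpha> * t ^ (2 * k) = t ^ s"
      proof -
        have "t powr \<alpha> * t ^ (2 * k) = t powr (\<alpha> + 2 * real k)"
          using t by (simp add: powr_add powr_realpow[symmetric])
        then show ?thesis using t by (simp add: s powr_realpow)
      qed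
      ultimately have "t powr \<alpha> * (cmod (F z))\<^sup>2 = (cmod ((deriv ^^ k) f z))\<^sup>2 * t ^ s"
        by (simp add: mult_ac)
      then show ?thesis using True by (simp add: t_def flip: ennreal_mult')
    qed simp
  qed
  finally show ?thesis by (simp add: F_def)
qed

lemma A2_iff:
  assumes \<alpha>: "\<alpha> + 2 = - real N"
  shows "f \<in> A2 \<alpha> \<longleftrightarrow> f holomorphic_on unit_disk \<and> (\<forall>z. z \<notin> unit_disk \<longrightarrow> f z = 0) \<and>
           summable (dir_term (Suc N) f)"
proof (cases "f holomorphic_on unit_disk")
  case True
  have "(\<exists>k::nat. \<alpha> + 2 * real k > -1 \<and>
         (\<lambda>z. of_real ((1 - (cmod z)\<^sup>2) ^ k) * (deriv ^^ k) f z) \<in> L2 (dA \<alpha>))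
       \<longleftrightarrow> summable (dir_term (Suc N) f)"
  proof
    assume "\<exists>k::nat. \<alpha> + 2 * real k > -1 \<and>
         (\<lambda>z. of_real ((1 - (cmod z)\<^sup>2) ^ k) * (deriv ^^ k) f z) \<in> L2 (dA \<alpha>)"
    then obtain k where k: "\<alpha> + 2 * real k > -1"
      "(\<lambda>z. of_real ((1 - (cmod z)\<^sup>2) ^ k) * (deriv ^^ k) f z) \<in> L2 (dA \<alpha>)" by blast
    \<comment> \<open>As \<open>\<alpha>\<close> is an integer, the strict bound by -1 makes
      \<open>\<alpha> + 2 * k\<close> a natural number, the exponent \<open>s\<close> below.\<close>
    have "N + 2 \<le> 2 * k" using k(1) \<alpha> by linarith
    then obtain s where s: "2 * k = N + 2 + s" using le_Suc_ex by blast
    have "\<alpha> + 2 * real k = real s" using \<alpha> s by linarith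
    from L2_dA_iff_area_integral[OF True this] k(2) have "area_integral k s f < \<infinity>" by blast
    moreover have "2 * k = Suc s + Suc N" using s by simp
    ultimately show "summable (dir_term (Suc N) f)"
      using summable_dir_term_iff_area_integral[OF _ True] by blast
  next
    assume sm: "summable (dir_term (Suc N) f)"
    \<comment> \<open>The witness is \<open>k = Suc N\<close>, for which the remaining weight
      exponent is \<open>N\<close>.\<close>
    have "area_integral (Suc N) N f < \<infinity>"
      using summable_dir_term_iff_area_integral[OF _ True, of "Suc N" N "Suc N"] sm by simp
    moreover have eq: "\<alpha> + 2 * real (Suc N) = real N" using \<alpha> by simp
    ultimately have "(\<lambda>z. of_real ((1 - (cmod z)\<^sup>2) ^ Suc N) * (deriv ^^ Suc N) f z) \<in> L2 (dA \<alpha>)"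
      using L2_dA_iff_area_integral[OF True eq] by blast
    moreover have "\<alpha> + 2 * real (Suc N) > -1" unfolding eq by simp
    ultimately show "\<exists>k::nat. \<alpha> + 2 * real k > -1 \<and>
         (\<lambda>z. of_real ((1 - (cmod z)\<^sup>2) ^ k) * (deriv ^^ k) f z) \<in> L2 (dA \<alpha>)"
      by blast
  qed
  then show ?thesis using True by (simp add: A2_def)
qed (simp add: A2_def)

text \<open>A single term of the exponential series is at most the whole,
  \<open>t ^ n / fact n \<le> exp t\<close>, taken at \<open>t = ln x * Suc j\<close>.\<close>

lemma power_Suc_le_geometric:
  fixes x :: real
  assumes "1 < x"
  obtains C where "0 < C" "\<And>j. real (Suc j) ^ n \<le> C * x ^ j"
proof (rule that)
  define c where "c = ln x"
  have c: "0 < c" using assms by (simp add: c_def)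
  show "0 < fact n * x / c ^ n" using c assms by simp
  fix j
  define t where "t = c * real (Suc j)"
  have t: "0 \<le> t" using c by (simp add: t_def)
  have "t ^ n /\<^sub>R fact n \<le> exp t"
    unfolding exp_def using t summable_exp_generic[of t]
      sum_le_suminf[of "\<lambda>n. t ^ n /\<^sub>R fact n" "{n}"] by simp
  then have "t ^ n \<le> fact n * exp t" by (simp add: field_simps)
  also have "exp t = x ^ Suc j"
    unfolding t_def c_def using assms by (simp add: exp_of_nat2_mult del: of_nat_Suc power_Suc)
  finally show "real (Suc j) ^ n \<le> fact n * x / c ^ n * x ^ j"
    using c by (simp add: t_def power_mult_distrib field_simps del: of_nat_Suc)
qed

text \<open>With \<open>1 < r < r' < R\<close>, convergence at \<open>r'\<close> gives absolute
  convergence at \<open>r\<close>, and the geometric factor \<open>r ^ j\<close> absorbs the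
  polynomial weight.\<close>

lemma summable_taylor_coeff_weight:
  assumes u: "u holomorphic_on ball 0 R" and R: "1 < R"
  shows "summable (\<lambda>j. cmod (taylor_coeff u j) * real (Suc j) ^ n)"
proof -
  define r where "r = (1 + R) / 2"
  have r: "1 < r" "r < R" using R by (auto simp: r_def)
  define r' where "r' = (r + R) / 2"
  have r': "r < r'" "r' < R" using r by (auto simp: r'_def)
  have "summable (\<lambda>j. taylor_coeff u j * of_real r' ^ j)"
    using holomorphic_power_series[OF u, of "of_real r'"] r r'
    by (auto simp: taylor_coeff_alt sums_iff)
  then have s: "summable (\<lambda>j. cmod (taylor_coeff u j * of_real r ^ j))"
    by (rule powser_insidea) (use r r' in auto)
  obtain C where C: "0 < C" "\<And>j. real (Suc j) ^ n \<le> C * r ^ j"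
    using power_Suc_le_geometric[OF r(1)] by blast
  show ?thesis
  proof (rule summable_comparison_test'[OF summable_mult[OF s, of C], of 0])
    fix j
    have "cmod (taylor_coeff u j) * real (Suc j) ^ n \<le> cmod (taylor_coeff u j) * (C * r ^ j)"
      by (intro mult_left_mono C) auto
    then show "norm (cmod (taylor_coeff u j) * real (Suc j) ^ n) \<le> C * cmod (taylor_coeff u j * of_real r ^ j)"
      using r by (simp add: norm_mult norm_power mult_ac)
  qed
qed

text \<open>A convolution estimate: the weight is submultiplicative,
  \<open>m + 1 \<le> (j + 1) * (m - j + 1)\<close>, and the weighted coefficients of
  \<open>u\<close> are absolutely summable. One factor \<open>A\<close> of the constant comes from
  Cauchy-Schwarz, the other from the Cauchy product.\<close>

lemma dir_norm_mult:
  assumes u: "u holomorphic_on ball 0 R" and R: "1 < R"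
  obtains C where "0 \<le> C"
    "\<And>f. f holomorphic_on unit_disk \<Longrightarrow> summable (dir_term n f) \<Longrightarrow>
       summable (dir_term n (\<lambda>z. u z * f z)) \<and> dir_norm n (\<lambda>z. u z * f z) \<le> C * dir_norm n f"
proof -
  define a where "a = (\<lambda>j. cmod (taylor_coeff u j) * real (Suc j) ^ n)"
  have a_sum: "summable a"
    unfolding a_def using summable_taylor_coeff_weight[OF u R] .
  have a_nonneg: "0 \<le> a j" and a_ge: "cmod (taylor_coeff u j) \<le> a j" for j
    using mult_left_mono[of 1 "real (Suc j) ^ n" "cmod (taylor_coeff u j)"]
    by (auto simp: a_def one_le_power)
  define A where "A = (\<Sum>j. a j)"
  have A: "0 \<le> A" unfolding A_def using a_sum a_nonneg by (rule suminf_nonneg)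
  have u': "u holomorphic_on unit_disk" using u by (rule holomorphic_on_subset) (use R in auto)
  show thesis
  proof (rule that)
    show "0 \<le> A * A" using A by simp
    fix f assume f: "f holomorphic_on unit_disk" and sm: "summable (dir_term n f)"
    define b where "b = dir_term n f"
    have b_nonneg: "0 \<le> b i" for i by (simp add: b_def)
    have CP: "(\<lambda>m. \<Sum>j\<le>m. a j * b (m - j)) sums (A * dir_norm n f)"
      unfolding A_def dir_norm_def b_def[symmetric]
      by (rule Cauchy_product_sums) (use a_sum a_nonneg sm b_nonneg in \<open>simp_all add: b_def\<close>)
    have le: "dir_term n (\<lambda>z. u z * f z) m \<le> A * (\<Sum>j\<le>m. a j * b (m - j))" for m
    proof -
      define p where "p = (\<lambda>j. cmod (taylor_coeff u j))"
      define q where "q = (\<lambda>j. cmod (taylor_coeff f (m - j)))"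
      have pq: "0 \<le> p j" "0 \<le> q j" for j by (auto simp: p_def q_def)
      have "cmod (taylor_coeff (\<lambda>z. u z * f z) m) \<le> (\<Sum>j\<le>m. p j * q j)"
        unfolding taylor_coeff_mult[OF u' f] p_def q_def norm_mult[symmetric] by (rule norm_sum)
      \<comment> \<open>Splitting \<open>p j\<close> into two square roots lets Cauchy-Schwarz
        square only the coefficients of \<open>f\<close> and keep those of \<open>u\<close> in first
        power, where they are summable.\<close>
      also have "\<dots> = (\<Sum>j\<le>m. sqrt (p j) * (sqrt (p j) * q j))"
        using pq by (simp flip: mult.assoc)
      finally have "(cmod (taylor_coeff (\<lambda>z. u z * f z) m))\<^sup>2 \<le> (\<Sum>j\<le>m. sqrt (p j) * (sqrt (p j) * q j))\<^sup>2"
        by (intro power_mono) auto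
      also have "\<dots> \<le> (\<Sum>j\<le>m. (sqrt (p j))\<^sup>2) * (\<Sum>j\<le>m. (sqrt (p j) * q j)\<^sup>2)"
        by (rule Cauchy_Schwarz_ineq_sum)
      also have "\<dots> = (\<Sum>j\<le>m. p j) * (\<Sum>j\<le>m. p j * (q j)\<^sup>2)"
        using pq by (simp add: power_mult_distrib)
      also have "\<dots> \<le> A * (\<Sum>j\<le>m. p j * (q j)\<^sup>2)"
      proof (intro mult_right_mono sum_nonneg)
        have "(\<Sum>j\<le>m. p j) \<le> (\<Sum>j\<le>m. a j)" by (intro sum_mono) (auto simp: p_def a_ge)
        also have "\<dots> \<le> A" unfolding A_def using a_sum a_nonneg by (intro sum_le_suminf) auto
        finally show "(\<Sum>j\<le>m. p j) \<le> A" .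
      qed (use pq in auto)
      finally have "dir_term n (\<lambda>z. u z * f z) m \<le> A * (\<Sum>j\<le>m. p j * (q j)\<^sup>2) * real (Suc m) ^ n"
        unfolding dir_term_def by (intro mult_right_mono) auto
      also have "\<dots> = A * (\<Sum>j\<le>m. p j * (q j)\<^sup>2 * real (Suc m) ^ n)"
        by (simp add: sum_distrib_right mult.assoc)
      also have "\<dots> \<le> A * (\<Sum>j\<le>m. a j * b (m - j))"
      proof (intro mult_left_mono sum_mono A)
        fix j assume "j \<in> {..m}"
        then have "Suc m \<le> Suc j * Suc (m - j)" by auto
        then have "real (Suc m) \<le> real (Suc j) * real (Suc (m - j))" by (metis of_nat_le_iff of_nat_mult)
        then have "real (Suc m) ^ n \<le> real (Suc j) ^ n * real (Suc (m - j)) ^ n"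
          by (metis of_nat_0_le_iff power_mono power_mult_distrib)
        then have "p j * (q j)\<^sup>2 * real (Suc m) ^ n \<le> p j * (q j)\<^sup>2 * (real (Suc j) ^ n * real (Suc (m - j)) ^ n)"
          using pq by (intro mult_left_mono) auto
        then show "p j * (q j)\<^sup>2 * real (Suc m) ^ n \<le> a j * b (m - j)"
          by (simp add: a_def b_def dir_term_def p_def q_def mult_ac)
      qed
      finally show ?thesis .
    qed
    have sm': "summable (\<lambda>m. A * (\<Sum>j\<le>m. a j * b (m - j)))"
      using CP by (intro summable_mult) (simp add: sums_iff)
    then have "summable (dir_term n (\<lambda>z. u z * f z))"
      by (rule summable_comparison_test'[of _ 0]) (use le in simp)
    moreover have "dir_norm n (\<lambda>z. u z * f z) \<le> (\<Sum>m. A * (\<Sum>j\<le>m. a j * b (m - j)))"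
      unfolding dir_norm_def using le calculation sm' by (rule suminf_le)
    moreover have "(\<Sum>m. A * (\<Sum>j\<le>m. a j * b (m - j))) = A * A * dir_norm n f"
      using sums_mult[OF CP, of A] by (simp add: sums_iff mult.assoc)
    ultimately show "summable (dir_term n (\<lambda>z. u z * f z)) \<and> dir_norm n (\<lambda>z. u z * f z) \<le> A * A * dir_norm n f"
      by simp
  qed
qed

lemma summable_dir_term_monomial: "summable (dir_term n (\<lambda>z. z ^ m))"
  by (rule summable_finite[of "{m}"]) (auto simp: dir_term_def taylor_coeff_monomial)

lemma summable_dir_term_holomorphic:
  assumes u: "u holomorphic_on ball 0 R" and R: "1 < R"
  shows "summable (dir_term n u)"
proof -
  obtain C where "0 \<le> C" and C:
    "\<And>f. f holomorphic_on unit_disk \<Longrightarrow> summable (dir_term n f) \<Longrightarrow>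
       summable (dir_term n (\<lambda>z. u z * f z)) \<and> dir_norm n (\<lambda>z. u z * f z) \<le> C * dir_norm n f"
    by (rule dir_norm_mult[OF u R]) (rule that)
  have "summable (dir_term n (\<lambda>z. u z * z ^ 0))"
    by (rule conjunct1[OF C]) (intro holomorphic_intros summable_dir_term_monomial)+
  then show ?thesis by simp
qed

section \<open>Boundedness of linear fractional composition operators\<close>

text \<open>After the disk automorphism taking \<open>p = \<phi> 0\<close> to 0, the Schwarz lemma
  applies. The automorphism changes \<open>1 - |w|^2\<close> by the factor
  \<open>(1 - |p|^2) / |1 - cnj p * w|^2\<close>, whose denominator is at least
  \<open>(1 - |p|)^2\<close>; this gives the constant.\<close>

lemma schwarz_pick_bound:
  assumes hol: "\<phi> holomorphic_on unit_disk" and self: "\<phi> ` unit_disk \<subseteq> unit_disk"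
  obtains K where "0 < K" "\<And>z. z \<in> unit_disk \<Longrightarrow> 1 - (cmod z)\<^sup>2 \<le> K * (1 - (cmod (\<phi> z))\<^sup>2)"
proof -
  define p where "p = \<phi> 0"
  have self': "cmod (\<phi> z) < 1" if "cmod z < 1" for z
    using self that by (force simp: image_subset_iff)
  have p: "cmod p < 1" using self'[of 0] by (simp add: p_def)
  define \<psi> where "\<psi> = Moebius_function 0 p \<circ> \<phi>"
  have \<psi>_hol: "\<psi> holomorphic_on ball 0 1"
    unfolding \<psi>_def using hol Moebius_function_holomorphic[OF p] self
    by (rule holomorphic_on_compose_gen)
  have \<psi>_le: "cmod (\<psi> z) \<le> cmod z" if "cmod z < 1" for z
    by (rule Schwarz_Lemma(1)[OF \<psi>_hol])
      (use that p self' in \<open>auto simp: \<psi>_def p_def[symmetric] Moebius_function_eq_zero intro!: Moebius_function_norm_lt_1\<close>)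
  show thesis
  proof (rule that)
    show "0 < (1 - (cmod p)\<^sup>2) / (1 - cmod p)\<^sup>2"
      using p by (simp add: power_less_one_iff)
    fix z assume z: "z \<in> unit_disk"
    define w where "w = \<phi> z"
    have w: "cmod w < 1" using self' z by (simp add: w_def)
    have den: "1 - cmod p \<le> cmod (1 - cnj p * w)"
    proof -
      have "1 - cmod (cnj p * w) \<le> cmod (1 - cnj p * w)"
        using norm_triangle_ineq2[of 1 "cnj p * w"] by simp
      moreover have "cmod (cnj p * w) \<le> cmod p * 1"
        unfolding norm_mult complex_mod_cnj using w by (intro mult_left_mono) auto
      ultimately show ?thesis by simp
    qed
    have den0: "0 < cmod (1 - cnj p * w)" using den p by linarith
    have id: "(cmod (1 - cnj p * w))\<^sup>2 - (cmod (w - p))\<^sup>2 = (1 - (cmod p)\<^sup>2) * (1 - (cmod w)\<^sup>2)"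
      unfolding cmod_power2 by (simp add: algebra_simps power2_eq_square)
    have "(cmod (\<psi> z))\<^sup>2 = (cmod (w - p))\<^sup>2 / (cmod (1 - cnj p * w))\<^sup>2"
      by (simp add: \<psi>_def Moebius_function_simple w_def norm_divide power_divide)
    then have eq: "1 - (cmod (\<psi> z))\<^sup>2 = (1 - (cmod p)\<^sup>2) * (1 - (cmod w)\<^sup>2) / (cmod (1 - cnj p * w))\<^sup>2"
      using den0 by (simp add: id[symmetric] diff_divide_distrib)
    have "1 - (cmod z)\<^sup>2 \<le> 1 - (cmod (\<psi> z))\<^sup>2"
      using \<psi>_le[of z] z by (simp add: power_mono)
    also have "\<dots> \<le> (1 - (cmod p)\<^sup>2) * (1 - (cmod w)\<^sup>2) / (1 - cmod p)\<^sup>2"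
      unfolding eq using den p w
      by (intro divide_left_mono power_mono mult_nonneg_nonneg) (auto simp: power_le_one_iff intro!: mult_pos_pos zero_less_power den0)
    finally show "1 - (cmod z)\<^sup>2 \<le> (1 - (cmod p)\<^sup>2) / (1 - cmod p)\<^sup>2 * (1 - (cmod (\<phi> z))\<^sup>2)"
      by (simp add: w_def)
  qed
qed

text \<open>Leibniz' rule stops after two terms, because the second derivative of the linear factor
  vanishes.\<close>

lemma higher_deriv_linear_mult:
  assumes "open S" "X holomorphic_on S" "z \<in> S"
  shows "(deriv ^^ Suc k) (\<lambda>z. (c * z + d) * X z) z
      = (c * z + d) * (deriv ^^ Suc k) X z + of_nat (Suc k) * c * (deriv ^^ k) X z"
  using assms(3)
proof (induction k arbitrary: z)
  case 0
  have "((\<lambda>z. (c * z + d) * X z) has_field_derivative (c * z + d) * deriv X z + c * X z) (at z)"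
    using holomorphic_derivI[OF assms(2,1) 0] by (auto intro!: derivative_eq_intros)
  then show ?case by (simp add: DERIV_imp_deriv)
next
  case (Suc k)
  have hk: "((deriv ^^ j) X has_field_derivative (deriv ^^ Suc j) X z) (at z)" for j
    using holomorphic_derivI[OF holomorphic_higher_deriv[OF assms(2,1)] assms(1) Suc.prems] by simp
  have "(deriv ^^ Suc (Suc k)) (\<lambda>z. (c * z + d) * X z) z = deriv ((deriv ^^ Suc k) (\<lambda>z. (c * z + d) * X z)) z"
    by simp
  also have "\<dots> = deriv (\<lambda>z. (c * z + d) * (deriv ^^ Suc k) X z + of_nat (Suc k) * c * (deriv ^^ k) X z) z"
    by (rule deriv_cong_ev, rule eventually_mono[OF eventually_nhds_in_open[OF assms(1) Suc.prems]])
      (use Suc.IH in auto)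
  also have "\<dots> = (c * z + d) * (deriv ^^ Suc (Suc k)) X z + of_nat (Suc (Suc k)) * c * (deriv ^^ Suc k) X z"
  proof (rule DERIV_imp_deriv)
    have "((\<lambda>z. c * z + d) has_field_derivative c) (at z)"
      by (auto intro!: derivative_eq_intros)
    from DERIV_add[OF DERIV_mult[OF this hk[of "Suc k"]] DERIV_cmult[OF hk[of k], of "of_nat (Suc k) * c"]]
    show "((\<lambda>z. (c * z + d) * (deriv ^^ Suc k) X z + of_nat (Suc k) * c * (deriv ^^ k) X z) has_field_derivative
        (c * z + d) * (deriv ^^ Suc (Suc k)) X z + of_nat (Suc (Suc k)) * c * (deriv ^^ Suc k) X z) (at z)"
      by (rule DERIV_cong) (simp add: algebra_simps)
  qed
  finally show ?case .
qed

text \<open>Each induction step adds one factor \<open>c * z + d\<close> and one derivative. The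
  exponent \<open>M\<close> is exactly the one at which the contribution of the next lower
  derivative of \<open>f\<close> disappears.\<close>

lemma bol_identity:
  assumes S: "open S" and den: "\<And>z. z \<in> S \<Longrightarrow> c * z + d \<noteq> 0"
    and f: "f holomorphic_on T" "open T" and im: "moebius a b c d ` S \<subseteq> T" and z: "z \<in> S"
  shows "(deriv ^^ Suc M) (\<lambda>z. (c * z + d) ^ M * f (moebius a b c d z)) z
      = ((a * d - b * c) ^ Suc M / (c * z + d) ^ (M + 2)) * (deriv ^^ Suc M) f (moebius a b c d z)"
  using z
proof (induction M arbitrary: z)
  case 0
  have "(moebius a b c d has_field_derivative (a * d - b * c) / (c * z + d)\<^sup>2) (at z)"
    using den[OF 0] unfolding moebius_def
    by (auto intro!: derivative_eq_intros simp: field_simps power2_eq_square)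
  moreover have "(f has_field_derivative deriv f (moebius a b c d z)) (at (moebius a b c d z))"
    using holomorphic_derivI[OF f] im 0 by blast
  ultimately have "((\<lambda>z. f (moebius a b c d z)) has_field_derivative
      deriv f (moebius a b c d z) * ((a * d - b * c) / (c * z + d)\<^sup>2)) (at z)"
    by (rule DERIV_chain2[rotated])
  then show ?case by (simp add: DERIV_imp_deriv power2_eq_square)
next
  case (Suc M)
  define D where "D = a * d - b * c"
  define X where "X = (\<lambda>z. (c * z + d) ^ M * f (moebius a b c d z))"
  define F where "F = (\<lambda>k z. (deriv ^^ k) f (moebius a b c d z))"
  have m_hol: "moebius a b c d holomorphic_on S"
    unfolding moebius_def using den by (intro holomorphic_intros) auto
  have "(f \<circ> moebius a b c d) holomorphic_on S"
    by (rule holomorphic_on_compose_gen[OF m_hol f(1) im])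
  then have X_hol: "X holomorphic_on S"
    unfolding X_def o_def by (intro holomorphic_intros)
  have L: "c * z + d \<noteq> 0" using den Suc.prems by blast
  have mz: "(moebius a b c d has_field_derivative D / (c * z + d)\<^sup>2) (at z)"
    using L unfolding moebius_def D_def
    by (auto intro!: derivative_eq_intros simp: field_simps power2_eq_square)
  have "((deriv ^^ Suc M) f has_field_derivative (deriv ^^ Suc (Suc M)) f (moebius a b c d z)) (at (moebius a b c d z))"
  proof -
    have "moebius a b c d z \<in> T" using im Suc.prems by blast
    from holomorphic_derivI[OF holomorphic_higher_deriv[OF f, of "Suc M"] f(2) this] show ?thesis by simp
  qed
  from DERIV_chain2[OF this mz]
  have F': "(F (Suc M) has_field_derivative F (Suc (Suc M)) z * (D / (c * z + d)\<^sup>2)) (at z)"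
    by (simp add: F_def)
  have IH: "(deriv ^^ Suc M) X z = (D ^ Suc M / (c * z + d) ^ (M + 2)) * F (Suc M) z" if "z \<in> S" for z
    using Suc.IH[OF that] by (simp add: X_def F_def D_def)
  have "(deriv ^^ Suc (Suc M)) X z = deriv (\<lambda>z. (D ^ Suc M / (c * z + d) ^ (M + 2)) * F (Suc M) z) z"
  proof -
    have "deriv ((deriv ^^ Suc M) X) z = deriv (\<lambda>z. (D ^ Suc M / (c * z + d) ^ (M + 2)) * F (Suc M) z) z"
      by (rule deriv_cong_ev, rule eventually_mono[OF eventually_nhds_in_open[OF S Suc.prems]])
        (use IH in auto)
    then show ?thesis by simp
  qed
  also have "\<dots> = D ^ Suc M / (c * z + d) ^ (M + 2) * (F (Suc (Suc M)) z * (D / (c * z + d)\<^sup>2))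
     - of_nat (M + 2) * c * D ^ Suc M / (c * z + d) ^ (M + 3) * F (Suc M) z"
  proof (rule DERIV_imp_deriv)
    have "((\<lambda>z. D ^ Suc M / (c * z + d) ^ (M + 2)) has_field_derivative
        - (of_nat (M + 2) * c * D ^ Suc M / (c * z + d) ^ (M + 3))) (at z)"
    proof -
      have "((\<lambda>z. (c * z + d) ^ (M + 2)) has_field_derivative of_nat (M + 2) * (c * z + d) ^ (M + 1) * c) (at z)"
      proof -
        have "((\<lambda>z. c * z + d) has_field_derivative c) (at z)"
          by (auto intro!: derivative_eq_intros)
        from DERIV_power[OF this, of "M + 2"] show ?thesis by (rule DERIV_cong) simp
      qed
      moreover have "(c * z + d) ^ (M + 2) \<noteq> 0" using L by simp
      ultimately have "((\<lambda>z. D ^ Suc M * inverse ((c * z + d) ^ (M + 2))) has_field_derivative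
          D ^ Suc M * - (inverse ((c * z + d) ^ (M + 2)) * (of_nat (M + 2) * (c * z + d) ^ (M + 1) * c)
            * inverse ((c * z + d) ^ (M + 2)))) (at z)"
        by (intro DERIV_cmult DERIV_inverse')
      moreover have "inverse (w ^ (M + 2)) * w ^ (M + 1) * inverse (w ^ (M + 2)) = inverse (w ^ (M + 3))"
        if "w \<noteq> 0" for w :: complex
        using that by (simp add: field_simps power_add power2_eq_square power3_eq_cube)
      note pqp = this[OF L]
      have "A * - (p * (n * q * c) * p) = - (n * c * A * (p * q * p))" for A p q n :: complex
        by simp
      ultimately show ?thesis unfolding divide_inverse by (simp only: pqp)
    qed
    from DERIV_mult[OF this F']
    show "((\<lambda>z. (D ^ Suc M / (c * z + d) ^ (M + 2)) * F (Suc M) z) has_field_derivative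
      D ^ Suc M / (c * z + d) ^ (M + 2) * (F (Suc (Suc M)) z * (D / (c * z + d)\<^sup>2))
        - of_nat (M + 2) * c * D ^ Suc M / (c * z + d) ^ (M + 3) * F (Suc M) z) (at z)"
      by (simp add: algebra_simps)
  qed
  finally have d2: "(deriv ^^ Suc (Suc M)) X z = \<dots>" .
  have "(deriv ^^ Suc (Suc M)) (\<lambda>z. (c * z + d) * X z) z
      = (c * z + d) * (deriv ^^ Suc (Suc M)) X z + of_nat (Suc (Suc M)) * c * (deriv ^^ Suc M) X z"
    by (rule higher_deriv_linear_mult[OF S X_hol Suc.prems])
  \<comment> \<open>The term from differentiating the negative power of \<open>c * z + d\<close>,
    multiplied by \<open>c * z + d\<close>, cancels the second Leibniz term: both are
    \<open>(M + 2) * c\<close> times the derivative supplied by the induction hypothesis.\<close>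
  also have "\<dots> = D ^ Suc (Suc M) / (c * z + d) ^ (Suc M + 2) * F (Suc (Suc M)) z"
    unfolding d2 IH[OF Suc.prems] using L
    by (simp add: divide_simps power_add power2_eq_square numeral_3_eq_3)
  finally show ?case by (simp add: X_def F_def D_def mult.assoc)
qed

text \<open>Since all weights are at least 1, each coefficient is bounded by the norm, and a
  geometric series finishes. This gives continuity of point evaluations, uniform for
  \<open>|w| \<le> \<rho>\<close>.\<close>

lemma norm_le_dir_norm:
  assumes f: "f holomorphic_on unit_disk" and sm: "summable (dir_term n f)"
    and w: "cmod w \<le> \<rho>" "\<rho> < 1"
  shows "cmod (f w) \<le> sqrt (dir_norm n f) / (1 - \<rho>)"
proof -
  have w1: "w \<in> unit_disk" using w by simp
  have \<rho>: "0 \<le> \<rho>" using w(1) norm_ge_zero[of w] by linarith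
  have coeff: "cmod (taylor_coeff f m) \<le> sqrt (dir_norm n f)" for m
  proof (rule real_le_rsqrt)
    have "(cmod (taylor_coeff f m))\<^sup>2 \<le> dir_term n f m"
      unfolding dir_term_def using mult_left_mono[of 1 "real (Suc m) ^ n" "(cmod (taylor_coeff f m))\<^sup>2"]
      by (simp add: one_le_power)
    also have "\<dots> \<le> dir_norm n f"
      unfolding dir_norm_def using sum_le_suminf[OF sm, of "{m}"] by simp
    finally show "(cmod (taylor_coeff f m))\<^sup>2 \<le> dir_norm n f" .
  qed
  have geo: "(\<lambda>m. sqrt (dir_norm n f) * \<rho> ^ m) sums (sqrt (dir_norm n f) * (1 / (1 - \<rho>)))"
    using \<rho> w by (intro sums_mult geometric_sums) simp
  have le: "cmod (taylor_coeff f m * w ^ m) \<le> sqrt (dir_norm n f) * \<rho> ^ m" for m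
    unfolding norm_mult norm_power using w dir_norm_nonneg[OF sm] by (intro mult_mono coeff power_mono) auto
  have "cmod (f w) = cmod (\<Sum>m. taylor_coeff f m * w ^ m)"
    using taylor_coeff_sums[OF f w1] by (simp add: sums_iff)
  also have "\<dots> \<le> (\<Sum>m. sqrt (dir_norm n f) * \<rho> ^ m)"
    by (rule norm_suminf_le[OF le]) (use geo in \<open>simp add: sums_iff\<close>)
  also have "\<dots> = sqrt (dir_norm n f) / (1 - \<rho>)" using geo by (simp add: sums_iff)
  finally show ?thesis .
qed

section \<open>Linear fractional self-maps: the pole, and boundedness of composition\<close>

locale lft_self_map =
  fixes a b c d :: complex
  assumes det: "a * d - b * c \<noteq> 0"
    and den: "\<And>z. z \<in> unit_disk \<Longrightarrow> c * z + d \<noteq> 0"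
    and self: "moebius a b c d ` unit_disk \<subseteq> unit_disk"
begin

lemma self_lt: "cmod z < 1 \<Longrightarrow> cmod (moebius a b c d z) < 1"
  using self by (force simp: image_subset_iff)

text \<open>Without the quotient, the self-map condition is a closed one and passes to the unit
  circle, where the denominator is not yet known to be nonzero.\<close>

lemma norm_num_le_den:
  assumes "cmod z \<le> 1" shows "cmod (a * z + b) \<le> cmod (c * z + d)"
proof -
  let ?S = "{z. cmod (a * z + b) \<le> cmod (c * z + d)}"
  have "closed ?S" by (intro closed_Collect_le continuous_intros)
  moreover have "ball 0 1 \<subseteq> ?S"
  proof
    fix z assume "z \<in> unit_disk"
    then show "z \<in> ?S"
      using self_lt[of z] den[of z] by (simp add: moebius_def norm_divide divide_less_eq)
  qed
  ultimately have "closure (ball 0 1) \<subseteq> ?S" by (rule closure_minimal[rotated])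
  then show ?thesis using assms by auto
qed

lemma d_nonzero: "d \<noteq> 0"
  using den[of 0] by simp

lemma norm_b_less: "cmod b < cmod d"
  using self_lt[of 0] d_nonzero by (simp add: moebius_def norm_divide)

text \<open>Otherwise the pole \<open>- d / c\<close> lies in the closed disk. The preceding bound
  makes the numerator vanish there as well, which contradicts the nonzero determinant.\<close>

lemma norm_c_less: "cmod c < cmod d"
proof (rule ccontr)
  assume "\<not> cmod c < cmod d"
  then have le: "cmod d \<le> cmod c" by simp
  then have c: "c \<noteq> 0" using d_nonzero by auto
  define w where "w = - d / c"
  have "cmod w \<le> 1" using le c by (simp add: w_def norm_divide)
  moreover have w: "c * w + d = 0" using c by (simp add: w_def)
  ultimately have "a * w + b = 0" using norm_num_le_den[of w] by simp
  have "a * d - b * c = a * (c * w + d) - c * (a * w + b)" by (simp add: algebra_simps)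
  with det w \<open>a * w + b = 0\<close> show False by simp
qed

lemma den_bounds:
  assumes "cmod z \<le> 1"
  shows "cmod d - cmod c \<le> cmod (c * z + d)" "cmod (c * z + d) \<le> cmod c + cmod d"
proof -
  have "cmod (c * z) \<le> cmod c" using assms by (simp add: norm_mult mult_left_le)
  then show "cmod d - cmod c \<le> cmod (c * z + d)" "cmod (c * z + d) \<le> cmod c + cmod d"
    using norm_triangle_ineq2[of d "- (c * z)"] norm_triangle_ineq[of "c * z" d] by (auto simp: add.commute)
qed

text \<open>The modulus of the pole \<open>- d / c\<close>; if there is no pole, 2 is just some
  radius beyond 1.\<close>

definition pole_radius :: real where
  "pole_radius = (if c = 0 then 2 else cmod d / cmod c)"

lemma pole_radius_gt_1: "1 < pole_radius"
  using norm_c_less by (simp add: pole_radius_def)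

lemma norm_less_pole_radius:
  assumes "z \<in> ball 0 pole_radius"
  shows "cmod (c / d * z) < 1"
  using assms norm_c_less d_nonzero
  by (auto simp: pole_radius_def norm_mult norm_divide divide_simps mult.commute split: if_splits)

lemma den_nonzero:
  assumes "z \<in> ball 0 pole_radius"
  shows "c * z + d \<noteq> 0"
proof
  assume "c * z + d = 0"
  then have "c / d * z = - 1" using d_nonzero by (simp add: field_simps add_eq_0_iff2)
  then have "cmod (c / d * z) = 1" by simp
  with norm_less_pole_radius[OF assms] show False by simp
qed

lemma moebius_holomorphic: "moebius a b c d holomorphic_on ball 0 pole_radius"
  unfolding moebius_def using den_nonzero by (intro holomorphic_intros) auto

lemma moebius_holomorphic_disk: "moebius a b c d holomorphic_on unit_disk"
  by (rule holomorphic_on_subset[OF moebius_holomorphic]) (use pole_radius_gt_1 in auto)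

lemma moebius_inj: "inj_on (moebius a b c d) unit_disk"
proof (rule inj_onI)
  fix z w assume zw: "z \<in> unit_disk" "w \<in> unit_disk" "moebius a b c d z = moebius a b c d w"
  then have "(a * z + b) * (c * w + d) = (a * w + b) * (c * z + d)"
    using den[OF zw(1)] den[OF zw(2)] by (simp add: moebius_def frac_eq_eq)
  then have "(a * d - b * c) * (z - w) = 0" by (simp add: algebra_simps)
  then show "z = w" using det by simp
qed

lemma deriv_moebius:
  assumes "z \<in> unit_disk"
  shows "deriv (moebius a b c d) z = (a * d - b * c) / (c * z + d)\<^sup>2"
  using den[OF assms] unfolding moebius_def
  by (intro DERIV_imp_deriv) (auto intro!: derivative_eq_intros simp: field_simps power2_eq_square)

text \<open>Bol's identity produces the derivative of \<open>f\<close> at \<open>\<phi>(z)\<close>,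
  and Schwarz-Pick exchanges the weight at \<open>z\<close> for the weight at
  \<open>\<phi>(z)\<close>. Since \<open>\<phi>\<close> is injective into the disk, the change of
  variables bounds the result by the integral over the whole disk.\<close>

lemma area_integral_bol_bound:
  obtains C where "0 \<le> C"
    "\<And>f. f holomorphic_on unit_disk \<Longrightarrow>
       area_integral (Suc N) N (\<lambda>z. (c * z + d) ^ N * f (moebius a b c d z))
         \<le> ennreal C * area_integral (Suc N) N f"
proof -
  obtain K where K: "0 < K"
    "\<And>z. z \<in> unit_disk \<Longrightarrow> 1 - (cmod z)\<^sup>2 \<le> K * (1 - (cmod (moebius a b c d z))\<^sup>2)"
    using schwarz_pick_bound[OF moebius_holomorphic_disk self] by blast
  define \<delta> where "\<delta> = cmod d - cmod c"
  have \<delta>: "0 < \<delta>" using norm_c_less by (simp add: \<delta>_def)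
  define e where "e = cmod (a * d - b * c)"
  define C where "C = e ^ (2 * N) / \<delta> ^ (2 * N) * K ^ N"
  have C: "0 \<le> C" using \<delta> K by (simp add: C_def e_def)
  show thesis
  proof (rule that[OF C])
    fix f assume f: "f holomorphic_on unit_disk"
    define F where "F = (\<lambda>w. ennreal ((cmod ((deriv ^^ Suc N) f w))\<^sup>2 * (1 - (cmod w)\<^sup>2) ^ N) * indicator unit_disk w)"
    have F_meas [measurable]: "F \<in> borel_measurable borel"
    proof -
      have "(\<lambda>z. indicator unit_disk z *\<^sub>R ((cmod ((deriv ^^ Suc N) f z))\<^sup>2 * (1 - (cmod z)\<^sup>2) ^ N)) \<in> borel_measurable borel"
        by (intro borel_measurable_continuous_on_indicator continuous_intros
            holomorphic_on_imp_continuous_on holomorphic_higher_deriv f) auto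
      then have "(\<lambda>z. ennreal (indicator unit_disk z *\<^sub>R ((cmod ((deriv ^^ Suc N) f z))\<^sup>2 * (1 - (cmod z)\<^sup>2) ^ N))) \<in> borel_measurable borel"
        by measurable
      also have "(\<lambda>z. ennreal (indicator unit_disk z *\<^sub>R ((cmod ((deriv ^^ Suc N) f z))\<^sup>2 * (1 - (cmod z)\<^sup>2) ^ N))) = F"
        by (auto simp: F_def fun_eq_iff indicator_def)
      finally show ?thesis .
    qed
    let ?G = "\<lambda>z. (c * z + d) ^ N * f (moebius a b c d z)"
    let ?H = "\<lambda>z. F (moebius a b c d z) * ennreal ((cmod (deriv (moebius a b c d) z))\<^sup>2) * indicator unit_disk z"
    have H_meas: "?H \<in> borel_measurable borel"
    proof -
      have c1: "continuous_on unit_disk (\<lambda>z. (cmod ((deriv ^^ Suc N) f (moebius a b c d z)))\<^sup>2 * (1 - (cmod (moebius a b c d z))\<^sup>2) ^ N)"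
        using continuous_on_compose2[OF holomorphic_on_imp_continuous_on[OF holomorphic_higher_deriv[OF f open_ball, of "Suc N"]]
            holomorphic_on_imp_continuous_on[OF moebius_holomorphic_disk] self]
          holomorphic_on_imp_continuous_on[OF moebius_holomorphic_disk]
        by (intro continuous_intros)
      have c2: "continuous_on unit_disk (\<lambda>z. (cmod (deriv (moebius a b c d) z))\<^sup>2)"
        by (intro continuous_intros holomorphic_on_imp_continuous_on holomorphic_deriv moebius_holomorphic_disk open_ball)
      have "(\<lambda>z. indicator unit_disk z *\<^sub>R (((cmod ((deriv ^^ Suc N) f (moebius a b c d z)))\<^sup>2 * (1 - (cmod (moebius a b c d z))\<^sup>2) ^ N)
          * (cmod (deriv (moebius a b c d) z))\<^sup>2)) \<in> borel_measurable borel"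
        by (intro borel_measurable_continuous_on_indicator continuous_on_mult[OF c1 c2]) auto
      then have "(\<lambda>z. ennreal (indicator unit_disk z *\<^sub>R (((cmod ((deriv ^^ Suc N) f (moebius a b c d z)))\<^sup>2 * (1 - (cmod (moebius a b c d z))\<^sup>2) ^ N)
          * (cmod (deriv (moebius a b c d) z))\<^sup>2))) \<in> borel_measurable borel"
        by measurable
      also have "(\<lambda>z. ennreal (indicator unit_disk z *\<^sub>R (((cmod ((deriv ^^ Suc N) f (moebius a b c d z)))\<^sup>2 * (1 - (cmod (moebius a b c d z))\<^sup>2) ^ N)
          * (cmod (deriv (moebius a b c d) z))\<^sup>2))) = ?H"
        using self_lt by (auto simp: F_def fun_eq_iff indicator_def ennreal_mult'')
      finally show ?thesis .
    qed
    have "area_integral (Suc N) N ?G \<le> (\<integral>\<^sup>+z. ennreal C * ?H z \<partial>lborel)"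
      unfolding area_integral_def
    proof (rule nn_integral_mono)
      fix z :: complex
      show "ennreal ((cmod ((deriv ^^ Suc N) ?G z))\<^sup>2 * (1 - (cmod z)\<^sup>2) ^ N) * indicator unit_disk z
          \<le> ennreal C * ?H z"
      proof (cases "z \<in> unit_disk")
        case True
        define L where "L = cmod (c * z + d)"
        define X where "X = (cmod ((deriv ^^ Suc N) f (moebius a b c d z)))\<^sup>2"
        define t where "t = 1 - (cmod z)\<^sup>2"
        define t' where "t' = 1 - (cmod (moebius a b c d z))\<^sup>2"
        have t: "0 \<le> t" "0 \<le> t'" "t \<le> K * t'"
          using True self_lt[of z] K(2)[OF True] by (auto simp: t_def t'_def power_le_one_iff)
        have L: "\<delta> \<le> L" using den_bounds[of z] True by (simp add: L_def \<delta>_def)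
        have "(cmod ((deriv ^^ Suc N) ?G z))\<^sup>2 = (e ^ Suc N / L ^ (N + 2))\<^sup>2 * X"
          using bol_identity[OF open_ball den f open_ball self True, of N]
          by (simp add: e_def L_def X_def norm_mult norm_divide norm_power power_mult_distrib power_divide del: power_Suc funpow.simps)
        \<comment> \<open>The factor \<open>(e / L\<^sup>2)\<^sup>2\<close> is the Jacobian of the
          change of variables; the remaining powers of \<open>L\<close> are bounded below by
          \<open>\<delta>\<close>.\<close>
        also have "(e ^ Suc N / L ^ (N + 2))\<^sup>2 = (e ^ (2 * N) / L ^ (2 * N)) * (e / L\<^sup>2)\<^sup>2"
        proof -
          have "e ^ Suc N / L ^ (N + 2) = e ^ N / L ^ N * (e / L\<^sup>2)"
            by (simp add: power_add power2_eq_square mult_ac)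
          moreover have "e ^ (2 * N) / L ^ (2 * N) = (e ^ N / L ^ N)\<^sup>2"
            by (simp add: power_divide power_mult[symmetric] mult.commute)
          ultimately show ?thesis by (simp only: power_mult_distrib)
        qed
        finally have "(cmod ((deriv ^^ Suc N) ?G z))\<^sup>2 * t ^ N
           = ((e ^ (2 * N) / L ^ (2 * N)) * t ^ N) * (X * (e / L\<^sup>2)\<^sup>2)"
          by (simp add: mult_ac)
        also have "\<dots> \<le> ((e ^ (2 * N) / \<delta> ^ (2 * N)) * (K * t') ^ N) * (X * (e / L\<^sup>2)\<^sup>2)"
          using L \<delta> t K(1)
          by (intro mult_right_mono mult_mono divide_left_mono power_mono) (auto simp: e_def X_def)
        also have "\<dots> = C * (X * t' ^ N * (e / L\<^sup>2)\<^sup>2)"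
          by (simp add: C_def power_mult_distrib mult_ac)
        finally have "ennreal ((cmod ((deriv ^^ Suc N) ?G z))\<^sup>2 * t ^ N) \<le> ennreal (C * (X * t' ^ N * (e / L\<^sup>2)\<^sup>2))"
          by (rule ennreal_leI)
        also have "\<dots> = ennreal C * ?H z"
          using True self_lt[of z] C t deriv_moebius[OF True]
          by (simp add: F_def e_def L_def X_def t'_def norm_divide norm_power ennreal_mult ennreal_mult'')
        finally show ?thesis using True by (simp add: t_def)
      qed simp
    qed
    also have "\<dots> = ennreal C * (\<integral>\<^sup>+z. ?H z \<partial>lborel)"
      using H_meas by (intro nn_integral_cmult) simp
    also have "(\<integral>\<^sup>+z. ?H z \<partial>lborel) = (\<integral>\<^sup>+z. F z * indicator (moebius a b c d ` unit_disk) z \<partial>lborel)"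
      using self by (intro nn_integral_holomorphic_image moebius_holomorphic_disk moebius_inj
          emeasure_bounded_finite bounded_subset[OF bounded_ball]) auto
    also have "\<dots> \<le> area_integral (Suc N) N f"
      unfolding area_integral_def F_def by (intro nn_integral_mono) (auto simp: indicator_def)
    finally show "area_integral (Suc N) N ?G \<le> ennreal C * area_integral (Suc N) N f"
      by (simp add: mult_left_mono)
  qed
qed

text \<open>Compactness of the closed half disk keeps its image away from the unit circle, so that
  point evaluations there are uniformly bounded when Cauchy's inequality is applied at radius
  1/2.\<close>

lemma moebius_norm_le_on_half_disk:
  obtains \<rho> where "\<rho> < 1" "\<And>z. cmod z \<le> 1 / 2 \<Longrightarrow> cmod (moebius a b c d z) \<le> \<rho>"
proof -
  have "compact (moebius a b c d ` cball 0 (1 / 2))"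
    by (intro compact_continuous_image compact_cball holomorphic_on_imp_continuous_on
        holomorphic_on_subset[OF moebius_holomorphic_disk]) auto
  then obtain w where w: "w \<in> moebius a b c d ` cball 0 (1 / 2)"
    "\<forall>v\<in>moebius a b c d ` cball 0 (1 / 2). cmod v \<le> cmod w"
    using continuous_attains_sup[of "moebius a b c d ` cball 0 (1 / 2)" cmod]
    by (auto intro: continuous_intros)
  show thesis
  proof (rule that)
    show "cmod w < 1" using w(1) self_lt by auto
    show "cmod (moebius a b c d z) \<le> cmod w" if "cmod z \<le> 1 / 2" for z
      using w(2) that by auto
  qed
qed

text \<open>Bol's identity controls the coefficients of \<open>(c z + d)^N f(\<phi>(z))\<close> from index \<open>N + 1\<close> on; the
  remaining ones are bounded by Cauchy's inequality.\<close>

lemma dir_norm_bol: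
  obtains C where "0 \<le> C"
    "\<And>f. f holomorphic_on unit_disk \<Longrightarrow> summable (dir_term (Suc N) f) \<Longrightarrow>
       summable (dir_term (Suc N) (\<lambda>z. (c * z + d) ^ N * f (moebius a b c d z))) \<and>
       dir_norm (Suc N) (\<lambda>z. (c * z + d) ^ N * f (moebius a b c d z)) \<le> C * dir_norm (Suc N) f"
proof -
  have k: "2 * Suc N = Suc N + Suc N" by simp
  obtain A B where AB: "A > 0" "B > 0"
    "\<And>f. f holomorphic_on unit_disk \<Longrightarrow>
       ennreal A * (\<Sum>m. ennreal (dir_term (Suc N) f (m + Suc N))) \<le> area_integral (Suc N) N f"
    "\<And>f. f holomorphic_on unit_disk \<Longrightarrow>
       area_integral (Suc N) N f \<le> ennreal B * (\<Sum>m. ennreal (dir_term (Suc N) f (m + Suc N)))"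
    by (rule area_integral_bounds[OF k]) (rule that)
  obtain C1 where C1: "0 \<le> C1"
    "\<And>f. f holomorphic_on unit_disk \<Longrightarrow>
       area_integral (Suc N) N (\<lambda>z. (c * z + d) ^ N * f (moebius a b c d z))
         \<le> ennreal C1 * area_integral (Suc N) N f"
    by (rule area_integral_bol_bound) (rule that)
  obtain \<rho> where \<rho>: "\<rho> < 1" "\<And>z. cmod z \<le> 1 / 2 \<Longrightarrow> cmod (moebius a b c d z) \<le> \<rho>"
    by (rule moebius_norm_le_on_half_disk) (rule that)
  \<comment> \<open>\<open>M\<close> times the norm of \<open>f\<close> bounds the weighted
    composite on the circle of radius 1/2; Cauchy's inequality then costs the factors
    \<open>2 ^ m\<close> in \<open>C2\<close>.\<close>
  define M where "M = (cmod c + cmod d) ^ N / (1 - \<rho>)"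
  have M: "0 \<le> M" using \<rho>(1) by (simp add: M_def)
  define C2 where "C2 = (\<Sum>m<Suc N. (M * 2 ^ m)\<^sup>2 * real (Suc m) ^ Suc N)"
  have C2: "0 \<le> C2" unfolding C2_def by (intro sum_nonneg) auto
  show thesis
  proof (rule that)
    show "0 \<le> C1 * B / A + C2" using C1 AB C2 by simp
    fix f assume f: "f holomorphic_on unit_disk" and sm: "summable (dir_term (Suc N) f)"
    define G where "G = (\<lambda>z. (c * z + d) ^ N * f (moebius a b c d z))"
    have "(f \<circ> moebius a b c d) holomorphic_on unit_disk"
      by (rule holomorphic_on_compose_gen[OF moebius_holomorphic_disk f self])
    then have G: "G holomorphic_on unit_disk"
      unfolding G_def o_def by (intro holomorphic_intros)
    have norm0: "0 \<le> dir_norm (Suc N) f" using sm by (rule dir_norm_nonneg)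
    have sm_tail: "summable (\<lambda>m. dir_term (Suc N) f (m + Suc N))"
      using sm by (subst summable_iff_shift)
    have tail_le: "(\<Sum>m. dir_term (Suc N) f (m + Suc N)) \<le> dir_norm (Suc N) f"
      unfolding dir_norm_def suminf_minus_initial_segment[OF sm]
      by (simp add: sum_nonneg del: sum.lessThan_Suc)
    \<comment> \<open>The chain is carried out in \<open>ennreal\<close>, because summability for
      \<open>G\<close> is not known yet: it follows from finiteness of the final bound.\<close>
    have "ennreal A * (\<Sum>m. ennreal (dir_term (Suc N) G (m + Suc N))) \<le> area_integral (Suc N) N G"
      by (rule AB(3)[OF G])
    also have "\<dots> \<le> ennreal C1 * area_integral (Suc N) N f"
      unfolding G_def by (rule C1(2)[OF f])
    also have "\<dots> \<le> ennreal C1 * (ennreal B * (\<Sum>m. ennreal (dir_term (Suc N) f (m + Suc N))))"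
      by (intro mult_left_mono AB(4)[OF f]) simp
    also have "(\<Sum>m. ennreal (dir_term (Suc N) f (m + Suc N))) = ennreal (\<Sum>m. dir_term (Suc N) f (m + Suc N))"
      using sm_tail by (intro suminf_ennreal2) auto
    also have "ennreal C1 * (ennreal B * \<dots>) = ennreal (C1 * (B * (\<Sum>m. dir_term (Suc N) f (m + Suc N))))"
      using C1 AB suminf_nonneg[OF sm_tail] by (simp add: ennreal_mult)
    also have "\<dots> \<le> ennreal (C1 * (B * dir_norm (Suc N) f))"
      using C1 AB tail_le by (intro ennreal_leI mult_left_mono) auto
    finally have tail: "ennreal A * (\<Sum>m. ennreal (dir_term (Suc N) G (m + Suc N))) \<le> ennreal (C1 * (B * dir_norm (Suc N) f))" .
    have "ennreal A * (\<Sum>m. ennreal (dir_term (Suc N) G (m + Suc N))) < \<infinity>"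
      using tail by (rule le_less_trans) simp
    then have "(\<Sum>m. ennreal (dir_term (Suc N) G (m + Suc N))) \<noteq> top"
      using AB(1) by (auto simp: ennreal_mult_less_top)
    then have smG_tail: "summable (\<lambda>m. dir_term (Suc N) G (m + Suc N))"
      by (intro summable_suminf_not_top) auto
    then have smG: "summable (dir_term (Suc N) G)" by (subst (asm) summable_iff_shift)
    have "ennreal (A * (\<Sum>m. dir_term (Suc N) G (m + Suc N))) \<le> ennreal (C1 * (B * dir_norm (Suc N) f))"
      using tail smG_tail AB(1) by (simp add: suminf_ennreal2 ennreal_mult suminf_nonneg)
    then have "A * (\<Sum>m. dir_term (Suc N) G (m + Suc N)) \<le> C1 * (B * dir_norm (Suc N) f)"
      using C1 AB norm0 by (subst (asm) ennreal_le_iff) auto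
    then have tail': "(\<Sum>m. dir_term (Suc N) G (m + Suc N)) \<le> C1 * B / A * dir_norm (Suc N) f"
      using AB(1) by (simp add: field_simps)
    have coeff: "cmod (taylor_coeff G m) \<le> M * sqrt (dir_norm (Suc N) f) * 2 ^ m" for m
    proof -
      have "cmod ((deriv ^^ m) G 0) \<le> fact m * (M * sqrt (dir_norm (Suc N) f)) / (1 / 2) ^ m"
      proof (rule Cauchy_inequality)
        show "G holomorphic_on ball 0 (1 / 2)" using G by (rule holomorphic_on_subset) auto
        show "continuous_on (cball 0 (1 / 2)) G"
          by (rule continuous_on_subset[OF holomorphic_on_imp_continuous_on[OF G]]) auto
        fix z :: complex assume "cmod (0 - z) = 1 / 2"
        then have z: "cmod z = 1 / 2" by simp
        have "cmod (G z) = cmod (c * z + d) ^ N * cmod (f (moebius a b c d z))"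
          by (simp add: G_def norm_mult norm_power)
        also have "\<dots> \<le> (cmod c + cmod d) ^ N * (sqrt (dir_norm (Suc N) f) / (1 - \<rho>))"
          using den_bounds(2)[of z] z norm_le_dir_norm[OF f sm \<rho>(2)[of z] \<rho>(1)]
          by (intro mult_mono power_mono) auto
        finally show "cmod (G z) \<le> M * sqrt (dir_norm (Suc N) f)" by (simp add: M_def)
      qed simp
      then show ?thesis
        by (simp add: taylor_coeff_alt norm_divide field_simps)
    qed
    have "(\<Sum>m<Suc N. dir_term (Suc N) G m) \<le> (\<Sum>m<Suc N. (M * 2 ^ m)\<^sup>2 * real (Suc m) ^ Suc N * dir_norm (Suc N) f)"
    proof (rule sum_mono)
      fix m
      have "(cmod (taylor_coeff G m))\<^sup>2 \<le> (M * sqrt (dir_norm (Suc N) f) * 2 ^ m)\<^sup>2"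
        by (intro power_mono coeff) simp
      also have "\<dots> = (M * 2 ^ m)\<^sup>2 * dir_norm (Suc N) f"
        using norm0 by (simp add: power_mult_distrib)
      finally have "(cmod (taylor_coeff G m))\<^sup>2 * real (Suc m) ^ Suc N
          \<le> (M * 2 ^ m)\<^sup>2 * dir_norm (Suc N) f * real (Suc m) ^ Suc N"
        by (intro mult_right_mono) auto
      then show "dir_term (Suc N) G m \<le> (M * 2 ^ m)\<^sup>2 * real (Suc m) ^ Suc N * dir_norm (Suc N) f"
        unfolding dir_term_def by (simp only: mult_ac)
    qed
    also have "\<dots> = C2 * dir_norm (Suc N) f" unfolding C2_def by (rule sum_distrib_right[symmetric])
    finally have head: "(\<Sum>m<Suc N. dir_term (Suc N) G m) \<le> C2 * dir_norm (Suc N) f" .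
    have "dir_norm (Suc N) G = (\<Sum>m. dir_term (Suc N) G (m + Suc N)) + (\<Sum>m<Suc N. dir_term (Suc N) G m)"
      unfolding dir_norm_def by (rule suminf_split_initial_segment[OF smG])
    also have "\<dots> \<le> (C1 * B / A + C2) * dir_norm (Suc N) f"
      using add_mono[OF tail' head] by (simp only: distrib_right)
    finally show "summable (dir_term (Suc N) (\<lambda>z. (c * z + d) ^ N * f (moebius a b c d z))) \<and>
       dir_norm (Suc N) (\<lambda>z. (c * z + d) ^ N * f (moebius a b c d z)) \<le> (C1 * B / A + C2) * dir_norm (Suc N) f"
      using smG by (simp add: G_def)
  qed
qed

lemma inverse_den_holomorphic: "(\<lambda>z. 1 / (c * z + d) ^ N) holomorphic_on ball 0 pole_radius"
  using den_nonzero by (intro holomorphic_intros) auto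

lemma dir_norm_comp:
  obtains C where "0 \<le> C"
    "\<And>f. f holomorphic_on unit_disk \<Longrightarrow> summable (dir_term (Suc N) f) \<Longrightarrow>
       summable (dir_term (Suc N) (\<lambda>z. f (moebius a b c d z))) \<and>
       dir_norm (Suc N) (\<lambda>z. f (moebius a b c d z)) \<le> C * dir_norm (Suc N) f"
proof -
  obtain C1 where C1: "0 \<le> C1"
    "\<And>f. f holomorphic_on unit_disk \<Longrightarrow> summable (dir_term (Suc N) f) \<Longrightarrow>
       summable (dir_term (Suc N) (\<lambda>z. (c * z + d) ^ N * f (moebius a b c d z))) \<and>
       dir_norm (Suc N) (\<lambda>z. (c * z + d) ^ N * f (moebius a b c d z)) \<le> C1 * dir_norm (Suc N) f"
    by (rule dir_norm_bol) (rule that)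
  obtain C2 where C2: "0 \<le> C2"
    "\<And>f. f holomorphic_on unit_disk \<Longrightarrow> summable (dir_term (Suc N) f) \<Longrightarrow>
       summable (dir_term (Suc N) (\<lambda>z. 1 / (c * z + d) ^ N * f z)) \<and>
       dir_norm (Suc N) (\<lambda>z. 1 / (c * z + d) ^ N * f z) \<le> C2 * dir_norm (Suc N) f"
    by (rule dir_norm_mult[OF inverse_den_holomorphic pole_radius_gt_1]) (rule that)
  show thesis
  proof (rule that)
    show "0 \<le> C2 * C1" using C1 C2 by simp
    fix f assume f: "f holomorphic_on unit_disk" and sm: "summable (dir_term (Suc N) f)"
    define G where "G = (\<lambda>z. (c * z + d) ^ N * f (moebius a b c d z))"
    have "(f \<circ> moebius a b c d) holomorphic_on unit_disk"
      by (rule holomorphic_on_compose_gen[OF moebius_holomorphic_disk f self])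
    then have G: "G holomorphic_on unit_disk"
      unfolding G_def o_def by (intro holomorphic_intros)
    have G_le: "summable (dir_term (Suc N) G)" "dir_norm (Suc N) G \<le> C1 * dir_norm (Suc N) f"
      using C1(2)[OF f sm] by (simp_all add: G_def)
    have eq: "dir_term (Suc N) (\<lambda>z. f (moebius a b c d z)) = dir_term (Suc N) (\<lambda>z. 1 / (c * z + d) ^ N * G z)"
      by (rule dir_term_cong) (use den in \<open>simp add: G_def\<close>)
    have "dir_norm (Suc N) (\<lambda>z. 1 / (c * z + d) ^ N * G z) \<le> C2 * (C1 * dir_norm (Suc N) f)"
      using C2(2)[OF G G_le(1)] mult_left_mono[OF G_le(2) C2(1)] by linarith
    then show "summable (dir_term (Suc N) (\<lambda>z. f (moebius a b c d z))) \<and>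
       dir_norm (Suc N) (\<lambda>z. f (moebius a b c d z)) \<le> C2 * C1 * dir_norm (Suc N) f"
      using C2(2)[OF G G_le(1)] by (simp add: dir_norm_def eq mult.assoc)
  qed
qed

end

section \<open>Kernel coefficients and adjoints\<close>

text \<open>The series may start at \<open>m = 0\<close>, where division by zero makes the term
  0.\<close>

lemma Ln_inverse_one_minus_sums:
  fixes x :: complex
  assumes "cmod x < 1"
  shows "(\<lambda>m. 1 / of_nat m * x ^ m) sums Ln (1 / (1 - x))"
proof -
  have "Re (1 - x) > 0" using assms complex_Re_le_cmod[of x] by simp
  then have "1 - x \<notin> \<real>\<^sub>\<le>\<^sub>0" by (auto simp: complex_nonpos_Reals_iff)
  then have "Ln (1 / (1 - x)) = - Ln (1 - x)"
    using Ln_inverse[of "1 - x"] by (simp add: inverse_eq_divide)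
  moreover have "(\<lambda>m. 1 / of_nat m * x ^ m) sums (- Ln (1 - x))"
    using sums_minus[OF Ln_series'[of "- x"]] assms by simp
  ultimately show ?thesis by simp
qed

lemma poly_has_fps_expansion:
  "poly Q has_fps_expansion Abs_fps (coeff (Q :: complex poly))"
proof -
  have "(\<lambda>x. \<Sum>i\<le>degree Q. coeff Q i * x ^ i) has_fps_expansion (\<Sum>i\<le>degree Q. fps_const (coeff Q i) * fps_X ^ i)"
    by (intro has_fps_expansion_sum has_fps_expansion_cmult_left has_fps_expansion_fps_X_power)
  moreover have "(\<Sum>i\<le>degree Q. fps_const (coeff Q i) * fps_X ^ i) = Abs_fps (coeff Q)"
    by (rule fps_ext) (auto simp: fps_sum_nth if_distrib coeff_eq_0 cong: if_cong)
  ultimately show ?thesis by (simp add: poly_altdef[abs_def])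
qed

text \<open>Multiplication by \<open>x - 1\<close> replaces the coefficient at \<open>m\<close> by
  the one at \<open>m - 1\<close> minus the one at \<open>m\<close>. Starting from
  \<open>1 / m\<close>, \<open>N\<close> such differences give the formula; beyond the degree
  \<open>N\<close> the polynomial \<open>Q\<close> contributes nothing.\<close>

lemma taylor_coeff_kernel_fun:
  assumes "degree Q = N" "N < m"
  shows "taylor_coeff (kernel_fun N Q) m = fact N * fact (m - Suc N) / fact m"
proof -
  define L where "L = Abs_fps (\<lambda>m. 1 / of_nat m :: complex)"
  have "(\<lambda>x. Ln (1 / (1 - x))) has_fps_expansion L"
  proof (rule has_fps_expansionI)
    show "\<forall>\<^sub>F x in nhds 0. (\<lambda>m. fps_nth L m * x ^ m) sums Ln (1 / (1 - x))"
      by (rule eventually_mono[OF eventually_nhds_in_open[of unit_disk 0]])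
        (use Ln_inverse_one_minus_sums in \<open>auto simp: L_def\<close>)
  qed
  then have "kernel_fun N Q has_fps_expansion (fps_X - 1) ^ N * L + Abs_fps (coeff Q)"
    unfolding kernel_fun_def[abs_def]
    by (intro has_fps_expansion_add has_fps_expansion_mult has_fps_expansion_power
        has_fps_expansion_diff has_fps_expansion_fps_X has_fps_expansion_1 poly_has_fps_expansion)
  from taylor_coeff_has_fps_expansion[OF this]
  have "taylor_coeff (kernel_fun N Q) m = fps_nth ((fps_X - 1) ^ N * L) m"
    using assms by (simp add: coeff_eq_0)
  also have "fps_nth ((fps_X - 1) ^ N * L) m = fact N * fact (m - Suc N) / fact m"
    using assms(2)
  proof (induction N arbitrary: m)
    case 0
    then obtain k where "m = Suc k" by (cases m) auto
    then show ?case by (simp add: L_def)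
  next
    case (Suc N)
    then obtain k where k: "m = k + Suc (Suc N)" by (metis less_iff_Suc_add add.commute add_Suc_right)
    have "fps_nth ((fps_X - 1) ^ Suc N * L) m
        = fps_nth ((fps_X - 1) ^ N * L) (m - 1) - fps_nth ((fps_X - 1) ^ N * L) m"
      using Suc.prems by (simp add: mult.assoc left_diff_distrib)
    also have "\<dots> = fact N * fact (m - 1 - Suc N) / fact (m - 1) - fact N * fact (m - Suc N) / fact m"
      using Suc.prems by (subst (1 2) Suc.IH) auto
    also have "\<dots> = fact (Suc N) * fact (m - Suc (Suc N)) / fact m"
    proof -
      have eqs: "fact m = (of_nat m * fact (m - 1) :: complex)"
        "fact (m - 1 - Suc N) = (fact k :: complex)" "fact (m - Suc (Suc N)) = (fact k :: complex)"
        "fact (m - Suc N) = (of_nat (Suc k) * fact k :: complex)"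
        "fact (Suc N) = (of_nat (Suc N) * fact N :: complex)"
        using k by (simp_all add: fact_reduce)
      have "A * F / X - A * (s * F) / (M * X) = n * A * F / (M * X)"
        if "M = s + n" "M \<noteq> 0" "X \<noteq> 0" for A F X s n M :: complex
        using that by (simp add: divide_simps) (simp add: algebra_simps)
      moreover have "of_nat m = (of_nat (Suc k) + of_nat (Suc N) :: complex)" by (simp add: k)
      moreover have "of_nat m \<noteq> (0 :: complex)" unfolding of_nat_eq_0_iff using k by simp
      moreover have "fact (m - 1) \<noteq> (0 :: complex)" by simp
      ultimately show ?thesis unfolding eqs by blast
    qed
    finally show ?case .
  qed
  finally show ?thesis .
qed

text \<open>Cauchy-Schwarz on partial sums, with the weight split evenly between the two functions;
  the uniform bound also gives summability.\<close>

lemma sum_taylor_weight_le: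
  assumes f: "summable (dir_term n f)" and g: "summable (dir_term n g)"
  shows "summable (\<lambda>m. cmod (taylor_coeff f m) * cmod (taylor_coeff g m) * real (Suc m) ^ n)"
    and "(\<Sum>m. cmod (taylor_coeff f m) * cmod (taylor_coeff g m) * real (Suc m) ^ n)
           \<le> sqrt (dir_norm n f) * sqrt (dir_norm n g)"
proof -
  let ?t = "\<lambda>m. cmod (taylor_coeff f m) * cmod (taylor_coeff g m) * real (Suc m) ^ n"
  have le: "(\<Sum>m<M. ?t m) \<le> sqrt (dir_norm n f) * sqrt (dir_norm n g)" for M
  proof -
    define p where "p = (\<lambda>f m. cmod (taylor_coeff f m) * sqrt (real (Suc m) ^ n))"
    have L2: "L2_set (p f) {..<M} \<le> sqrt (dir_norm n f)" if "summable (dir_term n f)" for f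
    proof -
      have "(\<Sum>m<M. (p f m)\<^sup>2) = (\<Sum>m<M. dir_term n f m)"
        by (simp add: p_def dir_term_def power_mult_distrib)
      also have "\<dots> \<le> dir_norm n f"
        unfolding dir_norm_def using that by (intro sum_le_suminf) auto
      finally show ?thesis by (simp add: L2_set_def)
    qed
    have "(\<Sum>m<M. ?t m) = (\<Sum>m<M. \<bar>p f m\<bar> * \<bar>p g m\<bar>)"
    proof (rule sum.cong[OF refl])
      fix m
      have "\<bar>p f m\<bar> * \<bar>p g m\<bar> = cmod (taylor_coeff f m) * cmod (taylor_coeff g m)
          * (sqrt (real (Suc m) ^ n) * sqrt (real (Suc m) ^ n))"
        by (simp add: p_def abs_mult mult_ac del: real_sqrt_mult_self)
      then show "?t m = \<bar>p f m\<bar> * \<bar>p g m\<bar>" by simp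
    qed
    also have "\<dots> \<le> L2_set (p f) {..<M} * L2_set (p g) {..<M}" by (rule L2_set_mult_ineq)
    also have "\<dots> \<le> sqrt (dir_norm n f) * sqrt (dir_norm n g)"
      using L2[OF f] L2[OF g] dir_norm_nonneg[OF f] by (intro mult_mono) (auto simp: L2_set_nonneg)
    finally show ?thesis .
  qed
  show sm: "summable ?t" using le by (intro summableI_nonneg_bounded[OF _ le]) auto
  show "suminf ?t \<le> sqrt (dir_norm n f) * sqrt (dir_norm n g)"
    using le sm by (intro suminf_le_const) auto
qed

text \<open>The extension by 0 makes these total functions members of \<open>A2\<close>, where
  functions with equal coefficients are equal everywhere.\<close>

definition disk_series :: "(nat \<Rightarrow> complex) \<Rightarrow> complex \<Rightarrow> complex" where
  "disk_series a z = (if z \<in> unit_disk then \<Sum>m. a m * z ^ m else 0)"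

text \<open>The terms of the weighted series tend to 0 and the weights are at least 1, so the
  coefficients are bounded and the power series converges on the disk.\<close>

lemma disk_series_weighted:
  assumes "summable (\<lambda>m. (cmod (a m))\<^sup>2 * real (Suc m) ^ n)"
  shows "disk_series a holomorphic_on unit_disk" "taylor_coeff (disk_series a) = a"
    "summable (dir_term n (disk_series a))"
proof -
  have "(\<lambda>m. (cmod (a m))\<^sup>2 * real (Suc m) ^ n) \<longlonglongrightarrow> 0"
    using assms by (rule summable_LIMSEQ_zero)
  then have "Bseq (\<lambda>m. (cmod (a m))\<^sup>2 * real (Suc m) ^ n)"
    by (intro convergent_imp_Bseq convergentI)
  then obtain K where K: "0 < K" "\<And>m. norm ((cmod (a m))\<^sup>2 * real (Suc m) ^ n) \<le> K"
    by (auto elim: BseqE)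
  have bd: "cmod (a m) \<le> sqrt K" for m
  proof (rule real_le_rsqrt)
    have "(cmod (a m))\<^sup>2 \<le> (cmod (a m))\<^sup>2 * real (Suc m) ^ n"
      using mult_left_mono[of 1 "real (Suc m) ^ n" "(cmod (a m))\<^sup>2"] by (simp add: one_le_power)
    also have "\<dots> \<le> K" using K(2)[of m] by simp
    finally show "(cmod (a m))\<^sup>2 \<le> K" .
  qed
  have sums: "(\<lambda>m. a m * z ^ m) sums disk_series a z" if z: "z \<in> unit_disk" for z
  proof -
    have geo: "summable (\<lambda>m. sqrt K * cmod z ^ m)"
      using z by (intro summable_mult summable_geometric) simp
    have "summable (\<lambda>m. a m * z ^ m)"
      by (rule summable_comparison_test'[OF geo, of 0])
        (auto simp: norm_mult norm_power intro!: mult_right_mono bd)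
    then show ?thesis using z by (simp add: disk_series_def summable_sums)
  qed
  show "disk_series a holomorphic_on unit_disk" and t: "taylor_coeff (disk_series a) = a"
    using taylor_coeff_power_series[OF sums] by auto
  show "summable (dir_term n (disk_series a))"
    using assms by (simp add: dir_term_def[abs_def] t)
qed

section \<open>Kernel coefficients and the inner product\<close>

locale A2_space =
  fixes \<alpha> :: real and N :: nat and Q :: "complex poly"
  assumes \<alpha>: "\<alpha> + 2 = - real N" and Q: "admissible_poly N Q"
begin

definition \<kappa> :: "nat \<Rightarrow> real" where
  "\<kappa> m = Re (taylor_coeff (kernel_fun N Q) m)"

lemma kappa_pos: "0 < \<kappa> m"
  using Q by (simp add: admissible_poly_def \<kappa>_def)

lemma taylor_coeff_kernel_eq: "taylor_coeff (kernel_fun N Q) m = of_real (\<kappa> m)"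
  using Q by (simp add: admissible_poly_def \<kappa>_def complex_is_Real_iff complex_eq_iff)

text \<open>For \<open>m > N\<close> the coefficient is \<open>fact N\<close> divided by the
  \<open>N + 1\<close> consecutive integers \<open>m - N\<close>, ..., \<open>m\<close>, hence
  comparable to \<open>Suc m\<close> to the power \<open>- (N + 1)\<close>.\<close>

lemma kappa_bounds:
  obtains U V where "0 < U" "0 < V" "\<And>m. \<kappa> m * real (Suc m) ^ Suc N \<le> U"
    "\<And>m. 1 \<le> V * (\<kappa> m * real (Suc m) ^ Suc N)"
proof -
  define x where "x = (\<lambda>m. \<kappa> m * real (Suc m) ^ Suc N)"
  have x_pos: "0 < x m" for m using kappa_pos[of m] by (simp add: x_def)
  have deg: "degree Q = N" using Q by (simp add: admissible_poly_def)
  have large: "x m \<le> fact N * real (N + 2) ^ Suc N" "1 \<le> real (Suc N) ^ Suc N * x m" if m: "N < m" for m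
  proof -
    obtain k where k: "m = k + Suc N" using m by (metis less_iff_Suc_add add.commute add_Suc_right)
    define F where "F = (fact (k + Suc N) / fact k :: real)"
    have F: "real (Suc k) ^ Suc N \<le> F" "F \<le> (real (Suc k) * real (Suc N)) ^ Suc N"
      using fact_add_bounds[of k "Suc N"] by (auto simp: F_def le_divide_eq divide_le_eq)
    have F0: "0 < F" by (simp add: F_def)
    have "\<kappa> m = fact N / F"
    proof -
      have "taylor_coeff (kernel_fun N Q) m = of_real (fact N * fact k / fact m)"
        using taylor_coeff_kernel_fun[OF deg m] by (simp add: k)
      then show ?thesis by (simp only: \<kappa>_def Re_complex_of_real F_def k) simp
    qed
    then have xF: "x m = fact N / F * real (Suc m) ^ Suc N" by (simp add: x_def)
    have "real (Suc m) \<le> real (N + 2) * real (Suc k)"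
    proof -
      have "Suc m \<le> (N + 2) * Suc k" by (simp add: k)
      then show ?thesis by (metis of_nat_le_iff of_nat_mult)
    qed
    then have "real (Suc m) ^ Suc N \<le> real (N + 2) ^ Suc N * real (Suc k) ^ Suc N"
      by (metis of_nat_0_le_iff power_mono power_mult_distrib)
    also have "\<dots> \<le> real (N + 2) ^ Suc N * F" by (intro mult_left_mono F) simp
    finally have "fact N / F * real (Suc m) ^ Suc N \<le> fact N / F * (real (N + 2) ^ Suc N * F)"
      using F0 by (intro mult_left_mono) auto
    then show "x m \<le> fact N * real (N + 2) ^ Suc N" using F0 by (simp add: xF del: of_nat_Suc power_Suc)
    have "real (Suc k) ^ Suc N \<le> real (Suc m) ^ Suc N" by (intro power_mono) (auto simp: k)
    then have "F \<le> real (Suc m) ^ Suc N * real (Suc N) ^ Suc N"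
      by (intro order_trans[OF F(2)[unfolded power_mult_distrib]] mult_right_mono) auto
    moreover have "1 * (real (Suc m) ^ Suc N * real (Suc N) ^ Suc N) \<le> fact N * (real (Suc m) ^ Suc N * real (Suc N) ^ Suc N)"
      by (intro mult_right_mono) auto
    ultimately have "F \<le> fact N * (real (Suc m) ^ Suc N * real (Suc N) ^ Suc N)" by linarith
    then have "1 \<le> fact N * (real (Suc m) ^ Suc N * real (Suc N) ^ Suc N) / F"
      using F0 by (simp add: le_divide_eq)
    then show "1 \<le> real (Suc N) ^ Suc N * x m" by (simp add: xF mult_ac del: of_nat_Suc power_Suc)
  qed
  \<comment> \<open>For the finitely many \<open>m \<le> N\<close>, where \<open>Q\<close>
    intervenes, only positivity of the coefficients is known; adding all these values, or their
    reciprocals, covers each of them.\<close>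
  define U where "U = fact N * real (N + 2) ^ Suc N + (\<Sum>m\<le>N. x m)"
  define V where "V = real (Suc N) ^ Suc N + (\<Sum>m\<le>N. 1 / x m)"
  have sums: "0 \<le> (\<Sum>m\<le>N. x m)" "0 \<le> (\<Sum>m\<le>N. 1 / x m)"
    by (intro sum_nonneg less_imp_le[OF x_pos] divide_nonneg_pos x_pos zero_le_one)+
  have pos: "0 < fact N * real (N + 2) ^ Suc N" "0 < real (Suc N) ^ Suc N"
    by (intro mult_pos_pos zero_less_power fact_gt_zero) simp_all
  show thesis
  proof (rule that)
    show "0 < U" "0 < V" using sums pos by (simp_all add: U_def V_def add_pos_nonneg del: of_nat_Suc power_Suc)
    fix m
    show "\<kappa> m * real (Suc m) ^ Suc N \<le> U"
    proof (cases "N < m")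
      case True
      then show ?thesis using large(1)[OF True] sums unfolding U_def x_def by linarith
    next
      case False
      then have "x m \<le> (\<Sum>m\<le>N. x m)" using x_pos by (intro member_le_sum) (auto intro: less_imp_le)
      then show ?thesis using pos unfolding U_def x_def by linarith
    qed
    have "1 \<le> V * x m"
    proof (cases "N < m")
      case True
      have "real (Suc N) ^ Suc N * x m \<le> V * x m"
        using sums x_pos[of m] by (intro mult_right_mono) (auto simp: V_def)
      then show ?thesis using large(2)[OF True] by linarith
    next
      case False
      then have "1 / x m \<le> (\<Sum>m\<le>N. 1 / x m)"
        using x_pos by (intro member_le_sum[where f = "\<lambda>m. 1 / x m"]) (auto intro: less_imp_le)
      then have "1 / x m \<le> V" using pos unfolding V_def by linarith
      then show ?thesis using x_pos[of m] by (simp add: divide_le_eq)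
    qed
    then show "1 \<le> V * (\<kappa> m * real (Suc m) ^ Suc N)" by (simp add: x_def)
  qed
qed

abbreviation ip :: "(complex \<Rightarrow> complex) \<Rightarrow> (complex \<Rightarrow> complex) \<Rightarrow> complex" where
  "ip \<equiv> A2_inner N Q"

lemma A2_D:
  assumes "f \<in> A2 \<alpha>"
  shows "f holomorphic_on unit_disk" "summable (dir_term (Suc N) f)" "\<And>z. z \<notin> unit_disk \<Longrightarrow> f z = 0"
  using assms A2_iff[OF \<alpha>] by auto

lemma A2_I:
  assumes "f holomorphic_on unit_disk" "summable (dir_term (Suc N) f)" "\<And>z. z \<notin> unit_disk \<Longrightarrow> f z = 0"
  shows "f \<in> A2 \<alpha>"
  using assms A2_iff[OF \<alpha>] by auto

lemma A2_restrict:
  assumes "f holomorphic_on unit_disk" "summable (dir_term (Suc N) f)"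
  shows "(\<lambda>z. if z \<in> unit_disk then f z else 0) \<in> A2 \<alpha>"
proof (rule A2_I)
  show "(\<lambda>z. if z \<in> unit_disk then f z else 0) holomorphic_on unit_disk"
    using assms(1) by (rule holomorphic_transform) simp
  have "dir_term (Suc N) (\<lambda>z. if z \<in> unit_disk then f z else 0) = dir_term (Suc N) f"
    by (rule dir_term_cong) simp
  then show "summable (dir_term (Suc N) (\<lambda>z. if z \<in> unit_disk then f z else 0))"
    using assms(2) by simp
qed simp

lemma disk_series_mem:
  "summable (\<lambda>m. (cmod (a m))\<^sup>2 * real (Suc m) ^ Suc N) \<Longrightarrow> disk_series a \<in> A2 \<alpha>"
  by (rule A2_I, erule disk_series_weighted(1), erule disk_series_weighted(3), simp add: disk_series_def)

lemma A2_eqI: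
  assumes "f \<in> A2 \<alpha>" "g \<in> A2 \<alpha>" "\<And>m. taylor_coeff f m = taylor_coeff g m"
  shows "f = g"
proof
  fix z
  show "f z = g z"
  proof (cases "z \<in> unit_disk")
    case True
    then show ?thesis
      using taylor_coeff_sums[OF A2_D(1)[OF assms(1)] True] taylor_coeff_sums[OF A2_D(1)[OF assms(2)] True]
      by (simp add: assms(3) sums_iff)
  qed (use A2_D(3)[OF assms(1)] A2_D(3)[OF assms(2)] in simp)
qed

text \<open>The weight dominates \<open>1 / \<kappa> m\<close> up to \<open>V\<close>, so weighted
  Cauchy-Schwarz applies. The summability clause matters because \<open>A2_inner\<close> is a bare
  \<open>suminf\<close>: its linearity rests on it.\<close>

lemma ip_bound:
  obtains W where "0 < W"
    "\<And>f g. summable (dir_term (Suc N) f) \<Longrightarrow> summable (dir_term (Suc N) g) \<Longrightarrow>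
       summable (\<lambda>m. taylor_coeff f m * cnj (taylor_coeff g m) / taylor_coeff (kernel_fun N Q) m)"
    "\<And>f g. summable (dir_term (Suc N) f) \<Longrightarrow> summable (dir_term (Suc N) g) \<Longrightarrow>
       cmod (ip f g) \<le> W * (sqrt (dir_norm (Suc N) f) * sqrt (dir_norm (Suc N) g))"
proof -
  obtain U V where UV: "0 < U" "0 < V" "\<And>m. \<kappa> m * real (Suc m) ^ Suc N \<le> U"
    "\<And>m. 1 \<le> V * (\<kappa> m * real (Suc m) ^ Suc N)"
    by (rule kappa_bounds) (rule that)
  show thesis
  proof (rule that[OF UV(2)])
    fix f g assume fg: "summable (dir_term (Suc N) f)" "summable (dir_term (Suc N) g)"
    let ?t = "\<lambda>m. cmod (taylor_coeff f m) * cmod (taylor_coeff g m) * real (Suc m) ^ Suc N"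
    let ?s = "\<lambda>m. taylor_coeff f m * cnj (taylor_coeff g m) / taylor_coeff (kernel_fun N Q) m"
    have le: "cmod (?s m) \<le> V * ?t m" for m
    proof -
      have "1 / \<kappa> m \<le> V * real (Suc m) ^ Suc N"
        using UV(4)[of m] kappa_pos[of m] by (simp add: divide_le_eq mult_ac)
      from mult_left_mono[OF this, of "cmod (taylor_coeff f m) * cmod (taylor_coeff g m)"]
      show ?thesis
        using kappa_pos[of m] by (simp add: taylor_coeff_kernel_eq norm_mult norm_divide mult_ac)
    qed
    have sm: "summable (\<lambda>m. V * ?t m)" by (intro summable_mult sum_taylor_weight_le(1) fg)
    show "summable ?s" by (rule summable_comparison_test'[OF sm, of 0]) (rule le)
    have "cmod (ip f g) \<le> (\<Sum>m. V * ?t m)"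
      unfolding A2_inner_def by (rule norm_suminf_le[OF le sm])
    also have "\<dots> = V * (\<Sum>m. ?t m)" by (intro suminf_mult sum_taylor_weight_le(1) fg)
    also have "\<dots> \<le> V * (sqrt (dir_norm (Suc N) f) * sqrt (dir_norm (Suc N) g))"
      using UV(2) by (intro mult_left_mono sum_taylor_weight_le(2) fg) auto
    finally show "cmod (ip f g) \<le> V * (sqrt (dir_norm (Suc N) f) * sqrt (dir_norm (Suc N) g))" .
  qed
qed

lemma ip_summable:
  assumes "f \<in> A2 \<alpha>" "g \<in> A2 \<alpha>"
  shows "summable (\<lambda>m. taylor_coeff f m * cnj (taylor_coeff g m) / taylor_coeff (kernel_fun N Q) m)"
proof (rule ip_bound)
  assume summable: "\<And>f g. summable (dir_term (Suc N) f) \<Longrightarrow> summable (dir_term (Suc N) g) \<Longrightarrow>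
     summable (\<lambda>m. taylor_coeff f m * cnj (taylor_coeff g m) / taylor_coeff (kernel_fun N Q) m)"
  show ?thesis by (intro summable A2_D(2) assms)
qed

lemma A2_add: "f \<in> A2 \<alpha> \<Longrightarrow> g \<in> A2 \<alpha> \<Longrightarrow> (\<lambda>z. f z + g z) \<in> A2 \<alpha>"
proof (rule A2_I)
  assume fg: "f \<in> A2 \<alpha>" "g \<in> A2 \<alpha>"
  note f = A2_D[OF fg(1)] and g = A2_D[OF fg(2)]
  show "(\<lambda>z. f z + g z) holomorphic_on unit_disk" using f g by (intro holomorphic_intros)
  show "f z + g z = 0" if "z \<notin> unit_disk" for z using that f(3) g(3) by simp
  have "dir_term (Suc N) (\<lambda>z. f z + g z) m \<le> 2 * dir_term (Suc N) f m + 2 * dir_term (Suc N) g m" for m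
  proof -
    let ?p = "taylor_coeff f m" and ?q = "taylor_coeff g m"
    have "(cmod (?p + ?q))\<^sup>2 \<le> (cmod ?p + cmod ?q)\<^sup>2" by (intro power_mono norm_triangle_ineq) simp
    also have "\<dots> \<le> 2 * (cmod ?p)\<^sup>2 + 2 * (cmod ?q)\<^sup>2"
      using sum_squares_bound[of "cmod ?p" "cmod ?q"] by (simp add: power2_sum)
    finally have "(cmod (?p + ?q))\<^sup>2 * real (Suc m) ^ Suc N \<le> (2 * (cmod ?p)\<^sup>2 + 2 * (cmod ?q)\<^sup>2) * real (Suc m) ^ Suc N"
      by (intro mult_right_mono) auto
    then show ?thesis
      unfolding dir_term_def taylor_coeff_add[OF f(1) g(1)] by (simp only: distrib_right mult.assoc)
  qed
  then show "summable (dir_term (Suc N) (\<lambda>z. f z + g z))"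
    using f(2) g(2)
    by (intro summable_comparison_test'[OF summable_add[OF summable_mult[OF f(2), of 2] summable_mult[OF g(2), of 2]], of 0]) simp
qed

lemma dir_term_cmult:
  assumes "f holomorphic_on unit_disk"
  shows "dir_term n (\<lambda>z. c * f z) = (\<lambda>m. (cmod c)\<^sup>2 * dir_term n f m)"
  by (auto simp: dir_term_def taylor_coeff_cmult[OF assms] norm_mult power_mult_distrib)

lemma A2_cmult: "f \<in> A2 \<alpha> \<Longrightarrow> (\<lambda>z. c * f z) \<in> A2 \<alpha>"
  using A2_D[of f] by (intro A2_I) (auto simp: dir_term_cmult intro!: holomorphic_intros summable_mult)

lemma ip_add_left:
  assumes "f \<in> A2 \<alpha>" "g \<in> A2 \<alpha>" "h \<in> A2 \<alpha>"
  shows "ip (\<lambda>z. f z + g z) h = ip f h + ip g h"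
  unfolding A2_inner_def
  using suminf_add[OF ip_summable[OF assms(1,3)] ip_summable[OF assms(2,3)]]
  by (simp add: taylor_coeff_add A2_D(1)[OF assms(1)] A2_D(1)[OF assms(2)] add_divide_distrib distrib_right)

lemma ip_cmult_left:
  assumes "f \<in> A2 \<alpha>" "h \<in> A2 \<alpha>"
  shows "ip (\<lambda>z. c * f z) h = c * ip f h"
  unfolding A2_inner_def
  using suminf_mult[OF ip_summable[OF assms], of c]
  by (simp add: taylor_coeff_cmult A2_D(1)[OF assms(1)] mult.assoc)

lemma ip_commute:
  assumes "f \<in> A2 \<alpha>" "g \<in> A2 \<alpha>"
  shows "ip g f = cnj (ip f g)"
proof -
  have "(\<lambda>m. cnj (taylor_coeff f m * cnj (taylor_coeff g m) / taylor_coeff (kernel_fun N Q) m)) sums cnj (ip f g)"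
    unfolding A2_inner_def using ip_summable[OF assms] by (intro sums_cnj[THEN iffD2] summable_sums)
  then have "(\<lambda>m. taylor_coeff g m * cnj (taylor_coeff f m) / taylor_coeff (kernel_fun N Q) m) sums cnj (ip f g)"
    by (simp add: taylor_coeff_kernel_eq mult.commute)
  then show ?thesis by (simp add: A2_inner_def sums_iff)
qed

lemma ip_add_right:
  assumes "f \<in> A2 \<alpha>" "g \<in> A2 \<alpha>" "h \<in> A2 \<alpha>"
  shows "ip h (\<lambda>z. f z + g z) = ip h f + ip h g"
  using ip_add_left[OF assms] A2_add[OF assms(1,2)] assms
  by (simp add: ip_commute[of _ h])

lemma ip_cmult_right:
  assumes "f \<in> A2 \<alpha>" "h \<in> A2 \<alpha>"
  shows "ip h (\<lambda>z. c * f z) = cnj c * ip h f"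
  using ip_cmult_left[OF assms] A2_cmult[OF assms(1)] assms
  by (simp add: ip_commute[of _ h])

lemma A2_sum: "(\<And>i. i \<in> I \<Longrightarrow> f i \<in> A2 \<alpha>) \<Longrightarrow> (\<lambda>z. \<Sum>i\<in>I. f i z) \<in> A2 \<alpha>"
proof (induction I rule: infinite_finite_induct)
  case (insert i I)
  then show ?case using A2_add[of "f i" "\<lambda>z. \<Sum>i\<in>I. f i z"] by simp
qed (use A2_cmult[OF disk_series_mem[of "\<lambda>_. 0"], of 0] in simp_all)

lemma ip_sum_right:
  assumes "h \<in> A2 \<alpha>" "\<And>i. i \<in> I \<Longrightarrow> f i \<in> A2 \<alpha>"
  shows "ip h (\<lambda>z. \<Sum>i\<in>I. f i z) = (\<Sum>i\<in>I. ip h (f i))"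
  using assms(2)
proof (induction I rule: infinite_finite_induct)
  case (insert i I)
  then show ?case using ip_add_right[of "f i" "\<lambda>z. \<Sum>i\<in>I. f i z" h] A2_sum[of I f] assms(1) by simp
qed (use ip_cmult_right[OF disk_series_mem[of "\<lambda>_. 0"] assms(1), of 0] in simp_all)

text \<open>By \<open>kappa_bounds\<close>, \<open>dir_norm\<close> is equivalent to the squared
  norm of the inner product, so this is boundedness on the Hilbert space; \<open>C\<close> bounds
  squared norms.\<close>

definition bounded_op :: "((complex \<Rightarrow> complex) \<Rightarrow> complex \<Rightarrow> complex) \<Rightarrow> bool" where
  "bounded_op T \<longleftrightarrow> (\<forall>f\<in>A2 \<alpha>. T f \<in> A2 \<alpha>) \<and>
     (\<forall>f\<in>A2 \<alpha>. \<forall>g\<in>A2 \<alpha>. T (\<lambda>z. f z + g z) = (\<lambda>z. T f z + T g z)) \<and>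
     (\<forall>f\<in>A2 \<alpha>. \<forall>c. T (\<lambda>z. c * f z) = (\<lambda>z. c * T f z)) \<and>
     (\<exists>C\<ge>0. \<forall>f\<in>A2 \<alpha>. dir_norm (Suc N) (T f) \<le> C * dir_norm (Suc N) f)"

lemma disk_series_finite:
  assumes "\<And>m. m \<ge> M \<Longrightarrow> a m = 0"
  shows "disk_series a \<in> A2 \<alpha>" "taylor_coeff (disk_series a) = a"
    "dir_norm (Suc N) (disk_series a) = (\<Sum>m<M. (cmod (a m))\<^sup>2 * real (Suc m) ^ Suc N)"
proof -
  have sm: "summable (\<lambda>m. (cmod (a m))\<^sup>2 * real (Suc m) ^ Suc N)"
    by (rule summable_finite[of "{..<M}"]) (auto simp: assms)
  show "disk_series a \<in> A2 \<alpha>" using sm by (rule disk_series_mem)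
  show t: "taylor_coeff (disk_series a) = a" using sm by (rule disk_series_weighted(2))
  show "dir_norm (Suc N) (disk_series a) = (\<Sum>m<M. (cmod (a m))\<^sup>2 * real (Suc m) ^ Suc N)"
    unfolding dir_norm_def dir_term_def t by (rule suminf_finite) (auto simp: assms)
qed

section \<open>Basis functions and the existence of adjoints\<close>

abbreviation basis_fun :: "nat \<Rightarrow> complex \<Rightarrow> complex" where
  "basis_fun m \<equiv> disk_series (\<lambda>j. if j = m then 1 else 0)"

lemma basis_fun_mem: "basis_fun m \<in> A2 \<alpha>"
  and taylor_coeff_basis_fun: "taylor_coeff (basis_fun m) = (\<lambda>j. if j = m then 1 else 0)"
  using disk_series_finite[of "Suc m" "\<lambda>j. if j = m then 1 else 0"] by auto

lemma ip_basis_fun: "ip (basis_fun m) v = cnj (taylor_coeff v m) / of_real (\<kappa> m)"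
proof -
  have "ip (basis_fun m) v = (\<Sum>j. if j = m then cnj (taylor_coeff v j) / of_real (\<kappa> j) else 0)"
    unfolding A2_inner_def taylor_coeff_basis_fun taylor_coeff_kernel_eq
    by (intro suminf_cong) auto
  also have "\<dots> = cnj (taylor_coeff v m) / of_real (\<kappa> m)"
    by (subst suminf_finite[of "{m}"]) auto
  finally show ?thesis .
qed

lemma partial_sum_step:
  "disk_series (\<lambda>m. if m < Suc M then a m else 0)
     = (\<lambda>z. disk_series (\<lambda>m. if m < M then a m else 0) z + a M * basis_fun M z)"
proof (rule A2_eqI)
  let ?f = "disk_series (\<lambda>m. if m < M then a m else 0)"
  have f: "?f \<in> A2 \<alpha>" "taylor_coeff ?f = (\<lambda>m. if m < M then a m else 0)"
    using disk_series_finite[of M "\<lambda>m. if m < M then a m else 0"] by auto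
  have g: "(\<lambda>z. a M * basis_fun M z) \<in> A2 \<alpha>" by (intro A2_cmult basis_fun_mem)
  show "disk_series (\<lambda>m. if m < Suc M then a m else 0) \<in> A2 \<alpha>"
    using disk_series_finite[of "Suc M" "\<lambda>m. if m < Suc M then a m else 0"] by auto
  show "(\<lambda>z. ?f z + a M * basis_fun M z) \<in> A2 \<alpha>" using f(1) g by (rule A2_add)
  show "taylor_coeff (disk_series (\<lambda>m. if m < Suc M then a m else 0)) m
      = taylor_coeff (\<lambda>z. ?f z + a M * basis_fun M z) m" for m
    using disk_series_finite(2)[of "Suc M" "\<lambda>m. if m < Suc M then a m else 0"]
    by (auto simp: taylor_coeff_add[OF A2_D(1)[OF f(1)] A2_D(1)[OF g]] f(2)
        taylor_coeff_cmult[OF A2_D(1)[OF basis_fun_mem]] taylor_coeff_basis_fun less_Suc_eq)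
qed

text \<open>The Riesz argument in coordinates: testing the functional \<open>f \<mapsto> \<langle>T f, g\<rangle>\<close> on the partial sums of
  its own candidate representer bounds their norms.\<close>

lemma adjoint_exists:
  assumes T: "bounded_op T" and g: "g \<in> A2 \<alpha>"
  shows "\<exists>v\<in>A2 \<alpha>. \<forall>f\<in>A2 \<alpha>. ip (T f) g = ip f v"
proof -
  have T_mem: "T f \<in> A2 \<alpha>" if "f \<in> A2 \<alpha>" for f using T that by (simp add: bounded_op_def)
  have T_add: "T (\<lambda>z. f z + h z) = (\<lambda>z. T f z + T h z)" if "f \<in> A2 \<alpha>" "h \<in> A2 \<alpha>" for f h
    using T that by (simp add: bounded_op_def)
  have T_cmult: "T (\<lambda>z. k * f z) = (\<lambda>z. k * T f z)" if "f \<in> A2 \<alpha>" for f k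
    using T that by (simp add: bounded_op_def)
  obtain C where C: "0 \<le> C" "\<And>f. f \<in> A2 \<alpha> \<Longrightarrow> dir_norm (Suc N) (T f) \<le> C * dir_norm (Suc N) f"
    using T by (auto simp: bounded_op_def)
  obtain W where W: "0 < W"
    "\<And>f h. summable (dir_term (Suc N) f) \<Longrightarrow> summable (dir_term (Suc N) h) \<Longrightarrow>
       cmod (ip f h) \<le> W * (sqrt (dir_norm (Suc N) f) * sqrt (dir_norm (Suc N) h))"
    by (rule ip_bound) (rule that)
  define W' where "W' = W * sqrt C * sqrt (dir_norm (Suc N) g)"
  have W': "0 \<le> W'" using W(1) C(1) dir_norm_nonneg[OF A2_D(2)[OF g]] by (simp add: W'_def)
  have bound: "cmod (ip (T f) g) \<le> W' * sqrt (dir_norm (Suc N) f)" if f: "f \<in> A2 \<alpha>" for f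
  proof -
    have "cmod (ip (T f) g) \<le> W * (sqrt (dir_norm (Suc N) (T f)) * sqrt (dir_norm (Suc N) g))"
      by (intro W(2) A2_D(2) T_mem f g)
    also have "\<dots> \<le> W * (sqrt (C * dir_norm (Suc N) f) * sqrt (dir_norm (Suc N) g))"
      using W(1) C(2)[OF f] dir_norm_nonneg[OF A2_D(2)[OF g]]
      by (intro mult_left_mono mult_right_mono real_sqrt_le_mono) auto
    also have "\<dots> = W' * sqrt (dir_norm (Suc N) f)"
      by (simp add: W'_def real_sqrt_mult)
    finally show ?thesis .
  qed
  obtain U V where UV: "0 < U" "0 < V" "\<And>m. \<kappa> m * real (Suc m) ^ Suc N \<le> U"
    "\<And>m. 1 \<le> V * (\<kappa> m * real (Suc m) ^ Suc N)"
    by (rule kappa_bounds) (rule that)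
  have weight: "real (Suc m) ^ Suc N \<le> U / \<kappa> m" for m
    using UV(3)[of m] kappa_pos[of m] by (simp only: le_divide_eq if_True mult.commute)
  \<comment> \<open>Testing against the basis functions leaves only this choice: a representer must
    pair with \<open>basis_fun m\<close> to \<open>cnj (v m) / \<kappa> m\<close>.\<close>
  define v where "v = (\<lambda>m. of_real (\<kappa> m) * cnj (ip (T (basis_fun m)) g))"
  have e: "ip (T (basis_fun m)) g = cnj (v m) / of_real (\<kappa> m)" for m
    using kappa_pos[of m] by (simp add: v_def)
  have fin: "ip (T (disk_series (\<lambda>m. if m < M then a m else 0))) g = (\<Sum>m<M. a m * cnj (v m) / of_real (\<kappa> m))" for a M
  proof (induction M)
    case 0
    have z: "disk_series (\<lambda>_. 0) = (\<lambda>z. 0 * basis_fun 0 z)" by (auto simp: disk_series_def)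
    have "T (disk_series (\<lambda>_. 0)) = (\<lambda>z. 0 * T (basis_fun 0) z)"
      unfolding z by (rule T_cmult[OF basis_fun_mem])
    then show ?case using ip_cmult_left[OF T_mem[OF basis_fun_mem] g, of 0] by simp
  next
    case (Suc M)
    let ?f = "disk_series (\<lambda>m. if m < M then a m else 0)"
    have f: "?f \<in> A2 \<alpha>" using disk_series_finite[of M "\<lambda>m. if m < M then a m else 0"] by auto
    have "ip (T (disk_series (\<lambda>m. if m < Suc M then a m else 0))) g
        = ip (\<lambda>z. T ?f z + a M * T (basis_fun M) z) g"
      unfolding partial_sum_step T_add[OF f A2_cmult[OF basis_fun_mem]] T_cmult[OF basis_fun_mem] ..
    also have "\<dots> = ip (T ?f) g + a M * ip (T (basis_fun M)) g"
      using T_mem[OF f] T_mem[OF basis_fun_mem] A2_cmult[OF T_mem[OF basis_fun_mem]] g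
      by (simp add: ip_add_left ip_cmult_left)
    finally show ?case by (simp add: Suc.IH e)
  qed
  \<comment> \<open>\<open>S M\<close> is the squared Hilbert norm of the \<open>M\<close>-th
    partial sum of the candidate and also the value of the functional on it.\<close>
  define S where "S = (\<lambda>M. \<Sum>m<M. (cmod (v m))\<^sup>2 / \<kappa> m)"
  have S_nonneg: "0 \<le> S M" for M
    unfolding S_def using kappa_pos by (intro sum_nonneg divide_nonneg_pos) auto
  have S_le: "S M \<le> W'\<^sup>2 * U" for M
  proof -
    let ?p = "disk_series (\<lambda>m. if m < M then v m else 0)"
    note p = disk_series_finite[of M "\<lambda>m. if m < M then v m else 0"]
    have p_mem: "?p \<in> A2 \<alpha>" using p(1) by simp
    have "dir_norm (Suc N) ?p = (\<Sum>m<M. (cmod (v m))\<^sup>2 * real (Suc m) ^ Suc N)" using p(3) by simp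
    also have "\<dots> \<le> (\<Sum>m<M. (cmod (v m))\<^sup>2 * (U / \<kappa> m))"
      by (intro sum_mono mult_left_mono weight) auto
    also have "\<dots> = U * S M" by (simp add: S_def sum_distrib_left mult_ac)
    finally have dn: "dir_norm (Suc N) ?p \<le> U * S M" .
    have "ip (T ?p) g = of_real (S M)"
      unfolding fin S_def of_real_sum of_real_divide complex_norm_square ..
    then have "S M = cmod (ip (T ?p) g)" using S_nonneg[of M] by simp
    also have "\<dots> \<le> W' * sqrt (dir_norm (Suc N) ?p)" by (rule bound[OF p_mem])
    also have "\<dots> \<le> W' * sqrt (U * S M)" using W' dn by (intro mult_left_mono real_sqrt_le_mono)
    \<comment> \<open>The bound contains \<open>S M\<close> only under the square root, so squaring
      and cancelling one factor bounds it uniformly in \<open>M\<close>.\<close>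
    finally have "(S M)\<^sup>2 \<le> (W' * sqrt (U * S M))\<^sup>2" using S_nonneg by (intro power_mono)
    also have "\<dots> = W'\<^sup>2 * U * S M"
      using UV(1) S_nonneg[of M] by (simp add: power_mult_distrib)
    finally have "S M * S M \<le> W'\<^sup>2 * U * S M" by (simp only: power2_eq_square)
    then show ?thesis using S_nonneg[of M] UV(1)
      by (cases "S M = 0") (auto simp: mult_le_cancel_right)
  qed
  have "summable (\<lambda>m. (cmod (v m))\<^sup>2 / \<kappa> m)"
    by (rule summableI_nonneg_bounded[OF divide_nonneg_pos[OF zero_le_power2 kappa_pos] S_le[unfolded S_def]])
  then have "summable (\<lambda>m. U * ((cmod (v m))\<^sup>2 / \<kappa> m))" by (rule summable_mult)
  then have v_sm: "summable (\<lambda>m. (cmod (v m))\<^sup>2 * real (Suc m) ^ Suc N)"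
  proof (rule summable_comparison_test'[of _ 0])
    fix m
    show "norm ((cmod (v m))\<^sup>2 * real (Suc m) ^ Suc N) \<le> U * ((cmod (v m))\<^sup>2 / \<kappa> m)"
      using mult_left_mono[OF weight[of m], of "(cmod (v m))\<^sup>2"]
      by (simp add: mult_ac del: of_nat_Suc power_Suc)
  qed
  define w where "w = disk_series v"
  have w_mem: "w \<in> A2 \<alpha>" unfolding w_def by (rule disk_series_mem[OF v_sm])
  have w_coeff: "taylor_coeff w = v" unfolding w_def by (rule disk_series_weighted(2)[OF v_sm])
  have "ip (T f) g = ip f w" if f: "f \<in> A2 \<alpha>" for f
  proof -
    define a where "a = taylor_coeff f"
    define p where "p = (\<lambda>M. disk_series (\<lambda>m. if m < M then a m else 0))"
    \<comment> \<open>The remainders tend to 0 in norm, so by \<open>bound\<close> the functional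
      tends to 0 on them and its values on polynomials determine it.\<close>
    define q where "q = (\<lambda>M z. f z + (-1) * p M z)"
    have p_mem: "p M \<in> A2 \<alpha>" and p_coeff: "taylor_coeff (p M) = (\<lambda>m. if m < M then a m else 0)" for M
      using disk_series_finite[of M "\<lambda>m. if m < M then a m else 0"] by (auto simp: p_def)
    have q_mem: "q M \<in> A2 \<alpha>" for M unfolding q_def by (intro A2_add A2_cmult f p_mem)
    have q_coeff: "taylor_coeff (q M) m = (if m < M then 0 else a m)" for M m
      unfolding q_def
      by (subst taylor_coeff_add) (auto simp: A2_D(1)[OF f] A2_D(1)[OF A2_cmult[OF p_mem], simplified]
          taylor_coeff_cmult[OF A2_D(1)[OF p_mem], of "-1", simplified] p_coeff a_def
          intro!: holomorphic_intros A2_D(1)[OF p_mem])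
    have sm: "summable (dir_term (Suc N) f)" by (rule A2_D(2)[OF f])
    have q_norm: "dir_norm (Suc N) (q M) = dir_norm (Suc N) f - (\<Sum>m<M. dir_term (Suc N) f m)" for M
    proof -
      have "dir_norm (Suc N) (q M) = (\<Sum>m. dir_term (Suc N) (q M) (m + M)) + (\<Sum>m<M. dir_term (Suc N) (q M) m)"
        unfolding dir_norm_def by (rule suminf_split_initial_segment[OF A2_D(2)[OF q_mem]])
      also have "(\<Sum>m<M. dir_term (Suc N) (q M) m) = 0"
        by (rule sum.neutral) (simp add: dir_term_def q_coeff)
      also have "(\<Sum>m. dir_term (Suc N) (q M) (m + M)) = (\<Sum>m. dir_term (Suc N) f (m + M))"
        by (simp add: dir_term_def q_coeff a_def)
      finally show ?thesis by (simp add: dir_norm_def suminf_minus_initial_segment[OF sm])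
    qed
    have "(\<lambda>M. dir_norm (Suc N) f - (\<Sum>m<M. dir_term (Suc N) f m)) \<longlonglongrightarrow> dir_norm (Suc N) f - dir_norm (Suc N) f"
      unfolding dir_norm_def by (intro tendsto_diff tendsto_const summable_LIMSEQ[OF sm])
    then have "(\<lambda>M. W' * sqrt (dir_norm (Suc N) (q M))) \<longlonglongrightarrow> W' * sqrt 0"
      unfolding q_norm by (intro tendsto_mult tendsto_const tendsto_real_sqrt) simp
    then have "(\<lambda>M. ip (T (q M)) g) \<longlonglongrightarrow> 0"
      by (intro Lim_null_comparison[OF always_eventually[OF allI[OF bound[OF q_mem]]]]) simp
    moreover have "ip (T (q M)) g = ip (T f) g - (\<Sum>m<M. a m * cnj (v m) / of_real (\<kappa> m))" for M
    proof -
      have "T (q M) = (\<lambda>z. T f z + (-1) * T (p M) z)"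
        unfolding q_def T_add[OF f A2_cmult[OF p_mem]] T_cmult[OF p_mem] ..
      then have "ip (T (q M)) g = ip (T f) g + (-1) * ip (T (p M)) g"
        using ip_add_left[OF T_mem[OF f] A2_cmult[OF T_mem[OF p_mem]] g]
          ip_cmult_left[OF T_mem[OF p_mem] g] by metis
      then show ?thesis by (simp add: p_def fin)
    qed
    ultimately have "(\<lambda>M. ip (T f) g - (ip (T f) g - (\<Sum>m<M. a m * cnj (v m) / of_real (\<kappa> m)))) \<longlonglongrightarrow> ip (T f) g - 0"
      by (intro tendsto_diff tendsto_const) simp
    then have "(\<lambda>m. a m * cnj (v m) / of_real (\<kappa> m)) sums ip (T f) g"
      by (simp add: sums_def)
    then show ?thesis
      by (simp add: A2_inner_def a_def w_coeff taylor_coeff_kernel_eq sums_iff)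
  qed
  with w_mem show ?thesis by blast
qed

lemma adjoint_unique:
  assumes "v \<in> A2 \<alpha>" "w \<in> A2 \<alpha>" "\<And>f. f \<in> A2 \<alpha> \<Longrightarrow> ip f v = ip f w"
  shows "v = w"
proof (rule A2_eqI[OF assms(1,2)])
  fix m
  have "cnj (taylor_coeff v m) / of_real (\<kappa> m) = cnj (taylor_coeff w m) / of_real (\<kappa> m)"
    using assms(3)[OF basis_fun_mem[of m]] by (simp only: ip_basis_fun)
  then show "taylor_coeff v m = taylor_coeff w m" using kappa_pos[of m] by simp
qed

text \<open>Existence and uniqueness together give the definite description in
  \<open>adjoint_on\<close> its meaning.\<close>

lemma adjoint_on_spec:
  assumes "bounded_op T" "g \<in> A2 \<alpha>"
  shows "adjoint_on (A2 \<alpha>) ip T g \<in> A2 \<alpha>"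
    and "f \<in> A2 \<alpha> \<Longrightarrow> ip (T f) g = ip f (adjoint_on (A2 \<alpha>) ip T g)"
proof -
  obtain v where v: "v \<in> A2 \<alpha>" "\<forall>f\<in>A2 \<alpha>. ip (T f) g = ip f v"
    using adjoint_exists[OF assms] by blast
  have "adjoint_on (A2 \<alpha>) ip T g = v"
    unfolding adjoint_on_def
  proof (rule the_equality)
    fix w assume "w \<in> A2 \<alpha> \<and> (\<forall>f\<in>A2 \<alpha>. ip (T f) g = ip f w)"
    with v show "w = v" by (intro adjoint_unique) auto
  qed (use v in blast)
  with v show "adjoint_on (A2 \<alpha>) ip T g \<in> A2 \<alpha>"
    "f \<in> A2 \<alpha> \<Longrightarrow> ip (T f) g = ip f (adjoint_on (A2 \<alpha>) ip T g)" by simp_all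
qed

lemma adjoint_on_eval:
  assumes T: "bounded_op T" and f: "f \<in> A2 \<alpha>" and z: "z \<in> unit_disk"
  shows "adjoint_on (A2 \<alpha>) ip T f z = ip f (T (A2_kernel N Q z))"
proof -
  note K = A2_kernel_mem[OF z, of N Q \<alpha>]
  note adj = adjoint_on_spec[OF T f]
  have T_mem: "T (A2_kernel N Q z) \<in> A2 \<alpha>" using T K by (simp add: bounded_op_def)
  have "adjoint_on (A2 \<alpha>) ip T f z = ip (adjoint_on (A2 \<alpha>) ip T f) (A2_kernel N Q z)"
    by (rule A2_kernel_reproducing[OF Q adj(1) z, symmetric])
  also have "\<dots> = cnj (ip (T (A2_kernel N Q z)) f)"
    using ip_commute[OF K adj(1)] adj(2)[OF K] by simp
  also have "\<dots> = ip f (T (A2_kernel N Q z))"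
    using ip_commute[OF T_mem f] by simp
  finally show ?thesis .
qed

end

section \<open>The difference operator\<close>

text \<open>The two sums can differ only by a multiple of \<open>2 * pi * \<i>\<close>. Four
  imaginary parts, each below \<open>pi / 2\<close> in modulus, leave no room for a nonzero
  one.\<close>

lemma Ln_mult_right_half_plane:
  assumes "Re A > 0" "Re B > 0" "Re C > 0" "Re D > 0" "A * B = C * D"
  shows "Ln A + Ln B = Ln C + Ln D"
proof -
  have nz: "A \<noteq> 0" "B \<noteq> 0" "C \<noteq> 0" "D \<noteq> 0" using assms by auto
  have "exp (Ln A + Ln B) = exp (Ln C + Ln D)"
    using nz assms(5) by (simp add: exp_add)
  then obtain n :: int where n: "Ln A + Ln B = Ln C + Ln D + (of_int (2 * n) * pi) * \<i>"
    by (auto simp: exp_eq)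
  have im: "\<bar>Im (Ln X)\<bar> < pi / 2" if "0 < Re X" for X
    by (rule Re_Ln_pos_lt_imp[OF that])
  have "Im (Ln A) + Im (Ln B) = Im (Ln C) + Im (Ln D) + 2 * of_int n * pi"
    using arg_cong[OF n, of Im] by simp
  then have "\<bar>2 * of_int n * pi\<bar> < 2 * pi"
    using im[OF assms(1)] im[OF assms(2)] im[OF assms(3)] im[OF assms(4)] by linarith
  then have "\<bar>real_of_int n\<bar> < 1" by (simp add: abs_mult)
  then have "n = 0" by linarith
  with n show ?thesis by simp
qed

lemma Re_one_plus_pos:
  fixes x :: complex
  shows "cmod x < 1 \<Longrightarrow> 0 < Re (1 + x)"
  using abs_Re_le_cmod[of x] by simp

lemma Ln_linear_holomorphic:
  fixes k :: complex
  assumes "cmod k < 1"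
  obtains R where "1 < R" "(\<lambda>z. Ln (1 + k * z)) holomorphic_on ball 0 R"
proof
  define R where "R = (if k = 0 then 2 else 1 / cmod k)"
  show "1 < R" using assms by (auto simp: R_def)
  have "1 + k * z \<notin> \<real>\<^sub>\<le>\<^sub>0" if "z \<in> ball 0 R" for z
  proof -
    have "cmod (k * z) < 1"
      using that by (auto simp: R_def norm_mult divide_simps mult.commute split: if_splits)
    from Re_one_plus_pos[OF this] show ?thesis by (auto simp: complex_nonpos_Reals_iff)
  qed
  then show "(\<lambda>z. Ln (1 + k * z)) holomorphic_on ball 0 R"
    by (intro holomorphic_intros)
qed

interpretation fun_module: module "\<lambda>(c::complex) (f::complex \<Rightarrow> complex) z. c * f z"
  by (rule module_fun_scale)

lemma sum_scale_mem_span: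
  assumes "\<And>i. i \<in> I \<Longrightarrow> e i \<in> fun_module.span B"
  shows "(\<lambda>z. \<Sum>i\<in>I. k i * e i z) \<in> fun_module.span B"
  using assms
proof (induction I rule: infinite_finite_induct)
  case (insert i I)
  have "(\<lambda>z. k i * e i z) + (\<lambda>z. \<Sum>i\<in>I. k i * e i z) \<in> fun_module.span B"
    using insert by (intro fun_module.span_add fun_module.span_scale) auto
  then show ?case using insert by (simp add: plus_fun_def)
qed (use fun_module.span_zero[of B] in \<open>simp_all add: zero_fun_def\<close>)

section \<open>The operators of the theorem and the splitting of the kernels\<close>

locale lft_A2 = A2_space \<alpha> N Q + lft_self_map a b c d
  for \<alpha> N Q a b c d
begin

abbreviation restr :: "(complex \<Rightarrow> complex) \<Rightarrow> complex \<Rightarrow> complex" where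
  "restr f \<equiv> \<lambda>z. if z \<in> unit_disk then f z else 0"

lemma A2_holomorphic:
  assumes "u holomorphic_on ball 0 R" "1 < R"
  shows "restr u \<in> A2 \<alpha>"
  by (intro A2_restrict summable_dir_term_holomorphic[OF assms] holomorphic_on_subset[OF assms(1)])
    (use assms(2) in auto)

lemma A2_mult:
  assumes u: "u holomorphic_on ball 0 R" "1 < R" and f: "f \<in> A2 \<alpha>"
  shows "(\<lambda>z. u z * f z) \<in> A2 \<alpha>"
proof (rule A2_I)
  show "(\<lambda>z. u z * f z) holomorphic_on unit_disk"
    by (intro holomorphic_on_mult A2_D(1)[OF f] holomorphic_on_subset[OF u(1)]) (use u(2) in auto)
  show "u z * f z = 0" if "z \<notin> unit_disk" for z using A2_D(3)[OF f that] by simp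
  show "summable (dir_term (Suc N) (\<lambda>z. u z * f z))"
  proof -
    obtain C where "\<And>f. f holomorphic_on unit_disk \<Longrightarrow> summable (dir_term (Suc N) f) \<Longrightarrow>
       summable (dir_term (Suc N) (\<lambda>z. u z * f z)) \<and>
       dir_norm (Suc N) (\<lambda>z. u z * f z) \<le> C * dir_norm (Suc N) f"
      by (rule dir_norm_mult[OF u]) (rule that)
    then show ?thesis using A2_D[OF f] by blast
  qed
qed

lemma bounded_comp_op: "bounded_op (comp_op (moebius a b c d))"
proof -
  let ?\<phi> = "moebius a b c d"
  obtain C where C: "0 \<le> C"
    "\<And>f. f holomorphic_on unit_disk \<Longrightarrow> summable (dir_term (Suc N) f) \<Longrightarrow>
       summable (dir_term (Suc N) (\<lambda>z. f (?\<phi> z))) \<and>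
       dir_norm (Suc N) (\<lambda>z. f (?\<phi> z)) \<le> C * dir_norm (Suc N) f"
    by (rule dir_norm_comp) (rule that)
  have eq: "dir_term (Suc N) (comp_op ?\<phi> f) = dir_term (Suc N) (\<lambda>z. f (?\<phi> z))" for f
    by (rule dir_term_cong) (simp add: comp_op_def)
  have hol: "(\<lambda>z. f (?\<phi> z)) holomorphic_on unit_disk" if "f \<in> A2 \<alpha>" for f
    using holomorphic_on_compose_gen[OF moebius_holomorphic_disk A2_D(1)[OF that] self]
    by (simp add: o_def)
  have mem: "comp_op ?\<phi> f \<in> A2 \<alpha>" if f: "f \<in> A2 \<alpha>" for f
    unfolding comp_op_def using C(2)[OF A2_D(1,2)[OF f]] hol[OF f] by (intro A2_restrict) auto
  show ?thesis
    unfolding bounded_op_def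
  proof (intro conjI ballI allI)
    show "\<exists>C\<ge>0. \<forall>f\<in>A2 \<alpha>. dir_norm (Suc N) (comp_op ?\<phi> f) \<le> C * dir_norm (Suc N) f"
      using C A2_D(1,2) by (intro exI[of _ C]) (simp add: dir_norm_def eq)
    show "comp_op ?\<phi> f \<in> A2 \<alpha>" if "f \<in> A2 \<alpha>" for f by (rule mem[OF that])
  qed (auto simp: comp_op_def fun_eq_iff)
qed

text \<open>The symbol \<open>h\<close>, with its exponent \<open>\<alpha> + 2 = - N\<close> read as
  an integer power.\<close>

definition inv_den :: "complex \<Rightarrow> complex" where
  "inv_den z = 1 / (c * z + d) ^ N"

lemma inv_den_holomorphic: "inv_den holomorphic_on ball 0 pole_radius"
  using inverse_den_holomorphic[of N] by (simp add: inv_den_def[abs_def])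

lemma bounded_mult_op: "bounded_op (mult_op inv_den)"
proof -
  obtain C where C: "0 \<le> C"
    "\<And>f. f holomorphic_on unit_disk \<Longrightarrow> summable (dir_term (Suc N) f) \<Longrightarrow>
       summable (dir_term (Suc N) (\<lambda>z. inv_den z * f z)) \<and>
       dir_norm (Suc N) (\<lambda>z. inv_den z * f z) \<le> C * dir_norm (Suc N) f"
    by (rule dir_norm_mult[OF inv_den_holomorphic pole_radius_gt_1]) (rule that)
  have eq: "mult_op inv_den f = (\<lambda>z. inv_den z * f z)" if "f \<in> A2 \<alpha>" for f
    using A2_D(3)[OF that] by (auto simp: mult_op_def)
  show ?thesis
    unfolding bounded_op_def
  proof (intro conjI ballI allI)
    show "mult_op inv_den f \<in> A2 \<alpha>" if "f \<in> A2 \<alpha>" for f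
      unfolding eq[OF that] by (rule A2_mult[OF inv_den_holomorphic pole_radius_gt_1 that])
    show "\<exists>C\<ge>0. \<forall>f\<in>A2 \<alpha>. dir_norm (Suc N) (mult_op inv_den f) \<le> C * dir_norm (Suc N) f"
      using C A2_D(1,2) by (intro exI[of _ C]) (simp add: eq)
  qed (auto simp: mult_op_def fun_eq_iff algebra_simps)
qed

text \<open>The denominator of the Krein adjoint; its \<open>N\<close>-th power is the symbol
  \<open>g\<close>.\<close>

definition adj_den :: "complex \<Rightarrow> complex" where
  "adj_den z = - cnj b * z + cnj d"

abbreviation krein :: "complex \<Rightarrow> complex" where
  "krein \<equiv> krein_adjoint a b c d"

lemma adj_den_nonzero:
  assumes "z \<in> unit_disk" shows "adj_den z \<noteq> 0"
proof
  assume "adj_den z = 0"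
  then have "cmod d = cmod b * cmod z"
    by (metis adj_den_def add.commute complex_mod_cnj diff_eq_eq mult_minus_left norm_mult uminus_add_conv_diff add_0)
  also have "\<dots> \<le> cmod b * 1" using assms by (intro mult_left_mono) auto
  finally show False using norm_b_less by simp
qed

lemma krein_eq: "krein z = (cnj a * z - cnj c) / adj_den z"
  by (simp add: krein_adjoint_def moebius_def adj_den_def)

text \<open>Both sides are the same polynomial in \<open>w\<close> and \<open>cnj z\<close>, grouped
  once by \<open>w\<close> and once by \<open>cnj z\<close>. Leaving \<open>w\<close> arbitrary
  allows points of the unit circle in \<open>krein_self\<close>.\<close>

lemma krein_identity:
  assumes "z \<in> unit_disk"
  shows "(c * w + d) - cnj z * (a * w + b) = cnj (adj_den z) * (1 - cnj (krein z) * w)"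
proof -
  have "cnj (adj_den z) * cnj (krein z) = a * cnj z - c"
    using adj_den_nonzero[OF assms] by (simp add: krein_eq)
  then have "cnj (adj_den z) * (1 - cnj (krein z) * w) = cnj (adj_den z) - (a * cnj z - c) * w"
    by (simp add: right_diff_distrib flip: mult.assoc)
  then show ?thesis by (simp add: adj_den_def algebra_simps)
qed

text \<open>If \<open>krein z\<close> had modulus at least 1, then at
  \<open>w = 1 / cnj (krein z)\<close> in the closed disk the identity would give
  \<open>|c w + d| = |z| |a w + b| \<le> |z| |c w + d|\<close>, impossible since
  \<open>|z| < 1\<close> and \<open>c w + d\<close> is nonzero.\<close>

lemma krein_self:
  assumes z: "z \<in> unit_disk" shows "krein z \<in> unit_disk"
proof (rule ccontr)
  assume "krein z \<notin> unit_disk"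
  then have ge: "1 \<le> cmod (krein z)" by simp
  define w where "w = 1 / cnj (krein z)"
  have w: "cmod w \<le> 1" using ge by (simp add: w_def norm_divide divide_le_eq_1)
  have "cnj (krein z) \<noteq> 0" using ge by auto
  then have "cnj (krein z) * w = 1" by (simp add: w_def)
  then have "c * w + d = cnj z * (a * w + b)" using krein_identity[OF z, of w] by simp
  then have "cmod (c * w + d) = cmod z * cmod (a * w + b)" by (metis complex_mod_cnj norm_mult)
  also have "\<dots> \<le> cmod z * cmod (c * w + d)" by (intro mult_left_mono norm_num_le_den w) simp
  finally have "(1 - cmod z) * cmod (c * w + d) \<le> 0" by (simp add: algebra_simps)
  moreover have "0 < cmod (c * w + d)" using den_bounds(1)[OF w] norm_c_less by linarith
  ultimately show False using z by (simp add: mult_le_0_iff)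
qed

text \<open>Dividing \<open>krein_identity\<close> by \<open>d\<close> normalises the one-variable
  factors to \<open>1 + c / d * w\<close> and \<open>1 - b / d * cnj z\<close>. As
  \<open>|b|\<close> and \<open>|c|\<close> are below \<open>|d|\<close>, all four factors lie in
  the right half plane, and the principal logarithms add without a branch correction.\<close>

lemma kernel_log_identity:
  assumes z: "z \<in> unit_disk" and w: "w \<in> unit_disk"
  shows "Ln (1 / (1 - cnj z * moebius a b c d w)) - Ln (1 / (1 - cnj (krein z) * w))
       = Ln (1 + c / d * w) - Ln (1 - b / d * cnj z)"
proof -
  have lt: "cmod (cnj x * y) < 1" if "x \<in> unit_disk" "y \<in> unit_disk" for x y
  proof -
    have "cmod x * cmod y < 1 * 1" using that by (intro mult_strict_mono') auto
    then show ?thesis by (simp add: norm_mult)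
  qed
  have mw: "moebius a b c d w \<in> unit_disk" using self w by blast
  have A: "0 < Re (1 - cnj z * moebius a b c d w)"
    using Re_one_plus_pos[of "- (cnj z * moebius a b c d w)"] lt[OF z mw] by simp
  have C: "0 < Re (1 - cnj (krein z) * w)"
    using Re_one_plus_pos[of "- (cnj (krein z) * w)"] lt[OF krein_self[OF z] w] by simp
  have B: "0 < Re (1 + c / d * w)"
    by (intro Re_one_plus_pos norm_less_pole_radius) (use w pole_radius_gt_1 in auto)
  have D: "0 < Re (1 - b / d * cnj z)"
  proof -
    have "cmod b * cmod z \<le> cmod b * 1" using z by (intro mult_left_mono) auto
    also have "\<dots> < cmod d" using norm_b_less by simp
    finally have "cmod (- (b / d * cnj z)) < 1"
      using d_nonzero by (simp add: norm_mult norm_divide)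
    from Re_one_plus_pos[OF this] show ?thesis by simp
  qed
  have L: "c * w + d \<noteq> 0" by (rule den[OF w])
  have "(1 - cnj z * moebius a b c d w) * (1 + c / d * w)
      = ((c * w + d) - cnj z * (a * w + b)) / (c * w + d) * ((c * w + d) / d)"
  proof -
    have "1 - cnj z * moebius a b c d w = ((c * w + d) - cnj z * (a * w + b)) / (c * w + d)"
      using L by (simp add: moebius_def diff_divide_distrib)
    moreover have "1 + c / d * w = (c * w + d) / d"
      using d_nonzero by (simp add: add_divide_distrib)
    ultimately show ?thesis by simp
  qed
  also have "\<dots> = ((c * w + d) - cnj z * (a * w + b)) / d" using L by simp
  also have "\<dots> = (1 - cnj (krein z) * w) * (cnj (adj_den z) / d)"
    unfolding krein_identity[OF z] by simp
  also have "cnj (adj_den z) / d = 1 - b / d * cnj z"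
    using d_nonzero by (simp add: adj_den_def diff_divide_distrib add_divide_distrib)
  finally have "Ln (1 - cnj z * moebius a b c d w) + Ln (1 + c / d * w)
      = Ln (1 - cnj (krein z) * w) + Ln (1 - b / d * cnj z)"
    by (rule Ln_mult_right_half_plane[OF A B C D])
  moreover have "Ln (1 / x) = - Ln x" if "0 < Re x" for x
    using Ln_inverse[of x] that by (auto simp: inverse_eq_divide complex_nonpos_Reals_iff)
  ultimately show ?thesis using A C by (simp add: algebra_simps)
qed

text \<open>The coefficient of \<open>x ^ i\<close> in \<open>(x - 1) ^ N\<close>.\<close>

definition binom_coeff :: "nat \<Rightarrow> complex" where
  "binom_coeff i = of_nat (N choose i) * (- 1) ^ (N - i)"

text \<open>The first sum collects the logarithm in \<open>w\<close> and the polynomial part at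
  \<open>\<phi>(w)\<close>, the second the logarithm in \<open>z\<close>, the third the polynomial
  part at \<open>krein z\<close>. The factors in \<open>z\<close> are written as conjugates because
  the inner product is conjugate-linear in its second argument and will return them
  analytic.\<close>

lemma kernel_difference:
  assumes z: "z \<in> unit_disk" and w: "w \<in> unit_disk"
  shows "comp_op (moebius a b c d) (A2_kernel N Q z) w
      - cnj (adj_den z ^ N) * mult_op inv_den (A2_kernel N Q (krein z)) w
    = (\<Sum>i\<le>N. cnj (z ^ i) * (binom_coeff i * (Ln (1 + c / d * w) * moebius a b c d w ^ i)
                + coeff Q i * moebius a b c d w ^ i))
      + (\<Sum>i\<le>N. cnj (z ^ i * Ln (1 - cnj (b / d) * z)) * (- binom_coeff i * moebius a b c d w ^ i))
      + (\<Sum>i\<le>N. cnj (adj_den z ^ (N - i) * (cnj a * z - cnj c) ^ i) * (- coeff Q i * (inv_den w * w ^ i)))"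
proof -
  define m where "m = moebius a b c d w"
  define E where "E = cnj (adj_den z)"
  define L where "L = c * w + d"
  define s where "s = cnj (krein z)"
  define \<zeta> where "\<zeta> = cnj z"
  have L: "L \<noteq> 0" using den[OF w] by (simp add: L_def)
  have E: "E \<noteq> 0" using adj_den_nonzero[OF z] by (simp add: E_def)
  have m_in: "m \<in> unit_disk" using self_lt[of w] w by (simp add: m_def)
  have Es: "E * s = a * \<zeta> - c"
    using E by (simp add: E_def s_def krein_eq \<zeta>_def)
  have id: "1 - \<zeta> * m = E * (1 - s * w) / L"
  proof -
    have "1 - \<zeta> * m = (L - \<zeta> * (a * w + b)) / L"
      using L by (simp add: m_def moebius_def L_def diff_divide_distrib)
    also have "L - \<zeta> * (a * w + b) = E * (1 - s * w)"
      unfolding L_def \<zeta>_def E_def s_def by (rule krein_identity[OF z])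
    finally show ?thesis .
  qed
  \<comment> \<open>This equality of the factors in front of the two logarithms is what
    \<open>g\<close> and \<open>h\<close> are chosen for.\<close>
  then have id': "(\<zeta> * m - 1) ^ N = E ^ N * (s * w - 1) ^ N * inv_den w"
  proof -
    have "\<zeta> * m - 1 = E * (s * w - 1) / L" using id L by (simp add: field_simps)
    then show ?thesis by (simp add: power_mult_distrib power_divide inv_den_def L_def)
  qed
  have cnjLn: "cnj (Ln (1 - cnj (b / d) * z)) = Ln (1 - b / d * \<zeta>)"
  proof -
    have "cmod b * cmod z \<le> cmod b * 1" using z by (intro mult_left_mono) auto
    also have "\<dots> < cmod d" using norm_b_less by simp
    finally have "cmod (- (cnj (b / d) * z)) < 1"
      using d_nonzero by (simp add: norm_mult norm_divide)
    from Re_one_plus_pos[OF this] have "1 - cnj (b / d) * z \<notin> \<real>\<^sub>\<le>\<^sub>0"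
      by (auto simp: complex_nonpos_Reals_iff)
    then show ?thesis by (subst cnj_Ln) (simp_all add: \<zeta>_def)
  qed
  have bin: "(\<zeta> * m - 1) ^ N = (\<Sum>i\<le>N. \<zeta> ^ i * (binom_coeff i * m ^ i))"
    using binomial_ring[of "\<zeta> * m" "-1" N]
    by (simp add: binom_coeff_def power_mult_distrib mult_ac)
  have degQ: "degree Q = N" using Q by (simp add: admissible_poly_def)
  have polyQ: "poly Q x = (\<Sum>i\<le>N. coeff Q i * x ^ i)" for x by (simp add: poly_altdef degQ)
  \<comment> \<open>Since \<open>Q\<close> has degree \<open>N\<close>, the factor
    \<open>E ^ N\<close> clears all denominators of \<open>s\<close>, and only polynomials in
    \<open>cnj z\<close> remain.\<close>
  have EQ: "E ^ N * poly Q (s * w) = (\<Sum>i\<le>N. (E ^ (N - i) * (a * \<zeta> - c) ^ i) * (coeff Q i * w ^ i))"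
    unfolding polyQ sum_distrib_left
  proof (rule sum.cong[OF refl])
    fix i assume "i \<in> {..N}"
    then have EN: "E ^ N = E ^ (N - i) * E ^ i" by (simp flip: power_add)
    show "E ^ N * (coeff Q i * (s * w) ^ i) = (E ^ (N - i) * (a * \<zeta> - c) ^ i) * (coeff Q i * w ^ i)"
      unfolding Es[symmetric] power_mult_distrib EN by (simp add: mult_ac)
  qed
  have "comp_op (moebius a b c d) (A2_kernel N Q z) w
      - cnj (adj_den z ^ N) * mult_op inv_den (A2_kernel N Q (krein z)) w
    = (\<zeta> * m - 1) ^ N * Ln (1 / (1 - \<zeta> * m)) + poly Q (\<zeta> * m)
      - E ^ N * (inv_den w * ((s * w - 1) ^ N * Ln (1 / (1 - s * w)) + poly Q (s * w)))"
    using w m_in by (simp add: comp_op_def mult_op_def A2_kernel_def kernel_fun_def m_def \<zeta>_def E_def s_def)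
  also have "\<dots> = (\<zeta> * m - 1) ^ N * (Ln (1 / (1 - \<zeta> * m)) - Ln (1 / (1 - s * w)))
      + poly Q (\<zeta> * m) - inv_den w * (E ^ N * poly Q (s * w))"
    by (simp add: id' algebra_simps)
  also have "Ln (1 / (1 - \<zeta> * m)) - Ln (1 / (1 - s * w)) = Ln (1 + c / d * w) - Ln (1 - b / d * \<zeta>)"
    unfolding \<zeta>_def m_def s_def by (rule kernel_log_identity[OF z w])
  also have "(\<zeta> * m - 1) ^ N * (Ln (1 + c / d * w) - Ln (1 - b / d * \<zeta>)) + poly Q (\<zeta> * m) - inv_den w * (E ^ N * poly Q (s * w))
    = (\<Sum>i\<le>N. \<zeta> ^ i * (binom_coeff i * (Ln (1 + c / d * w) * m ^ i) + coeff Q i * m ^ i))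
      + (\<Sum>i\<le>N. (\<zeta> ^ i * Ln (1 - b / d * \<zeta>)) * (- binom_coeff i * m ^ i))
      + (\<Sum>i\<le>N. (E ^ (N - i) * (a * \<zeta> - c) ^ i) * (- coeff Q i * (inv_den w * w ^ i)))"
    unfolding bin EQ polyQ[of "\<zeta> * m"]
    by (simp add: sum_distrib_left sum_distrib_right sum.distrib[symmetric] sum_subtractf[symmetric]
        sum_negf[symmetric] power_mult_distrib algebra_simps)
  finally show ?thesis
    by (simp only: m_def \<zeta>_def E_def cnjLn[unfolded \<zeta>_def] complex_cnj_mult complex_cnj_power
        complex_cnj_diff complex_cnj_cnj)
qed

lemma Ln_den_holomorphic: "(\<lambda>w. Ln (1 + c / d * w)) holomorphic_on ball 0 pole_radius"
proof -
  have "1 + c / d * w \<notin> \<real>\<^sub>\<le>\<^sub>0" if "w \<in> ball 0 pole_radius" for w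
    using Re_one_plus_pos[OF norm_less_pole_radius[OF that]] by (auto simp: complex_nonpos_Reals_iff)
  then show ?thesis by (intro holomorphic_intros) auto
qed

lemma finite_rank_difference:
  "finite_rank_on (A2 \<alpha>)
    (\<lambda>f z. adjoint_on (A2 \<alpha>) ip (comp_op (moebius a b c d)) f z
         - mult_op (\<lambda>z. adj_den z ^ N) (comp_op krein (adjoint_on (A2 \<alpha>) ip (mult_op inv_den) f)) z)"
    (is "finite_rank_on _ ?D")
proof -
  \<comment> \<open>The \<open>e\<close> functions depend on \<open>z\<close> and span the range;
    the \<open>P\<close> functions depend on \<open>w\<close> and are paired with \<open>f\<close>
    to give the coefficients. Both kinds extend analytically across the circle, hence lie in the
    space.\<close>
  define e1 where "e1 = (\<lambda>i::nat. restr (\<lambda>z. z ^ i))"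
  define e2 where "e2 = (\<lambda>i::nat. restr (\<lambda>z. z ^ i * Ln (1 - cnj (b / d) * z)))"
  define e3 where "e3 = (\<lambda>i::nat. restr (\<lambda>z. adj_den z ^ (N - i) * (cnj a * z - cnj c) ^ i))"
  define P1 where "P1 = (\<lambda>i. restr (\<lambda>w. binom_coeff i * (Ln (1 + c / d * w) * moebius a b c d w ^ i)
      + coeff Q i * moebius a b c d w ^ i))"
  define P2 where "P2 = (\<lambda>i. restr (\<lambda>w. - binom_coeff i * moebius a b c d w ^ i))"
  define P3 where "P3 = (\<lambda>i. restr (\<lambda>w. - coeff Q i * (inv_den w * w ^ i)))"
  have e1: "e1 i \<in> A2 \<alpha>" and e3: "e3 i \<in> A2 \<alpha>" for i
    unfolding e1_def e3_def adj_den_def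
    by (intro A2_holomorphic[of _ 2] holomorphic_intros; simp)+
  have e2: "e2 i \<in> A2 \<alpha>" for i
  proof -
    have "cmod (- cnj (b / d)) < 1" using norm_b_less d_nonzero by (simp add: norm_divide)
    then obtain R where "1 < R" "(\<lambda>z. Ln (1 + - cnj (b / d) * z)) holomorphic_on ball 0 R"
      by (rule Ln_linear_holomorphic)
    then show ?thesis unfolding e2_def
      by (intro A2_holomorphic[of _ R] holomorphic_on_mult holomorphic_on_power holomorphic_on_ident) simp_all
  qed
  have P: "P1 i \<in> A2 \<alpha>" "P2 i \<in> A2 \<alpha>" "P3 i \<in> A2 \<alpha>" for i
    unfolding P1_def P2_def P3_def
    by (intro A2_holomorphic[OF _ pole_radius_gt_1] holomorphic_intros moebius_holomorphic
        inv_den_holomorphic Ln_den_holomorphic)+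
  have D_eq: "?D f = (\<lambda>z. (\<Sum>i\<le>N. ip f (P1 i) * e1 i z) + (\<Sum>i\<le>N. ip f (P2 i) * e2 i z)
      + (\<Sum>i\<le>N. ip f (P3 i) * e3 i z))" if f: "f \<in> A2 \<alpha>" for f
  proof
    fix z
    show "?D f z = (\<Sum>i\<le>N. ip f (P1 i) * e1 i z) + (\<Sum>i\<le>N. ip f (P2 i) * e2 i z)
      + (\<Sum>i\<le>N. ip f (P3 i) * e3 i z)"
    proof (cases "z \<in> unit_disk")
      case True
      note z = True
      let ?X = "comp_op (moebius a b c d) (A2_kernel N Q z)"
      let ?Y = "mult_op inv_den (A2_kernel N Q (krein z))"
      have X: "?X \<in> A2 \<alpha>" using bounded_comp_op A2_kernel_mem[OF z] by (simp add: bounded_op_def)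
      have Y: "?Y \<in> A2 \<alpha>"
        using bounded_mult_op A2_kernel_mem[OF krein_self[OF z]] by (simp add: bounded_op_def)
      have S: "(\<lambda>w. \<Sum>i\<le>N. cnj (e i z) * P i w) \<in> A2 \<alpha>"
        "ip f (\<lambda>w. \<Sum>i\<le>N. cnj (e i z) * P i w) = (\<Sum>i\<le>N. ip f (P i) * e i z)"
        if "\<And>i. P i \<in> A2 \<alpha>" for e P
      proof -
        show "(\<lambda>w. \<Sum>i\<le>N. cnj (e i z) * P i w) \<in> A2 \<alpha>" by (intro A2_sum A2_cmult that)
        show "ip f (\<lambda>w. \<Sum>i\<le>N. cnj (e i z) * P i w) = (\<Sum>i\<le>N. ip f (P i) * e i z)"
          unfolding ip_sum_right[OF f A2_cmult[OF that]] ip_cmult_right[OF that f]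
          by (simp add: mult.commute)
      qed
      have fe: "(\<lambda>w. ?X w + (- cnj (adj_den z ^ N)) * ?Y w)
        = (\<lambda>w. ((\<Sum>i\<le>N. cnj (e1 i z) * P1 i w) + (\<Sum>i\<le>N. cnj (e2 i z) * P2 i w))
            + (\<Sum>i\<le>N. cnj (e3 i z) * P3 i w))"
      proof
        fix w
        show "?X w + (- cnj (adj_den z ^ N)) * ?Y w
          = ((\<Sum>i\<le>N. cnj (e1 i z) * P1 i w) + (\<Sum>i\<le>N. cnj (e2 i z) * P2 i w))
            + (\<Sum>i\<le>N. cnj (e3 i z) * P3 i w)"
        proof (cases "w \<in> unit_disk")
          case True
          have "?X w + (- cnj (adj_den z ^ N)) * ?Y w = ?X w - cnj (adj_den z ^ N) * ?Y w" by simp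
          also note kernel_difference[OF z True]
          finally show ?thesis
            unfolding e1_def e2_def e3_def P1_def P2_def P3_def using z True by (simp only: if_True)
        next
          case False
          then show ?thesis by (simp add: comp_op_def mult_op_def P1_def P2_def P3_def)
        qed
      qed
      have "?D f z = ip f ?X - adj_den z ^ N * ip f ?Y"
        using z krein_self[OF z] adjoint_on_eval[OF bounded_comp_op f z]
          adjoint_on_eval[OF bounded_mult_op f krein_self[OF z]]
        by (simp add: mult_op_def[of "\<lambda>z. adj_den z ^ N"] comp_op_def[of krein])
      also have "\<dots> = ip f (\<lambda>w. ?X w + (- cnj (adj_den z ^ N)) * ?Y w)"
        unfolding ip_add_right[OF X A2_cmult[OF Y] f] ip_cmult_right[OF Y f] by simp
      also have "\<dots> = ip f (\<lambda>w. \<Sum>i\<le>N. cnj (e1 i z) * P1 i w) + ip f (\<lambda>w. \<Sum>i\<le>N. cnj (e2 i z) * P2 i w)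
          + ip f (\<lambda>w. \<Sum>i\<le>N. cnj (e3 i z) * P3 i w)"
        unfolding fe by (subst ip_add_right ip_add_right; (intro A2_add S(1) P f refl)?)+
      finally show ?thesis by (simp only: S(2)[where P = P1, OF P(1)] S(2)[where P = P2, OF P(2)] S(2)[where P = P3, OF P(3)])
    next
      case False
      then have "?D f z = 0"
        using A2_D(3)[OF adjoint_on_spec(1)[OF bounded_comp_op f]] by (simp add: mult_op_def)
      with False show ?thesis by (simp add: e1_def e2_def e3_def)
    qed
  qed
  define B where "B = e1 ` {..N} \<union> e2 ` {..N} \<union> e3 ` {..N}"
  have "?D f \<in> fun_module.span B" if f: "f \<in> A2 \<alpha>" for f
  proof -
    have sp: "(\<lambda>z. \<Sum>i\<le>N. k i * e i z) \<in> fun_module.span B" if "e ` {..N} \<subseteq> B" for k e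
      using that by (intro sum_scale_mem_span fun_module.span_base) auto
    have "((\<lambda>z. \<Sum>i\<le>N. ip f (P1 i) * e1 i z) + (\<lambda>z. \<Sum>i\<le>N. ip f (P2 i) * e2 i z))
      + (\<lambda>z. \<Sum>i\<le>N. ip f (P3 i) * e3 i z) \<in> fun_module.span B"
      by (intro fun_module.span_add sp) (auto simp: B_def)
    then show ?thesis unfolding D_eq[OF f] by (simp add: plus_fun_def)
  qed
  then show ?thesis
    unfolding finite_rank_on_def
    by (intro exI[of _ B]) (auto simp: B_def e1 e2 e3)
qed

end

theorem theorem2p8:
  fixes \<alpha> :: real and N :: nat and Q :: "complex poly"
    and a b c d :: complex and \<phi> \<sigma> g h :: "complex \<Rightarrow> complex"
  assumes "\<alpha> + 2 = - real N"
    and "admissible_poly N Q"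
    and "a * d - b * c \<noteq> 0"
    and "\<And>z. z \<in> unit_disk \<Longrightarrow> c * z + d \<noteq> 0"
    and "\<phi> = moebius a b c d"
    and "\<phi> ` unit_disk \<subseteq> unit_disk"
    and "\<sigma> = krein_adjoint a b c d"
    and "\<And>z. z \<in> unit_disk \<Longrightarrow> g z = (- cnj b * z + cnj d) powr complex_of_real (- \<alpha> - 2)"
    and "\<And>z. z \<in> unit_disk \<Longrightarrow> h z = (c * z + d) powr complex_of_real (\<alpha> + 2)"
  shows "finite_rank_on (A2 \<alpha>)
    (\<lambda>f z. adjoint_on (A2 \<alpha>) (A2_inner N Q) (comp_op \<phi>) f z
         - mult_op g (comp_op \<sigma> (adjoint_on (A2 \<alpha>) (A2_inner N Q) (mult_op h) f)) z)"
proof -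
  interpret lft_A2 \<alpha> N Q a b c d
    by unfold_locales (use assms in auto)
  have g: "mult_op g = mult_op (\<lambda>z. adj_den z ^ N)"
  proof -
    have "g z = adj_den z ^ N" if "z \<in> unit_disk" for z
    proof -
      \<comment> \<open>The exponent is an integer and the base is nonzero on the disk, so
        \<open>powr\<close> is an ordinary power, free of any branch choice.\<close>
      have "complex_of_real (- \<alpha> - 2) = of_nat N" using assms(1) by (simp add: complex_eq_iff)
      then show ?thesis
        using assms(8)[OF that] adj_den_nonzero[OF that] by (simp add: adj_den_def powr_nat)
    qed
    then show ?thesis by (auto simp: mult_op_def fun_eq_iff)
  qed
  have h: "mult_op h = mult_op inv_den"
  proof -
    have "h z = inv_den z" if "z \<in> unit_disk" for z
    proof -
      have "complex_of_real (\<alpha> + 2) = - of_nat N" using assms(1) by (simp add: complex_eq_iff)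
      then show ?thesis
        using assms(9)[OF that] den[OF that] by (simp add: inv_den_def powr_minus powr_nat inverse_eq_divide)
    qed
    then show ?thesis by (auto simp: mult_op_def fun_eq_iff)
  qed
  show ?thesis
    unfolding g h assms(5,7) by (rule finite_rank_difference)
qed

end
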